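(* Let $\mathcal{G}$ be a (finite-dimensional) complex simple Lie algebra with invariant scalar product $\langle\ ,\ \rangle$, and let $G$ be a connected complex Lie group with Lie algebra $\mathcal{G}$. Let $F$ be an odd complex function ($F(-z)=-F(z)$) that is holomorphic in a neighbourhood of $z=0$. Let $\check{\mathcal{G}}\subset\mathcal{G}$ be an open $\mathrm{Ad}_G$-invariant neighbourhood of $0$ which the exponential map sends diffeomorphically onto an open set $\check G=\exp(\check{\mathcal{G}})\subset G$, and on which $F(\mathrm{ad}_\omega)$ is defined by the Taylor series of $F$ at $0$. Define $$R:\check G\to\mathrm{End}(\mathcal{G}),\qquad R(e^\omega)=F(\mathrm{ad}_\omega)\qquad(\omega\in\check{\mathcal{G}}),$$ and let $\mu\in\mathbb{C}$. Then $R$ satisfies the PL-CDYBE $$\Big\langle[R(\Omega)X,R(\Omega)Y]-\tfrac12\,(\mathcal{D}^+_XR(\Omega))Y,\;Z\Big\rangle+\text{cycl. perm.}(X,Y,Z)=\mu\,\langle[X,Y],Z\rangle\qquad\forall X,Y,Z\in\mathcal{G},\ \forall\Omega\in\check G$$ if and only if $F=F_\nu$ (near $z=0$), where $$F_\nu(z)=\nu\coth(\nu z)-\tfrac12\coth(\tfrac12z)$$ and $\nu\in\mathbb{C}$ is a constant related to $\mu$ by $\mu=\frac14-\nu^2$. (Here $\nu$ can be arbitrary: each $\nu\in\mathbb{C}$ yields a solution, with $\mu=\frac14-\nu^2$.)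
   Context: An invariant scalar product is a nondegenerate symmetric bilinear form with $\langle[X,Y],Z\rangle=\langle X,[Y,Z]\rangle$. For $R:\check G\to\mathrm{End}(\mathcal{G})$ and $X\in\mathcal{G}$, $$\mathcal{D}^+_XR(\Omega)=\frac{d}{dt}\Big|_{t=0}R(e^{tX}\Omega e^{tX}).$$ "cycl. perm.$(X,Y,Z)$" means adding the two terms obtained from the displayed one by cyclic permutations of $X,Y,Z$. The singularities of $F_\nu$ at $z=0$ cancel, so $F_\nu$ is regarded as holomorphic near $0$ with $F_\nu(0)=0$; for $\nu=0$, $\nu\coth(\nu z)$ is understood as its limit $z^{-1}$. The displayed equation is the PL-CDYBE (Poisson-Lie analogue of the classical dynamical Yang-Baxter equation). It is equivalent to $[R_{12},R_{13}]+\frac12T^a_3\mathcal{D}^+_{T_a}R_{12}+\text{cycl. perm.}=\mu f$ on $\check G$, where $\{T_a\},\{T^a\}$ are dual bases of $\mathcal{G}$ with $\langle T_a,T^b\rangle=\delta_a^b$, $[T_a,T_b]=f_{ab}^cT_c$, $f=f_{ab}^cT^a\otimes T^b\otimes T_c$ (repeated indices summed), cyclic permutations act on the tensor labels $1,2,3$, and $\mathcal{G}\otimes\mathcal{G}$ is identified with $\mathrm{End}(\mathcal{G})$ by $A\otimes B\mapsto A\langle B,\cdot\rangle$. *)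

theory Defs
  imports "HOL-Complex_Analysis.Complex_Analysis" "HOL-Algebra.Group"
begin

section \<open>Complex simple Lie algebras with invariant scalar product\<close>

text \<open>
  A finite-dimensional complex vector space is a Euclidean space together with a multiplication by
  complex scalars that extends the real one.  The Euclidean norm only serves to provide the unique
  vector space topology; the Euclidean inner product plays no role.
\<close>

locale complex_fd_space = vector_space cs
  for cs :: "complex \<Rightarrow> 'a::euclidean_space \<Rightarrow> 'a" +
  assumes cs_of_real: "cs (complex_of_real r) x = r *\<^sub>R x"

locale complex_lie_algebra = complex_fd_space cs
  for cs :: "complex \<Rightarrow> 'a::euclidean_space \<Rightarrow> 'a" +
  fixes br :: "'a \<Rightarrow> 'a \<Rightarrow> 'a"
  assumes br_linear_right: "Vector_Spaces.linear cs cs (\<lambda>y. br x y)"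
    and br_linear_left: "Vector_Spaces.linear cs cs (\<lambda>x. br x y)"
    and br_self: "br x x = 0"
    and jacobi: "br x (br y z) + br y (br z x) + br z (br x y) = 0"

definition lie_ideal ::
    "(complex \<Rightarrow> 'a::euclidean_space \<Rightarrow> 'a) \<Rightarrow> ('a \<Rightarrow> 'a \<Rightarrow> 'a) \<Rightarrow> 'a set \<Rightarrow> bool" where
  "lie_ideal cs br I \<longleftrightarrow> module.subspace cs I \<and> (\<forall>x. \<forall>y\<in>I. br x y \<in> I)"

locale simple_complex_lie_algebra = complex_lie_algebra cs br
  for cs :: "complex \<Rightarrow> 'a::euclidean_space \<Rightarrow> 'a" and br :: "'a \<Rightarrow> 'a \<Rightarrow> 'a" +
  assumes non_abelian: "\<exists>x y. br x y \<noteq> 0"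
    and simple: "lie_ideal cs br I \<Longrightarrow> I = {0} \<or> I = UNIV"

definition invariant_scalar_product ::
    "(complex \<Rightarrow> 'a::euclidean_space \<Rightarrow> 'a) \<Rightarrow> ('a \<Rightarrow> 'a \<Rightarrow> 'a) \<Rightarrow> ('a \<Rightarrow> 'a \<Rightarrow> complex) \<Rightarrow> bool" where
  "invariant_scalar_product cs br B \<longleftrightarrow>
     (\<forall>x. Vector_Spaces.linear cs (*) (\<lambda>y. B x y)) \<and>
     (\<forall>y. Vector_Spaces.linear cs (*) (\<lambda>x. B x y)) \<and>
     (\<forall>x y. B x y = B y x) \<and>
     (\<forall>x. (\<forall>y. B x y = 0) \<longrightarrow> x = 0) \<and>
     (\<forall>x y z. B (br x y) z = B x (br y z))"


section \<open>Complex manifolds\<close>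

definition holomorphic_on_space ::
    "(complex \<Rightarrow> 'a::euclidean_space \<Rightarrow> 'a) \<Rightarrow> (complex \<Rightarrow> 'b::euclidean_space \<Rightarrow> 'b)
     \<Rightarrow> 'a set \<Rightarrow> ('a \<Rightarrow> 'b) \<Rightarrow> bool" where
  "holomorphic_on_space s1 s2 S f \<longleftrightarrow>
     (\<forall>x\<in>S. \<exists>D. Vector_Spaces.linear s1 s2 D \<and> (f has_derivative D) (at x))"

text \<open>
  A chart is a pair of its domain and the coordinate map; the values of the coordinate map outside
  the domain are irrelevant.
\<close>

type_synonym ('m, 'a) chart = "'m set \<times> ('m \<Rightarrow> 'a)"

definition complex_manifold ::
    "(complex \<Rightarrow> 'a::euclidean_space \<Rightarrow> 'a) \<Rightarrow> 'm topology \<Rightarrow> ('m, 'a) chart set \<Rightarrow> bool" where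
  "complex_manifold cs T A \<longleftrightarrow>
     complex_fd_space cs \<and> Hausdorff_space T \<and> second_countable T \<and>
     (\<forall>(U, \<phi>)\<in>A. openin T U \<and> open (\<phi> ` U) \<and>
        homeomorphic_map (subtopology T U) (top_of_set (\<phi> ` U)) \<phi>) \<and>
     (\<Union>(U, \<phi>)\<in>A. U) = topspace T \<and>
     (\<forall>(U, \<phi>)\<in>A. \<forall>(V, \<psi>)\<in>A.
        holomorphic_on_space cs cs (\<phi> ` (U \<inter> V)) (\<psi> \<circ> inv_into U \<phi>))"

definition holomorphic_map ::
    "(complex \<Rightarrow> 'a::euclidean_space \<Rightarrow> 'a) \<Rightarrow> 'm topology \<Rightarrow> ('m, 'a) chart set
     \<Rightarrow> (complex \<Rightarrow> 'b::euclidean_space \<Rightarrow> 'b) \<Rightarrow> 'n topology \<Rightarrow> ('n, 'b) chart set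
     \<Rightarrow> ('m \<Rightarrow> 'n) \<Rightarrow> bool" where
  "holomorphic_map s1 T1 A1 s2 T2 A2 f \<longleftrightarrow>
     continuous_map T1 T2 f \<and>
     (\<forall>(U, \<phi>)\<in>A1. \<forall>(V, \<psi>)\<in>A2.
        holomorphic_on_space s1 s2 (\<phi> ` {x \<in> U. f x \<in> V}) (\<psi> \<circ> f \<circ> inv_into U \<phi>))"

definition biholomorphic_map ::
    "(complex \<Rightarrow> 'a::euclidean_space \<Rightarrow> 'a) \<Rightarrow> 'm topology \<Rightarrow> ('m, 'a) chart set
     \<Rightarrow> (complex \<Rightarrow> 'b::euclidean_space \<Rightarrow> 'b) \<Rightarrow> 'n topology \<Rightarrow> ('n, 'b) chart set
     \<Rightarrow> ('m \<Rightarrow> 'n) \<Rightarrow> bool" where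
  "biholomorphic_map s1 T1 A1 s2 T2 A2 f \<longleftrightarrow>
     holomorphic_map s1 T1 A1 s2 T2 A2 f \<and>
     (\<exists>g. holomorphic_map s2 T2 A2 s1 T1 A1 g \<and>
          (\<forall>x\<in>topspace T1. g (f x) = x) \<and> (\<forall>y\<in>topspace T2. f (g y) = y))"

definition prod_scale ::
    "(complex \<Rightarrow> 'a \<Rightarrow> 'a) \<Rightarrow> (complex \<Rightarrow> 'b \<Rightarrow> 'b) \<Rightarrow> complex \<Rightarrow> 'a \<times> 'b \<Rightarrow> 'a \<times> 'b" where
  "prod_scale s1 s2 c = map_prod (s1 c) (s2 c)"

definition prod_atlas ::
    "('m, 'a) chart set \<Rightarrow> ('n, 'b) chart set \<Rightarrow> ('m \<times> 'n, 'a \<times> 'b) chart set" where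
  "prod_atlas A1 A2 = {(U \<times> V, map_prod \<phi> \<psi>) |U \<phi> V \<psi>. (U, \<phi>) \<in> A1 \<and> (V, \<psi>) \<in> A2}"

definition open_submanifold_atlas :: "('m, 'a) chart set \<Rightarrow> 'm set \<Rightarrow> ('m, 'a) chart set" where
  "open_submanifold_atlas A W = {(U \<inter> W, \<phi>) |U \<phi>. (U, \<phi>) \<in> A}"


section \<open>Complex Lie groups and their Lie algebras\<close>

definition complex_lie_group ::
    "(complex \<Rightarrow> 'a::euclidean_space \<Rightarrow> 'a) \<Rightarrow> 'g monoid \<Rightarrow> 'g topology \<Rightarrow> ('g, 'a) chart set \<Rightarrow> bool"
  where
  "complex_lie_group cs G T A \<longleftrightarrow>
     group G \<and> topspace T = carrier G \<and> complex_manifold cs T A \<and>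
     holomorphic_map (prod_scale cs cs) (prod_topology T T) (prod_atlas A A) cs T A
       (\<lambda>(g, h). g \<otimes>\<^bsub>G\<^esub> h) \<and>
     holomorphic_map cs T A cs T A (\<lambda>g. inv\<^bsub>G\<^esub> g)"

text \<open>
  The tangent space of the group at the unit is identified with the model space by the differential
  of a chart \<open>(U, \<kappa>)\<close> centred at the unit (every linear identification arises in this way,
  and the atlas may always be enlarged by such a chart).  Under this identification the adjoint
  action of \<open>g\<close> is the differential at the unit of the conjugation by \<open>g\<close>.
\<close>

definition Ad ::
    "'g monoid \<Rightarrow> 'g set \<Rightarrow> ('g \<Rightarrow> 'a::euclidean_space) \<Rightarrow> 'g \<Rightarrow> 'a \<Rightarrow> 'a" where
  "Ad G U \<kappa> g =
     frechet_derivative (\<lambda>x. \<kappa> (g \<otimes>\<^bsub>G\<^esub> inv_into U \<kappa> x \<otimes>\<^bsub>G\<^esub> inv\<^bsub>G\<^esub> g)) (at 0)"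

text \<open>
  The bracket of the Lie algebra of the group is the differential at the unit of the adjoint
  representation (equivalently, the bracket of left-invariant vector fields).  The last condition
  says that this is the given bracket \<open>br\<close>.
\<close>

definition complex_lie_group_with_lie_algebra ::
    "(complex \<Rightarrow> 'a::euclidean_space \<Rightarrow> 'a) \<Rightarrow> ('a \<Rightarrow> 'a \<Rightarrow> 'a)
     \<Rightarrow> 'g monoid \<Rightarrow> 'g topology \<Rightarrow> ('g, 'a) chart set \<Rightarrow> 'g set \<Rightarrow> ('g \<Rightarrow> 'a) \<Rightarrow> bool" where
  "complex_lie_group_with_lie_algebra cs br G T A U \<kappa> \<longleftrightarrow>
     complex_lie_algebra cs br \<and> complex_lie_group cs G T A \<and>
     (U, \<kappa>) \<in> A \<and> \<one>\<^bsub>G\<^esub> \<in> U \<and> \<kappa> \<one>\<^bsub>G\<^esub> = 0 \<and>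
     (\<forall>Y. ((\<lambda>x. Ad G U \<kappa> (inv_into U \<kappa> x) Y) has_derivative (\<lambda>X. br X Y)) (at 0))"

text \<open>
  The exponential map: \<open>t \<mapsto> e (t X)\<close> is the one-parameter subgroup with initial velocity \<open>X\<close>.
  Exactly one map has this property.  Continuity is required because \<open>\<kappa>\<close> is arbitrary
  outside its chart domain.
\<close>

definition exponential_map ::
    "'g monoid \<Rightarrow> 'g topology \<Rightarrow> ('g \<Rightarrow> 'a::euclidean_space) \<Rightarrow> ('a \<Rightarrow> 'g) \<Rightarrow> bool" where
  "exponential_map G T \<kappa> e \<longleftrightarrow>
     (\<forall>X. continuous_map euclideanreal T (\<lambda>t. e (t *\<^sub>R X)) \<and>
          (\<forall>s t. e ((s + t) *\<^sub>R X) = e (s *\<^sub>R X) \<otimes>\<^bsub>G\<^esub> e (t *\<^sub>R X)) \<and>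
          ((\<lambda>t. \<kappa> (e (t *\<^sub>R X))) has_vector_derivative X) (at 0))"


section \<open>Functions of operators and the PL-CDYBE\<close>

text \<open>
  \<open>F(L)\<close> given by the Taylor series of \<open>F\<close> at \<open>0\<close>.  In finite dimension, convergence in the space
  of endomorphisms is the same as convergence on every vector.
\<close>

definition taylor_summable ::
    "(complex \<Rightarrow> 'a::euclidean_space \<Rightarrow> 'a) \<Rightarrow> (complex \<Rightarrow> complex) \<Rightarrow> ('a \<Rightarrow> 'a) \<Rightarrow> bool" where
  "taylor_summable cs F L \<longleftrightarrow>
     (\<forall>Y. summable (\<lambda>n. cs ((deriv ^^ n) F 0 / fact n) ((L ^^ n) Y)))"

definition taylor_apply ::
    "(complex \<Rightarrow> 'a::euclidean_space \<Rightarrow> 'a) \<Rightarrow> (complex \<Rightarrow> complex) \<Rightarrow> ('a \<Rightarrow> 'a) \<Rightarrow> 'a \<Rightarrow> 'a" where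
  "taylor_apply cs F L Y = (\<Sum>n. cs ((deriv ^^ n) F 0 / fact n) ((L ^^ n) Y))"

text \<open>The derivative of an endomorphism-valued function is taken vector by vector.\<close>

definition D_plus ::
    "'g monoid \<Rightarrow> ('a::euclidean_space \<Rightarrow> 'g) \<Rightarrow> 'a \<Rightarrow> ('g \<Rightarrow> 'a \<Rightarrow> 'a) \<Rightarrow> 'g \<Rightarrow> 'a \<Rightarrow> 'a" where
  "D_plus G e X R \<Omega> Y =
     vector_derivative (\<lambda>t::real. R (e (t *\<^sub>R X) \<otimes>\<^bsub>G\<^esub> \<Omega> \<otimes>\<^bsub>G\<^esub> e (t *\<^sub>R X)) Y) (at 0)"

definition PL_CDYBE ::
    "('a::euclidean_space \<Rightarrow> 'a \<Rightarrow> 'a) \<Rightarrow> ('a \<Rightarrow> 'a \<Rightarrow> complex) \<Rightarrow> 'g monoid \<Rightarrow> ('a \<Rightarrow> 'g)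
     \<Rightarrow> 'g set \<Rightarrow> ('g \<Rightarrow> 'a \<Rightarrow> 'a) \<Rightarrow> complex \<Rightarrow> bool" where
  "PL_CDYBE br B G e W R \<mu> \<longleftrightarrow>
     (\<forall>X Y Z. \<forall>\<Omega>\<in>W.
        (let term = (\<lambda>X Y Z.
               B (br (R \<Omega> X) (R \<Omega> Y) - (1/2) *\<^sub>R D_plus G e X R \<Omega> Y) Z)
         in term X Y Z + term Y Z X + term Z X Y = \<mu> * B (br X Y) Z))"

definition coth :: "complex \<Rightarrow> complex" where
  "coth z = cosh z / sinh z"

text \<open>
  The value at the removable singularity \<open>z = 0\<close> is \<open>0\<close>, and \<open>\<nu> coth(\<nu> z)\<close> is read as its
  limit \<open>1 / z\<close> for \<open>\<nu> = 0\<close>.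
\<close>

definition F_nu :: "complex \<Rightarrow> complex \<Rightarrow> complex" where
  "F_nu \<nu> z =
     (if z = 0 then 0
      else (if \<nu> = 0 then 1 / z else \<nu> * coth (\<nu> * z)) - (1/2) * coth (z / 2))"

end

theory Submission
  imports Defs "HOL-Computational_Algebra.Fundamental_Theorem_Algebra"
begin

text \<open>
  Put \<open>\<Omega> = e w\<close> and let \<open>x, y, z\<close> with \<open>x + y + z = 0\<close> be \<open>ad w\<close> acting on the three arguments of
  \<open>B [X, Y] Z\<close>.  Comparing adjoint actions, the curve \<open>log (exp (t X) \<Omega> exp (t X))\<close> has initial velocity
  \<open>h (ad w) X\<close> with \<open>h z = z coth (z / 2)\<close>.  Hence the PL-CDYBE turns into the functional equation
  \<open>F x F y + F y F z + F z F x + (coth (x / 2) (F y + F z) + cycl. perm.) / 2 = \<mu>\<close>.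
  For \<open>F z = f z - coth (z / 2) / 2\<close> this reads \<open>f x f y + f y f z + f z f x = \<mu> - 1/4\<close>, the addition
  theorem of \<open>\<nu> coth (\<nu> z)\<close> with \<open>\<mu> = 1/4 - \<nu>^2\<close>.  Poles do not interfere: unless \<open>F = 0\<close>, the radius of
  convergence of \<open>F_nu\<close> is at most \<open>2 \<pi>\<close>, the radius of \<open>h\<close>, and on the open set \<open>g\<^sub>0\<close> the spectral
  radius of \<open>ad w\<close> stays below it.

  Conversely, by Engel's theorem some \<open>ad w\<close> is not nilpotent, so it has an eigenvector \<open>X\<close> with a nonzero
  eigenvalue.  The equation for \<open>s w\<close>, tested on \<open>X\<close>, any \<open>Y\<close> with \<open>B X Y \<noteq> 0\<close>, and \<open>Z = w\<close>, is a
  Riccati equation for \<open>F\<close> near \<open>0\<close> with a unique odd power series solution.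
\<close>

unbundle no vec_syntax
unbundle fps_syntax

section \<open>The formal functional equation\<close>

text \<open>\<open>ad w\<close> need not be diagonalizable, and x, y or z may be 0, so the
  functional equation can be checked neither on eigenvectors nor by evaluating coth. It is used
  degree by degree instead. Write L for \<open>ad w\<close>. Invariance of \<open>B\<close> trades L
  on Z for -L on X and on Y; hence an identity between homogeneous polynomials modulo x + y + z
  carries over to the forms \<open>B\<close> [L^i X, L^j Y] (L^k Z). The coth terms arise as
  follows. The derivative of L^(m+1) Y in direction eta is the sum of L^i [eta, L^(m-i) Y]. Paired
  with Z, the outer L^i moves onto Z and yields (-z)^i y^(m-i); these add up to the divided
  difference of F at -z and y, whose denominator is -z - y = x. The velocity eta = h
  (\<open>ad w\<close>) X contributes h x. Oddness of F and h x / x = coth (x / 2) give the stated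
  equation. The constant 1/4 is the addition theorem of coth (z / 2), scaled by the square of 1/2.
  In the converse, Z = w means z = 0 because [w, w] = 0, and an eigenvector X then forces y =
  -x.\<close>

definition expm1_over_X :: "complex fps" where
  "expm1_over_X = fps_shift 1 (fps_exp 1 - 1)"

text \<open>The Taylor series of \<open>z coth (z / 2)\<close>.\<close>

definition zcoth_fps :: "complex fps" where
  "zcoth_fps = inverse expm1_over_X * (fps_exp 1 + 1)"

text \<open>
  Writing \<open>h z = z coth (z / 2)\<close>, one has \<open>F_nu \<nu> z = (h (2 \<nu> z) - h z) / (2 z)\<close>, uniformly in \<open>\<nu>\<close>.
\<close>

definition F_nu_fps :: "complex \<Rightarrow> complex fps" where
  "F_nu_fps \<nu> = Abs_fps (\<lambda>n. zcoth_fps $ Suc n * ((2 * \<nu>) ^ Suc n - 1) / 2)"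

text \<open>For numbers x, y, z the formal variable records the total degree: the coefficient of X^n
  in a product of \<open>dil x f\<close>, \<open>dil y g\<close>, \<open>dil z h\<close> is the
  homogeneous part of degree n of f x * g y * h z.\<close>

definition dil :: "complex \<Rightarrow> complex fps \<Rightarrow> complex fps" where
  "dil c f = f oo (fps_const c * fps_X)"

lemma dil_nth [simp]: "dil c f $ n = c ^ n * f $ n"
  by (simp add: dil_def)

lemma dil_add: "dil c (f + g) = dil c f + dil c g"
  and dil_diff: "dil c (f - g) = dil c f - dil c g"
  and dil_mult: "dil c (f * g) = dil c f * dil c g"
  by (simp_all add: dil_def fps_compose_add_distrib fps_compose_sub_distrib fps_compose_mult_distrib)

lemma dil_exp: "dil c (fps_exp d) = fps_exp (c * d)"
  by (simp add: dil_def fps_exp_compose_linear)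

lemma dil_1: "dil c 1 = 1" and dil_X: "dil c fps_X = fps_const c * fps_X"
  by (auto simp: dil_def)

lemma expm1_over_X_mult: "expm1_over_X * fps_X = fps_exp 1 - 1"
  by (auto simp: expm1_over_X_def fps_eq_iff split: nat.splits)

lemma expm1_over_X_nth: "expm1_over_X $ n = 1 / fact (Suc n)"
  by (simp add: expm1_over_X_def del: fact_Suc)

lemma expm1_over_X_inverse: "inverse expm1_over_X * expm1_over_X = 1"
  by (rule inverse_mult_eq_1) (simp add: expm1_over_X_nth)

lemma zcoth_fps_mult: "zcoth_fps * (fps_exp 1 - 1) = fps_X * (fps_exp 1 + 1)"
  using expm1_over_X_inverse
  by (simp add: zcoth_fps_def algebra_simps flip: expm1_over_X_mult)

lemma zcoth_fps_dil_mult: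
  "dil c zcoth_fps * (fps_exp c - 1) = fps_const c * fps_X * (fps_exp c + 1)"
  using arg_cong[OF zcoth_fps_mult, of "dil c"]
  by (simp add: dil_mult dil_diff dil_add dil_exp dil_1 dil_X)

lemma fps_exp_neq_1: "c \<noteq> 0 \<Longrightarrow> fps_exp c - 1 \<noteq> (0::complex fps)"
  by (auto simp: fps_eq_iff intro!: exI[of _ 1])

text \<open>Division is avoided: exp(-c) exp(c) = 1 shows that both sides agree after multiplication
  by \<open>fps_exp c - 1\<close>, which is a nonzero series for c different from 0.\<close>

lemma zcoth_fps_even: "dil (-c) zcoth_fps = dil c zcoth_fps"
proof (cases "c = 0")
  case False
  have E: "fps_exp (-c) * fps_exp c = (1::complex fps)"
    by (simp flip: fps_exp_add_mult)
  have "(fps_exp c - 1) * dil (-c) zcoth_fps = - (dil (-c) zcoth_fps * (fps_exp (-c) - 1) * fps_exp c)"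
    using E by (simp add: algebra_simps)
  also have "\<dots> = fps_const c * fps_X * (fps_exp c + fps_exp (-c) * fps_exp c)"
    unfolding zcoth_fps_dil_mult by (simp add: algebra_simps flip: fps_const_neg)
  also have "\<dots> = (fps_exp c - 1) * dil c zcoth_fps"
    unfolding E by (metis zcoth_fps_dil_mult mult.commute)
  finally have "(fps_exp c - 1) * dil (-c) zcoth_fps = (fps_exp c - 1) * dil c zcoth_fps" .
  then show ?thesis
    using fps_exp_neq_1[OF False] by (metis mult_left_cancel)
qed auto

lemma zcoth_fps_0 [simp]: "zcoth_fps $ 0 = 2"
  by (simp add: zcoth_fps_def expm1_over_X_nth)

text \<open>With denominators cleared, this is the addition theorem coth p coth q + coth q coth r +
  coth r coth p = -1 for p + q + r = 0. It is applied with \<open>c = 1\<close> to coth (z / 2) and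
  with \<open>c = 2 * \<nu>\<close> to coth (nu z).\<close>

lemma zcoth_addition:
  assumes "x + y + z = (0::complex)" and "x \<noteq> 0" "y \<noteq> 0" "z \<noteq> 0"
  fixes c
  defines "h \<equiv> \<lambda>u. dil (c * u) zcoth_fps"
  shows "fps_const z * h x * h y + fps_const x * h y * h z + fps_const y * h z * h x
          = - (fps_const (c\<^sup>2) * fps_const x * fps_const y * fps_const z * fps_X\<^sup>2)"
proof (cases "c = 0")
  \<comment> \<open>This is the case nu = 0, where every \<open>h u\<close> is the constant 2 and
    the sum is 4 (x + y + z).\<close>
  case True
  then have "h u = fps_const 2" for u
    by (auto simp: h_def fps_eq_iff power_0_left)
  moreover have "fps_const z * fps_const 2 * fps_const 2 + fps_const x * fps_const 2 * fps_const 2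
      + fps_const y * fps_const 2 * fps_const 2 = 0"
  proof -
    have "z * 2 * 2 + x * 2 * 2 + y * 2 * 2 = (x + y + z) * 4"
      by (simp add: algebra_simps)
    then show ?thesis
      using assms(1) by simp
  qed
  ultimately show ?thesis
    using True by simp
next
  case False
  define E where "E = (\<lambda>u. fps_exp (c * u) :: complex fps)"
  have sum0: "c * x + c * y + c * z = 0"
    using assms(1) by (metis distrib_left mult_zero_right)
  have E1: "E x * E y * E z = 1"
    using sum0 by (simp add: E_def flip: fps_exp_add_mult)
  have h: "h u * (E u - 1) = fps_const c * fps_const u * fps_X * (E u + 1)" for u
    using zcoth_fps_dil_mult[of "c * u"] by (simp add: h_def E_def)
  have nz: "(E x - 1) * (E y - 1) * (E z - 1) \<noteq> 0"
    using assms False fps_exp_neq_1 by (auto simp: E_def)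
  \<comment> \<open>As the product of the three exponentials is 1, both sides reduce to e2 - e1 with
    the elementary symmetric polynomials of \<open>E x\<close>, \<open>E y\<close>,
    \<open>E z\<close>.\<close>
  have key: "(E x + 1) * (E y + 1) * (E z - 1) + (E y + 1) * (E z + 1) * (E x - 1)
      + (E z + 1) * (E x + 1) * (E y - 1) = - ((E x - 1) * (E y - 1) * (E z - 1))"
    using E1 by (simp add: algebra_simps)
  define l r where "l = fps_const z * h x * h y + fps_const x * h y * h z + fps_const y * h z * h x"
    and "r = - (fps_const (c\<^sup>2) * fps_const x * fps_const y * fps_const z * fps_X\<^sup>2)"
  have c2: "fps_const (c\<^sup>2) = (fps_const c)\<^sup>2"
    by (simp add: power2_eq_square)
  have "l * ((E x - 1) * (E y - 1) * (E z - 1)) =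
      fps_const z * (h x * (E x - 1)) * (h y * (E y - 1)) * (E z - 1)
    + fps_const x * (h y * (E y - 1)) * (h z * (E z - 1)) * (E x - 1)
    + fps_const y * (h z * (E z - 1)) * (h x * (E x - 1)) * (E y - 1)"
    by (simp add: l_def algebra_simps)
  also have "\<dots> = (fps_const c)\<^sup>2 * fps_const x * fps_const y * fps_const z * fps_X\<^sup>2 *
      ((E x + 1) * (E y + 1) * (E z - 1) + (E y + 1) * (E z + 1) * (E x - 1)
      + (E z + 1) * (E x + 1) * (E y - 1))"
    unfolding h by (simp add: algebra_simps power2_eq_square)
  also have "\<dots> = r * ((E x - 1) * (E y - 1) * (E z - 1))"
    unfolding key r_def c2 by (simp add: algebra_simps)
  finally have "l = r"
    using nz by (metis mult_right_cancel)
  then show ?thesis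
    by (simp add: l_def r_def)
qed

lemma F_nu_fps_dil:
  "2 * fps_const x * fps_X * dil x (F_nu_fps \<nu>) = dil (2 * \<nu> * x) zcoth_fps - dil x zcoth_fps"
proof (rule fps_ext)
  fix n
  show "(2 * fps_const x * fps_X * dil x (F_nu_fps \<nu>)) $ n
      = (dil (2 * \<nu> * x) zcoth_fps - dil x zcoth_fps) $ n"
  proof (cases n)
    case (Suc m)
    define w where "w = (2 * \<nu>) ^ Suc m"
    have pw: "(2 * \<nu> * x) ^ Suc m = w * x ^ Suc m"
      by (simp only: w_def power_mult_distrib)
    have e: "w * zcoth_fps $ Suc m = zcoth_fps $ Suc m + 2 * F_nu_fps \<nu> $ m"
      by (simp only: F_nu_fps_def w_def fps_nth_Abs_fps) (simp add: field_simps del: power_Suc)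
    have "(2 * fps_const x * fps_X * dil x (F_nu_fps \<nu>)) $ Suc m = 2 * x * (x ^ m * F_nu_fps \<nu> $ m)"
      by (simp add: mult.assoc numeral_fps_const)
    moreover have "w * x ^ Suc m * zcoth_fps $ Suc m - x ^ Suc m * zcoth_fps $ Suc m
        = x ^ Suc m * (w * zcoth_fps $ Suc m - zcoth_fps $ Suc m)"
      by (simp only: algebra_simps)
    ultimately show ?thesis
      by (simp only: Suc dil_nth fps_sub_nth pw e) simp
  qed (simp add: mult.assoc numeral_fps_const)
qed

lemma zcoth_fps_odd_nth: "odd n \<Longrightarrow> zcoth_fps $ n = 0"
  using arg_cong[OF zcoth_fps_even[of 1], of "\<lambda>f. f $ n"] by simp

lemma F_nu_fps_even_nth: "even n \<Longrightarrow> F_nu_fps \<nu> $ n = 0"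
  by (simp add: F_nu_fps_def zcoth_fps_odd_nth)

lemma F_nu_fps_odd: "dil (-c) (F_nu_fps \<nu>) = - dil c (F_nu_fps \<nu>)"
proof (rule fps_ext)
  fix n
  show "dil (-c) (F_nu_fps \<nu>) $ n = (- dil c (F_nu_fps \<nu>)) $ n"
    by (cases "even n") (auto simp: F_nu_fps_even_nth)
qed

text \<open>
  The part of degree \<open>n\<close> of the left-hand side of the functional equation
  \<open>a x a y - (a (x + y) - a y) / x * h x / 2 + cycl. perm.\<close> with \<open>x + y + z = 0\<close>, where
  \<open>a (x + y)\<close> is expanded in powers of \<open>- z\<close>.  The value of the monomial \<open>x^i y^j z^k\<close> is \<open>t i j k\<close>,
  which is later a number, a polynomial, or a trilinear form in powers of \<open>ad w\<close>.
\<close>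

definition cdybe_coeff ::
    "(complex \<Rightarrow> 'b \<Rightarrow> 'b) \<Rightarrow> complex fps \<Rightarrow> nat \<Rightarrow> (nat \<Rightarrow> nat \<Rightarrow> nat \<Rightarrow> 'b) \<Rightarrow> 'b::ab_group_add" where
  "cdybe_coeff sc a n t =
     (\<Sum>i\<le>n. sc (a $ i * a $ (n - i)) (t i (n - i) 0 + t 0 i (n - i) + t (n - i) 0 i))
     - (\<Sum>m\<le>n. sc (a $ Suc m * zcoth_fps $ (n - m) / 2)
          (\<Sum>i\<le>m. sc ((-1) ^ i)
             (t (n - m) (m - i) i + t i (n - m) (m - i) + t (m - i) i (n - m))))"

text \<open>The divided difference of \<open>a\<close> at the points -z and y, graded by degree.
  Each coefficient is a polynomial in z and y, so it keeps its meaning where the two points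
  coincide.\<close>

definition difference_quotient_fps :: "complex fps \<Rightarrow> complex \<Rightarrow> complex \<Rightarrow> complex fps" where
  "difference_quotient_fps a z y = Abs_fps (\<lambda>m. a $ Suc m * (\<Sum>i\<le>m. (-z) ^ i * y ^ (m - i)))"

lemma difference_quotient_fps_mult:
  "fps_const (- z - y) * fps_X * difference_quotient_fps a z y = dil (-z) a - dil y a"
proof (rule fps_ext)
  fix n
  show "(fps_const (- z - y) * fps_X * difference_quotient_fps a z y) $ n = (dil (-z) a - dil y a) $ n"
  proof (cases n)
    case (Suc m)
    have "(-z) ^ Suc m - y ^ Suc m = (-z - y) * (\<Sum>i\<le>m. (-z) ^ i * y ^ (m - i))"
      by (metis diff_power_eq_sum lessThan_Suc_atMost)
    then have "(-z) ^ Suc m * a $ Suc m - y ^ Suc m * a $ Suc m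
        = (-z - y) * (a $ Suc m * (\<Sum>i\<le>m. (-z) ^ i * y ^ (m - i)))"
      by (metis left_diff_distrib mult.assoc mult.commute)
    then show ?thesis
      by (simp only: Suc dil_nth fps_sub_nth) (simp add: difference_quotient_fps_def mult.assoc)
  qed (simp add: difference_quotient_fps_def)
qed

text \<open>Cauchy products of dilated series reproduce the double sums of
  \<open>cdybe_coeff\<close>; the three difference quotients belong to the three cyclic
  permutations.\<close>

lemma cdybe_coeff_eq_fps_nth:
  "cdybe_coeff (*) a n (\<lambda>i j k. x ^ i * y ^ j * z ^ k) =
     (dil x a * dil y a + dil y a * dil z a + dil z a * dil x a
      - fps_const (1/2) * (difference_quotient_fps a z y * dil x zcoth_fps
          + difference_quotient_fps a x z * dil y zcoth_fps
          + difference_quotient_fps a y x * dil z zcoth_fps)) $ n"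
proof -
  let ?h = zcoth_fps
  have "(\<Sum>i\<le>n. a $ i * a $ (n - i) * (x ^ i * y ^ (n - i) * z ^ 0 + x ^ 0 * y ^ i * z ^ (n - i) + x ^ (n - i) * y ^ 0 * z ^ i))
      = (dil x a * dil y a + dil y a * dil z a + dil z a * dil x a) $ n"
    unfolding fps_add_nth fps_mult_nth atLeast0AtMost
    by (simp add: sum.distrib algebra_simps)
  moreover have "(\<Sum>m\<le>n. a $ Suc m * ?h $ (n - m) / 2 *
          (\<Sum>i\<le>m. (-1) ^ i * (x ^ (n - m) * y ^ (m - i) * z ^ i + x ^ i * y ^ (n - m) * z ^ (m - i)
              + x ^ (m - i) * y ^ i * z ^ (n - m))))
      = (fps_const (1/2) * (difference_quotient_fps a z y * dil x ?h + difference_quotient_fps a x z * dil y ?h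
          + difference_quotient_fps a y x * dil z ?h)) $ n" (is "?l = ?r")
  proof -
    have s: "(\<Sum>i\<le>m. (-1) ^ i * (x ^ (n - m) * y ^ (m - i) * z ^ i + x ^ i * y ^ (n - m) * z ^ (m - i)
              + x ^ (m - i) * y ^ i * z ^ (n - m)))
        = x ^ (n - m) * (\<Sum>i\<le>m. (-z) ^ i * y ^ (m - i)) + y ^ (n - m) * (\<Sum>i\<le>m. (-x) ^ i * z ^ (m - i))
          + z ^ (n - m) * (\<Sum>i\<le>m. (-y) ^ i * x ^ (m - i))" for m
      unfolding sum_distrib_left sum.distrib[symmetric]
      by (intro sum.cong) (auto simp: power_minus[of x] power_minus[of y] power_minus[of z] algebra_simps)
    show ?thesis
      unfolding s fps_mult_left_const_nth fps_add_nth
      unfolding fps_mult_nth atLeast0AtMost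
      by (simp add: difference_quotient_fps_def flip: sum.distrib)
         (subst sum_distrib_right, intro sum.cong refl, simp add: algebra_simps)
  qed
  ultimately show ?thesis
    by (simp add: cdybe_coeff_def)
qed

text \<open>Multiplied by 4 x y z X^2, the equation involves only K = h (2 nu .) and H = h. The
  mixed products of K and H cancel against the divided differences. What remains is the addition
  theorem for K minus the one for H, that is 1 - 4 nu^2 times x y z X^2.\<close>

lemma cdybe_coeff_F_nu:
  assumes xyz: "x + y + z = 0" and nz: "x \<noteq> 0" "y \<noteq> 0" "z \<noteq> 0"
  shows "cdybe_coeff (*) (F_nu_fps \<nu>) n (\<lambda>i j k. x ^ i * y ^ j * z ^ k) = (if n = 0 then 1/4 - \<nu>\<^sup>2 else 0)"
proof -
  let ?a = "F_nu_fps \<nu>" and ?X = "fps_X :: complex fps"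
  define cx cy cz where "cx = fps_const x" and "cy = fps_const y" and "cz = fps_const z"
  define H where "H = (\<lambda>u. dil u zcoth_fps)"
  define K where "K = (\<lambda>u. dil (2 * \<nu> * u) zcoth_fps)"
  define b where "b = (\<lambda>u. dil u ?a)"
  let ?D = "difference_quotient_fps ?a"
  define P where "P = b x * b y + b y * b z + b z * b x
      - fps_const (1/2) * (?D z y * H x + ?D x z * H y + ?D y x * H z)"
  have 1: "2 * cx * ?X * b x = K x - H x" "2 * cy * ?X * b y = K y - H y" "2 * cz * ?X * b z = K z - H z"
    unfolding b_def K_def H_def cx_def cy_def cz_def by (rule F_nu_fps_dil)+
  have "z = - x - y"
    using xyz by (simp add: eq_neg_iff_add_eq_0 algebra_simps)
  then have lin: "- z - y = x" "- x - z = y" "- y - x = z"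
    by simp_all
  \<comment> \<open>Since x + y + z = 0, the denominators of the divided differences are x, y, z;
    oddness turns the value at -z into minus the value at z.\<close>
  have 2: "cx * ?X * ?D z y = - b z - b y"
    "cy * ?X * ?D x z = - b x - b z" "cz * ?X * ?D y x = - b y - b x"
    using difference_quotient_fps_mult[of z y ?a] difference_quotient_fps_mult[of x z ?a]
      difference_quotient_fps_mult[of y x ?a]
    unfolding lin F_nu_fps_odd b_def cx_def cy_def cz_def by simp_all
  have 3: "cz * H x * H y + cx * H y * H z + cy * H z * H x = - (cx * cy * cz * ?X\<^sup>2)"
    using zcoth_addition[OF xyz nz, of 1] by (simp add: H_def cx_def cy_def cz_def)
  have 4: "cz * K x * K y + cx * K y * K z + cy * K z * K x
      = - (4 * (fps_const \<nu>)\<^sup>2 * cx * cy * cz * ?X\<^sup>2)"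
    using zcoth_addition[OF xyz nz, of "2 * \<nu>"]
    by (simp add: K_def cx_def cy_def cz_def power2_eq_square numeral_fps_const)
  have half: "2 * fps_const (1/2) = (1 :: complex fps)"
    by (simp add: numeral_fps_const)
  have "4 * cx * cy * cz * ?X\<^sup>2 * P =
      cz * (2 * cx * ?X * b x) * (2 * cy * ?X * b y) + cx * (2 * cy * ?X * b y) * (2 * cz * ?X * b z)
      + cy * (2 * cz * ?X * b z) * (2 * cx * ?X * b x)
      - (2 * fps_const (1/2)) * 2 * ?X * (cy * cz * (cx * ?X * ?D z y) * H x + cx * cz * (cy * ?X * ?D x z) * H y
          + cx * cy * (cz * ?X * ?D y x) * H z)"
    unfolding P_def by (simp add: algebra_simps power2_eq_square)
  also have "\<dots> = cz * (2 * cx * ?X * b x) * (2 * cy * ?X * b y) + cx * (2 * cy * ?X * b y) * (2 * cz * ?X * b z)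
      + cy * (2 * cz * ?X * b z) * (2 * cx * ?X * b x)
      + (cy * (2 * cz * ?X * b z) + cz * (2 * cy * ?X * b y)) * H x
      + (cx * (2 * cz * ?X * b z) + cz * (2 * cx * ?X * b x)) * H y
      + (cx * (2 * cy * ?X * b y) + cy * (2 * cx * ?X * b x)) * H z"
    unfolding 2 half by (simp add: algebra_simps)
  also have "\<dots> = (cz * K x * K y + cx * K y * K z + cy * K z * K x)
      - (cz * H x * H y + cx * H y * H z + cy * H z * H x)"
    unfolding 1 by (simp add: algebra_simps)
  also have "\<dots> = cx * cy * cz * ?X\<^sup>2 - 4 * (fps_const \<nu>)\<^sup>2 * cx * cy * cz * ?X\<^sup>2"
    unfolding 3 4 by simp
  also have "\<dots> = 4 * cx * cy * cz * ?X\<^sup>2 * fps_const (1/4 - \<nu>\<^sup>2)"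
    by (simp add: numeral_fps_const power2_eq_square algebra_simps flip: fps_const_mult fps_const_sub)
  finally have "4 * cx * cy * cz * ?X\<^sup>2 * P = 4 * cx * cy * cz * ?X\<^sup>2 * fps_const (1/4 - \<nu>\<^sup>2)" .
  moreover have "4 * cx * cy * cz * ?X\<^sup>2 \<noteq> 0"
    using nz by (auto simp: cx_def cy_def cz_def)
  ultimately have "P = fps_const (1/4 - \<nu>\<^sup>2)"
    by (metis mult_left_cancel)
  then show ?thesis
    unfolding cdybe_coeff_eq_fps_nth using P_def by (simp add: b_def H_def)
qed

section \<open>Convergence and the functions \<open>F_nu\<close>\<close>

lemma exp_neq_1:
  assumes "z \<noteq> 0" "norm z < 2 * pi"
  shows "exp z \<noteq> (1::complex)"
proof
  assume "exp z = 1"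
  then obtain n :: int where n: "Re z = 0" "Im z = of_int (2 * n) * pi"
    by (auto simp: exp_eq_1)
  then have "n \<noteq> 0"
    using assms(1) by (auto simp: complex_eq_iff)
  then have "1 \<le> \<bar>of_int n :: real\<bar>"
    by linarith
  moreover have "norm z = \<bar>of_int n\<bar> * (2 * pi)"
    using n by (simp add: cmod_def abs_mult)
  ultimately show False
    using assms(2) by (smt (verit) mult_right_mono pi_gt_zero mult_cancel_right1)
qed

lemma fps_conv_radius_expm1_over_X: "fps_conv_radius expm1_over_X = \<infinity>"
proof -
  have "fps_conv_radius (fps_exp 1 - 1 :: complex fps) \<ge> min \<infinity> \<infinity>"
    by (metis fps_conv_radius_1 fps_conv_radius_diff fps_conv_radius_exp)
  then show ?thesis
    by (simp add: expm1_over_X_def)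
qed

text \<open>The zeros of (exp z - 1) / z closest to 0 are 2 pi i and -2 pi i.\<close>

lemma fps_conv_radius_inverse_expm1_over_X: "ereal (2 * pi) \<le> fps_conv_radius (inverse expm1_over_X)"
proof -
  have "eval_fps expm1_over_X z \<noteq> 0" if "ereal (norm z) < ereal (2 * pi)" for z
  proof (cases "z = 0")
    case False
    have "eval_fps expm1_over_X z * z = exp z - 1"
      using arg_cong[OF expm1_over_X_mult, of "\<lambda>f. eval_fps f z"]
      by (simp add: eval_fps_mult eval_fps_diff fps_conv_radius_expm1_over_X)
    then show ?thesis
      using exp_neq_1[OF False] that by auto
  qed (simp add: eval_fps_at_0 expm1_over_X_nth)
  then have "min (ereal (2 * pi)) (fps_conv_radius expm1_over_X) \<le> fps_conv_radius (inverse expm1_over_X)"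
    by (rule fps_conv_radius_inverse)
  then show ?thesis
    by (simp add: fps_conv_radius_expm1_over_X)
qed

lemma fps_conv_radius_zcoth: "fps_conv_radius zcoth_fps \<ge> ereal (2 * pi)"
proof -
  have "fps_conv_radius (fps_exp 1 + 1 :: complex fps) \<ge> min \<infinity> \<infinity>"
    by (metis fps_conv_radius_1 fps_conv_radius_add fps_conv_radius_exp)
  then show ?thesis
    using fps_conv_radius_mult[of "inverse expm1_over_X" "fps_exp 1 + 1"] fps_conv_radius_inverse_expm1_over_X
    by (simp add: zcoth_fps_def)
qed

lemma coth_half:
  assumes "exp z \<noteq> 1"
  shows "coth (z / 2) = (exp z + 1) / (exp z - 1)"
proof -
  define w where "w = exp (z / 2)"
  have w: "w \<noteq> 0" "exp z = w * w" "exp (- (z / 2)) = inverse w"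
    by (simp_all add: w_def exp_minus flip: exp_add)
  have c: "cosh (z / 2) = (w + inverse w) / 2" and s: "sinh (z / 2) = (w - inverse w) / 2"
    using w by (simp_all add: cosh_field_def sinh_field_def w_def)
  have "w * w \<noteq> 1"
    using assms w by simp
  then show ?thesis
    unfolding coth_def c s w(2) using w(1) by (simp add: field_simps)
qed

lemma eval_zcoth_fps:
  assumes "z \<noteq> 0" "norm z < 2 * pi"
  shows "eval_fps zcoth_fps z = z * coth (z / 2)"
proof -
  have r: "ereal (norm z) < fps_conv_radius zcoth_fps"
    using fps_conv_radius_zcoth assms(2) by (meson ereal_less_eq(3) less_ereal.simps(1) less_le_trans)
  have i: "fps_conv_radius (fps_exp 1 + 1 :: complex fps) = \<infinity>" "fps_conv_radius (fps_exp 1 - 1 :: complex fps) = \<infinity>"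
    using fps_conv_radius_add[of "fps_exp 1 :: complex fps" 1] fps_conv_radius_diff[of "fps_exp 1 :: complex fps" 1]
    by simp_all
  have "eval_fps zcoth_fps z * (exp z - 1) = z * (exp z + 1)"
    using arg_cong[OF zcoth_fps_mult, of "\<lambda>f. eval_fps f z"] r i
    by (simp add: eval_fps_mult eval_fps_diff eval_fps_add)
  then show ?thesis
    using exp_neq_1[OF assms] by (simp add: coth_half field_simps)
qed

lemma less_fps_conv_radius:
  assumes "ereal r < fps_conv_radius f" "ereal r < fps_conv_radius g"
  shows less_fps_conv_radius_mult: "ereal r < fps_conv_radius (f * g)"
    and less_fps_conv_radius_add: "ereal r < fps_conv_radius (f + g)"
    and less_fps_conv_radius_diff: "ereal r < fps_conv_radius (f - g)"
  using assms fps_conv_radius_mult[of f g] fps_conv_radius_add[of f g] fps_conv_radius_diff[of f g]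
  by (meson less_le_trans min_less_iff_conj)+

lemma F_nu_fps_eq: "2 * fps_X * F_nu_fps \<nu> = dil (2 * \<nu>) zcoth_fps - zcoth_fps"
  using F_nu_fps_dil[of 1 \<nu>] by (simp add: fps_eq_iff dil_def fps_nth_compose_linear)

text \<open>The two functions are compared after multiplication by 2 z, where both become h (2 nu z)
  - h z. For nonzero z the factor is divided out; at 0 both values vanish, which matches the value
  chosen in \<open>F_nu\<close> for the removable singularity.\<close>

lemma F_nu_has_fps_expansion: "F_nu \<nu> has_fps_expansion F_nu_fps \<nu>"
proof -
  let ?h = "eval_fps zcoth_fps" and ?a = "F_nu_fps \<nu>"
  let ?H = "dil (2 * \<nu>) zcoth_fps - zcoth_fps"
  have "fps_conv_radius zcoth_fps > 0"
    using fps_conv_radius_zcoth by (smt (verit) ereal_less(2) less_le_trans pi_gt_zero)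
  then have h: "?h has_fps_expansion zcoth_fps"
    by (rule eval_fps_has_fps_expansion)
  have lin: "(\<lambda>z. 2 * \<nu> * z) has_fps_expansion fps_const (2 * \<nu>) * fps_X"
    by (intro fps_expansion_intros)
  have "(\<lambda>z. ?h (2 * \<nu> * z)) has_fps_expansion dil (2 * \<nu>) zcoth_fps"
    using has_fps_expansion_compose[OF h lin] by (simp add: o_def dil_def)
  then have H: "(\<lambda>z. ?h (2 * \<nu> * z) - ?h z) has_fps_expansion ?H"
    using h by (rule has_fps_expansion_diff)
  \<comment> \<open>\<open>eval_fps ?a\<close> is meaningful only once the radius of convergence is
    known to be positive; it is inherited from \<open>?H\<close>.\<close>
  have "?a = fps_const (1/2) * fps_shift 1 ?H"
    unfolding F_nu_fps_eq[symmetric] by (simp add: fps_eq_iff mult.assoc numeral_fps_const)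
  moreover have "fps_conv_radius (fps_const (1/2) * fps_shift 1 ?H) > 0"
    using H by (simp add: has_fps_expansion_def fps_conv_radius_cmult_left)
  ultimately have a: "eval_fps ?a has_fps_expansion ?a"
    by (simp add: eval_fps_has_fps_expansion)
  then have "(\<lambda>z. 2 * z * eval_fps ?a z) has_fps_expansion 2 * fps_X * ?a"
    by (intro fps_expansion_intros)
  with H have "eventually (\<lambda>z. 2 * z * eval_fps ?a z = ?h (2 * \<nu> * z) - ?h z) (nhds 0)"
    unfolding F_nu_fps_eq by (auto simp: has_fps_expansion_def elim: eventually_elim2)
  moreover have "eventually (\<lambda>z. norm z < 2 * pi \<and> norm (2 * \<nu> * z) < 2 * pi) (nhds 0)"
  proof -
    have "open {z. norm z < 2 * pi \<and> norm (2 * \<nu> * z) < 2 * pi}"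
      by (intro open_Collect_conj open_Collect_less continuous_intros)
    then show ?thesis
      using eventually_nhds_in_open[of "{z. norm z < 2 * pi \<and> norm (2 * \<nu> * z) < 2 * pi}" 0] by simp
  qed
  ultimately have "eventually (\<lambda>z. eval_fps ?a z = F_nu \<nu> z) (nhds 0)"
  proof eventually_elim
    case (elim z)
    show ?case
    proof (cases "z = 0")
      case False
      define c where "c = (if \<nu> = 0 then 1 / z else \<nu> * coth (\<nu> * z))"
      \<comment> \<open>For nu = 0 this reads h 0 = 2 = 2 z (1 / z), in accordance with the limit
        convention in \<open>F_nu\<close>.\<close>
      have "?h (2 * \<nu> * z) = 2 * z * c"
        using eval_zcoth_fps[of "2 * \<nu> * z"] elim False by (auto simp: eval_fps_at_0 c_def)
      moreover have "?h z = z * coth (z / 2)"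
        using elim False by (intro eval_zcoth_fps) auto
      ultimately have "z * (2 * eval_fps ?a z) = z * (2 * c - coth (z / 2))"
        using elim(1) by (simp add: algebra_simps)
      then have "2 * eval_fps ?a z = 2 * c - coth (z / 2)"
        using False by simp
      then show ?thesis
        using False by (simp add: F_nu_def c_def field_simps)
    qed (simp add: F_nu_def eval_fps_at_0 F_nu_fps_even_nth)
  qed
  then show ?thesis
    using a has_fps_expansion_cong[OF _ refl] by blast
qed

lemma F_nu_odd: "F_nu \<nu> (- z) = - F_nu \<nu> z"
  by (auto simp: F_nu_def coth_def)

text \<open>With a larger radius, every pole of nu coth (nu z) and of coth (z / 2) / 2 in the closed
  disc of radius 2 pi would have to cancel. At 2 pi i this makes 2 nu an integer n; at 2 pi i / n it
  makes 1 / n an integer. So n is 1 or -1, which the assumption rules out. For nu = 0 the pole of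
  coth (z / 2) at 2 pi i has no partner.\<close>

lemma fps_conv_radius_F_nu:
  assumes "\<nu>\<^sup>2 \<noteq> 1/4"
  shows "fps_conv_radius (F_nu_fps \<nu>) \<le> ereal (2 * pi)"
proof (rule ccontr)
  assume "\<not> ?thesis"
  then have r: "ereal (norm z) < fps_conv_radius (F_nu_fps \<nu>)" if "norm z \<le> 2 * pi" for z :: complex
    using that by (meson ereal_less_eq(3) le_less_trans not_le)
  let ?a = "F_nu_fps \<nu>" and ?E = "fps_exp 1 :: complex fps"
  let ?E2 = "fps_exp (2 * \<nu>) :: complex fps" and ?c = "fps_const (2 * \<nu>)"
  note a = F_nu_fps_eq[of \<nu>]
  note rules = less_fps_conv_radius eval_fps_mult eval_fps_add eval_fps_diff
  \<comment> \<open>Clearing both denominators gives an identity of entire series on the right; if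
    one of the two factors vanishes at z, the identity forces the other to vanish as well.\<close>
  have pole: "exp (2 * \<nu> * z) = 1 \<or> exp z = 1 \<Longrightarrow> norm z \<le> 2 * pi \<Longrightarrow> \<nu> \<noteq> 0 \<Longrightarrow>
      exp (2 * \<nu> * z) = 1 \<and> exp z = 1" for z
  proof -
    assume z: "exp (2 * \<nu> * z) = 1 \<or> exp z = 1" "norm z \<le> 2 * pi" and nu: "\<nu> \<noteq> 0"
    have "fps_X * (2 * ?a * (?E - 1) * (?E2 - 1)) = fps_X * (?c * (?E2 + 1) * (?E - 1) - (?E + 1) * (?E2 - 1))"
    proof -
      have "fps_X * (2 * ?a * (?E - 1) * (?E2 - 1)) = (2 * fps_X * ?a) * (?E - 1) * (?E2 - 1)"
        by (simp add: ac_simps)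
      also have "\<dots> = (dil (2 * \<nu>) zcoth_fps * (?E2 - 1)) * (?E - 1) - (zcoth_fps * (?E - 1)) * (?E2 - 1)"
        unfolding a by (simp add: algebra_simps)
      also have "\<dots> = fps_X * (?c * (?E2 + 1) * (?E - 1) - (?E + 1) * (?E2 - 1))"
        unfolding zcoth_fps_mult zcoth_fps_dil_mult by (simp add: algebra_simps)
      finally show ?thesis .
    qed
    then have "2 * ?a * (?E - 1) * (?E2 - 1) = ?c * (?E2 + 1) * (?E - 1) - (?E + 1) * (?E2 - 1)"
      by simp
    from arg_cong[OF this, of "\<lambda>f. eval_fps f z"] have "2 * eval_fps ?a z * (exp z - 1) * (exp (2 * \<nu> * z) - 1)
        = 2 * \<nu> * (exp (2 * \<nu> * z) + 1) * (exp z - 1) - (exp z + 1) * (exp (2 * \<nu> * z) - 1)"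
      using r[OF z(2)] by (simp add: rules)
    then show ?thesis
      using z(1) nu by auto
  qed
  show False
  proof (cases "\<nu> = 0")
    case True
    have "dil (2 * \<nu>) zcoth_fps = 2"
      using True by (auto simp: fps_eq_iff power_0_left numeral_fps_const)
    then have "2 * fps_X * ?a * (?E - 1) = 2 * (?E - 1) - fps_X * (?E + 1)"
      using a zcoth_fps_mult by (simp add: left_diff_distrib)
    from arg_cong[OF this, of "\<lambda>f. eval_fps f (2 * pi * \<i>)"]
    have "2 * (2 * pi * \<i>) * eval_fps ?a (2 * pi * \<i>) * (exp (2 * pi * \<i>) - 1)
      = 2 * (exp (2 * pi * \<i>) - 1) - 2 * pi * \<i> * (exp (2 * pi * \<i>) + 1)"
      using r[of "2 * pi * \<i>"] by (simp add: rules norm_mult)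
    then show False by simp
  next
    case False
    have "exp (2 * \<nu> * (2 * pi * \<i>)) = 1"
      using pole[of "2 * pi * \<i>"] False by (auto simp: norm_mult)
    then obtain n :: int where n: "Im \<nu> = 0" "Re \<nu> * 2 = of_int n"
      by (auto simp: exp_eq_1 mult.commute)
    then have n': "2 * \<nu> = of_int n"
      by (simp add: complex_eq_iff)
    with False have n0: "n \<noteq> 0"
      by auto
    \<comment> \<open>The pole of nu coth (nu z) nearest to 0, since 2 nu z = 2 pi i.\<close>
    define z where "z = 2 * pi * \<i> / of_int n"
    have "norm z \<le> 2 * pi"
      using n0 by (simp add: z_def norm_mult norm_divide divide_le_eq)
    moreover have "2 * \<nu> * z = 2 * of_real pi * \<i>"
      using n0 by (simp add: z_def n')
    then have "exp (2 * \<nu> * z) = 1"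
      by (simp only: exp_two_pi_i)
    ultimately have "exp z = 1"
      using pole[of z] False by blast
    then obtain m :: int where "Im z = of_int (2 * m) * pi"
      unfolding exp_eq_1 by blast
    moreover have "Im z = 2 * pi / of_int n"
    proof -
      have "z = of_real (2 * pi / of_int n) * \<i>"
        by (simp add: z_def)
      then show ?thesis
        by (simp del: of_real_divide of_real_mult)
    qed
    ultimately have "2 * pi / of_int n = of_int (2 * m) * pi"
      by simp
    then have "of_int (m * n) = (1 :: real)"
      using n0 by (simp add: field_simps)
    then have "m * n = 1"
      by (metis of_int_eq_1_iff)
    then have "n\<^sup>2 = 1"
      by (metis power2_eq_1_iff zmult_eq_1_iff)
    then have "(2 * \<nu>)\<^sup>2 = 1"
      unfolding n' by (metis of_int_1 of_int_power)
    then show False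
      using assms by (simp add: power_mult_distrib field_simps)
  qed
qed

text \<open>The exceptional case of the radius estimate. Convergence of the zero series says nothing
  about the size of \<open>ad w\<close>, so h (\<open>ad w\<close>) may diverge on
  \<open>g\<^sub>0\<close>, and this case is treated separately.\<close>

lemma F_nu_fps_trivial:
  assumes "\<nu>\<^sup>2 = 1/4"
  shows "F_nu_fps \<nu> = 0"
proof (rule fps_ext)
  fix n
  have "(2 * \<nu>)\<^sup>2 = 1"
    unfolding power_mult_distrib assms by simp
  then have "even (Suc n) \<Longrightarrow> (2 * \<nu>) ^ Suc n = 1"
    by (metis evenE power_mult power_one)
  then show "F_nu_fps \<nu> $ n = 0 $ n"
  proof (cases "even n")
    case False
    then have "(2 * \<nu>) ^ Suc n = 1"
      using \<open>even (Suc n) \<Longrightarrow> (2 * \<nu>) ^ Suc n = 1\<close> by simp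
    then show ?thesis
      by (simp add: F_nu_fps_def)
  qed (simp add: F_nu_fps_even_nth)
qed

section \<open>Power series of operators\<close>

text \<open>Partial sums over squares converge to the product. Their difference from partial sums
  over triangles is dominated by the same difference for the real series of norms, whose Cauchy
  product converges. The lemma serves operator evaluation, the bracket and \<open>B\<close>
  alike.\<close>

lemma bilinear_Cauchy_product_sums:
  assumes "bounded_bilinear (\<beta> :: 'a::banach \<Rightarrow> 'b::banach \<Rightarrow> 'c::real_normed_vector)"
    and f: "summable (\<lambda>n. norm (f n))" and g: "summable (\<lambda>n. norm (g n))"
  shows "(\<lambda>n. \<Sum>i\<le>n. \<beta> (f i) (g (n - i))) sums \<beta> (\<Sum>n. f n) (\<Sum>n. g n)"
proof -
  interpret bounded_bilinear \<beta> by fact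
  obtain K where K: "0 \<le> K" "\<And>a b. norm (\<beta> a b) \<le> norm a * norm b * K"
    using nonneg_bounded by blast
  define S1 S2 :: "nat \<Rightarrow> (nat \<times> nat) set"
    where "S1 = (\<lambda>n. {..<n} \<times> {..<n})" and "S2 = (\<lambda>n. {(i, j). i + j < n})"
  have sub: "S2 n \<subseteq> S1 n" and fin: "finite (S1 n)" for n
    by (auto simp: S1_def S2_def)
  define h where "h = (\<lambda>(i, j). \<beta> (f i) (g j))"
  define H where "H = (\<lambda>(i, j). norm (f i) * norm (g j))"
  have "(\<lambda>n. \<beta> (\<Sum>i<n. f i) (\<Sum>j<n. g j)) \<longlonglongrightarrow> \<beta> (\<Sum>n. f n) (\<Sum>n. g n)"
    by (intro tendsto summable_LIMSEQ summable_norm_cancel[OF f] summable_norm_cancel[OF g])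
  moreover have "\<beta> (\<Sum>i<n. f i) (\<Sum>j<n. g j) = sum h (S1 n)" for n
    by (simp only: sum_left) (simp add: sum_right S1_def h_def sum.cartesian_product)
  ultimately have 1: "(\<lambda>n. sum h (S1 n)) \<longlonglongrightarrow> \<beta> (\<Sum>n. f n) (\<Sum>n. g n)"
    by simp
  have "(\<lambda>n. (\<Sum>i<n. norm (f i)) * (\<Sum>j<n. norm (g j))) \<longlonglongrightarrow> (\<Sum>n. norm (f n)) * (\<Sum>n. norm (g n))"
    by (intro tendsto_mult summable_LIMSEQ f g)
  moreover have "(\<Sum>i<n. norm (f i)) * (\<Sum>j<n. norm (g j)) = sum H (S1 n)" for n
    by (simp add: sum_product S1_def H_def sum.cartesian_product)
  ultimately have 2: "(\<lambda>n. sum H (S1 n)) \<longlonglongrightarrow> (\<Sum>n. norm (f n)) * (\<Sum>n. norm (g n))"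
    by simp
  have "(\<lambda>n. \<Sum>k<n. \<Sum>i\<le>k. norm (f i) * norm (g (k - i))) \<longlonglongrightarrow> (\<Sum>n. norm (f n)) * (\<Sum>n. norm (g n))"
    using Cauchy_product_sums[of "\<lambda>n. norm (f n)" "\<lambda>n. norm (g n)"] f g by (simp add: sums_def)
  moreover have "(\<Sum>k<n. \<Sum>i\<le>k. norm (f i) * norm (g (k - i))) = sum H (S2 n)" for n
    unfolding S2_def H_def by (rule sum.triangle_reindex[symmetric])
  ultimately have 3: "(\<lambda>n. sum H (S2 n)) \<longlonglongrightarrow> (\<Sum>n. norm (f n)) * (\<Sum>n. norm (g n))"
    by simp
  have 4: "(\<lambda>n. K * (sum H (S1 n) - sum H (S2 n))) \<longlonglongrightarrow> 0"
    using tendsto_mult_left[OF tendsto_diff[OF 2 3], of K] by simp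
  have "norm (sum h (S1 n) - sum h (S2 n)) \<le> K * (sum H (S1 n) - sum H (S2 n))" for n
  proof -
    have "norm (sum h (S1 n - S2 n)) \<le> (\<Sum>p\<in>S1 n - S2 n. K * H p)"
      by (rule sum_norm_le) (use K(2) in \<open>auto simp: h_def H_def mult.commute\<close>)
    then show ?thesis
      by (simp add: sum_diff[OF fin sub] flip: sum_distrib_left)
  qed
  then have "(\<lambda>n. sum h (S1 n) - sum h (S2 n)) \<longlonglongrightarrow> 0"
    by (intro Lim_null_comparison[OF _ 4]) auto
  from tendsto_diff[OF 1 this] have "(\<lambda>n. sum h (S2 n)) \<longlonglongrightarrow> \<beta> (\<Sum>n. f n) (\<Sum>n. g n)"
    by simp
  then show ?thesis
    unfolding sums_def S2_def h_def sum.triangle_reindex .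
qed

text \<open>A quantitative substitute for a bound on the spectral radius. Keeping \<open>C\<close>
  explicit allows one pair of constants to serve for all operators near a given one, as termwise
  differentiation requires.\<close>

definition power_bounded :: "('a::real_normed_vector \<Rightarrow> 'a) \<Rightarrow> real \<Rightarrow> real \<Rightarrow> bool" where
  "power_bounded L C \<rho> \<longleftrightarrow> 0 \<le> C \<and> 0 \<le> \<rho> \<and> (\<forall>n v. norm ((L ^^ n) v) \<le> C * \<rho> ^ n * norm v)"

lemma power_boundedD: "power_bounded L C \<rho> \<Longrightarrow> norm ((L ^^ n) v) \<le> C * \<rho> ^ n * norm v"
  and power_bounded_nonneg: "power_bounded L C \<rho> \<Longrightarrow> 0 \<le> C \<and> 0 \<le> \<rho>"
  by (auto simp: power_bounded_def)

lemma summable_norm_fps: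
  assumes "0 \<le> \<rho>" "ereal \<rho> < fps_conv_radius a"
  shows "summable (\<lambda>n. norm (a $ n) * \<rho> ^ n)"
  using abs_summable_in_conv_radius[of "of_real \<rho>" "fps_nth a"] assms
  by (simp add: fps_conv_radius_def norm_mult norm_power)

context complex_fd_space
begin

lemma bounded_bilinear_cs: "bounded_bilinear cs"
proof -
  have r: "r *\<^sub>R x = cs (of_real r) x" for r x
    by (simp add: cs_of_real)
  have "bilinear cs"
    unfolding bilinear_def
    by (intro conjI allI linearI) (simp_all add: r scaleR_conv_of_real algebra_simps)
  then show ?thesis
    by (simp add: bilinear_conv_bounded_bilinear)
qed

lemma linear_real:
  assumes "Vector_Spaces.linear cs cs f"
  shows "linear f"
proof -
  interpret Vector_Spaces.linear cs cs f by fact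
  show ?thesis
    by (intro linearI) (simp_all add: add scale flip: cs_of_real)
qed

lemma linear_real_functional:
  assumes "Vector_Spaces.linear cs (*) f"
  shows "linear (f :: 'a \<Rightarrow> complex)"
proof -
  interpret Vector_Spaces.linear cs "(*)" f by fact
  show ?thesis
    by (intro linearI) (simp_all add: add scale scaleR_conv_of_real flip: cs_of_real)
qed

definition power_series_op :: "complex fps \<Rightarrow> ('a \<Rightarrow> 'a) \<Rightarrow> 'a \<Rightarrow> 'a" where
  "power_series_op a L v = (\<Sum>n. cs (a $ n) ((L ^^ n) v))"

lemma norm_cs_le: obtains K where "0 \<le> K" "\<And>c x. norm (cs c x) \<le> K * norm c * norm x"
proof -
  interpret bounded_bilinear cs by (rule bounded_bilinear_cs)
  obtain K where "0 \<le> K" "\<forall>a b. norm (cs a b) \<le> norm a * norm b * K"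
    using nonneg_bounded by blast
  then show ?thesis
    using that[of K] by (simp add: algebra_simps)
qed

lemma power_series_op_summable:
  assumes "power_bounded L C \<rho>" "ereal \<rho> < fps_conv_radius a"
  shows "summable (\<lambda>n. norm (cs (a $ n) ((L ^^ n) v)))"
proof -
  obtain K where K: "0 \<le> K" "\<And>c x. norm (cs c x) \<le> K * norm c * norm x"
    using norm_cs_le by blast
  have "summable (\<lambda>n. K * C * norm v * (norm (a $ n) * \<rho> ^ n))"
    using assms by (intro summable_mult summable_norm_fps) (auto simp: power_bounded_def)
  moreover have "norm (norm (cs (a $ n) ((L ^^ n) v))) \<le> K * C * norm v * (norm (a $ n) * \<rho> ^ n)" for n
  proof -
    have "norm (cs (a $ n) ((L ^^ n) v)) \<le> K * norm (a $ n) * norm ((L ^^ n) v)"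
      by (rule K)
    also have "\<dots> \<le> K * norm (a $ n) * (C * \<rho> ^ n * norm v)"
      by (intro mult_left_mono power_boundedD assms) (simp add: K)
    finally show ?thesis
      by (simp add: algebra_simps)
  qed
  ultimately show ?thesis
    by (rule summable_comparison_test'[of _ 0])
qed

lemma power_series_op_sums:
  assumes "power_bounded L C \<rho>" "ereal \<rho> < fps_conv_radius a"
  shows "(\<lambda>n. cs (a $ n) ((L ^^ n) v)) sums power_series_op a L v"
  unfolding power_series_op_def
  by (rule summable_sums[OF summable_norm_cancel[OF power_series_op_summable[OF assms]]])

lemma funpow_linear:
  assumes "Vector_Spaces.linear cs cs L"
  shows "Vector_Spaces.linear cs cs (L ^^ n)"
proof (induction n)
  case 0
  show ?case
    using vector_space_axioms by (simp add: Vector_Spaces.linear_iff)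
next
  case (Suc n)
  with assms show ?case
    by (simp add: Vector_Spaces.linear_iff)
qed

text \<open>A Cauchy product for the pairing of operators with vectors. For this the series of
  \<open>a\<close> has to converge absolutely in operator norm, hence the passage to
  \<open>Blinfun\<close>.\<close>

lemma power_series_op_mult:
  assumes L: "Vector_Spaces.linear cs cs L" and pb: "power_bounded L C \<rho>"
    and a: "ereal \<rho> < fps_conv_radius a" and b: "ereal \<rho> < fps_conv_radius b"
  shows "power_series_op (a * b) L v = power_series_op a L (power_series_op b L v)"
proof -
  obtain K where K: "0 \<le> K" "\<And>c x. norm (cs c x) \<le> K * norm c * norm x"
    using norm_cs_le by blast
  have Ln: "Vector_Spaces.linear cs cs (L ^^ n)" for n
    by (rule funpow_linear[OF L])
  define f where "f = (\<lambda>n. Blinfun (\<lambda>v. cs (a $ n) ((L ^^ n) v)))"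
  have f: "blinfun_apply (f n) v = cs (a $ n) ((L ^^ n) v)" for n v
  proof -
    have "linear (\<lambda>v. cs (a $ n) ((L ^^ n) v))"
      using Ln[of n] by (intro linear_real) (auto simp: Vector_Spaces.linear_iff scale_right_distrib scale_left_commute)
    then show ?thesis
      by (simp add: f_def bounded_linear_Blinfun_apply linear_conv_bounded_linear)
  qed
  have nf: "norm (f n) \<le> K * C * (norm (a $ n) * \<rho> ^ n)" for n
  proof (rule norm_blinfun_bound)
    show "0 \<le> K * C * (norm (a $ n) * \<rho> ^ n)"
      using K pb by (simp add: power_bounded_def)
    fix v
    have "norm (f n v) \<le> K * norm (a $ n) * norm ((L ^^ n) v)"
      unfolding f by (rule K)
    also have "\<dots> \<le> K * norm (a $ n) * (C * \<rho> ^ n * norm v)"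
      by (intro mult_left_mono power_boundedD pb) (simp add: K)
    finally show "norm (f n v) \<le> K * C * (norm (a $ n) * \<rho> ^ n) * norm v"
      by (simp add: algebra_simps)
  qed
  have "summable (\<lambda>n. K * C * (norm (a $ n) * \<rho> ^ n))"
    using pb a by (intro summable_mult summable_norm_fps) (auto simp: power_bounded_def)
  then have sf: "summable (\<lambda>n. norm (f n))"
    by (rule summable_comparison_test'[where N = 0]) (simp add: nf)
  define g where "g = (\<lambda>n. cs (b $ n) ((L ^^ n) v))"
  have sg: "summable (\<lambda>n. norm (g n))"
    unfolding g_def by (rule power_series_op_summable[OF pb b])
  have "(\<lambda>n. \<Sum>i\<le>n. blinfun_apply (f i) (g (n - i))) sums (suminf f) (suminf g)"
    by (rule bilinear_Cauchy_product_sums[OF bounded_bilinear_blinfun_apply sf sg])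
  moreover have "(\<Sum>i\<le>n. blinfun_apply (f i) (g (n - i))) = cs ((a * b) $ n) ((L ^^ n) v)" for n
  proof -
    have "blinfun_apply (f i) (g (n - i)) = cs (a $ i * b $ (n - i)) ((L ^^ n) v)" if "i \<le> n" for i
    proof -
      have "(L ^^ i) ((L ^^ (n - i)) v) = (L ^^ n) v"
        using that by (metis funpow_add le_add_diff_inverse o_apply)
      then show ?thesis
        using Ln[of i] by (simp add: f g_def Vector_Spaces.linear_iff)
    qed
    then show ?thesis
      by (simp add: fps_mult_nth atLeast0AtMost scale_sum_left)
  qed
  moreover have "blinfun_apply (suminf f) w = power_series_op a L w" for w
  proof -
    have "(\<lambda>n. blinfun_apply (f n) w) sums blinfun_apply (suminf f) w"
      using bounded_linear.sums[OF bounded_bilinear.bounded_linear_left[OF bounded_bilinear_blinfun_apply]] summable_sums[OF summable_norm_cancel[OF sf]] by blast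
    then show ?thesis
      unfolding f power_series_op_def by (rule sums_unique)
  qed
  ultimately have "(\<lambda>n. cs ((a * b) $ n) ((L ^^ n) v)) sums power_series_op a L (power_series_op b L v)"
    by (simp add: power_series_op_def g_def)
  then show ?thesis
    unfolding power_series_op_def[of "a * b"] by (rule sums_unique[symmetric])
qed

lemma power_series_op_add:
  assumes "power_bounded L C \<rho>" "ereal \<rho> < fps_conv_radius a" "ereal \<rho> < fps_conv_radius b"
  shows "power_series_op (a + b) L v = power_series_op a L v + power_series_op b L v"
proof -
  have "(\<lambda>n. cs ((a + b) $ n) ((L ^^ n) v)) sums (power_series_op a L v + power_series_op b L v)"
    using sums_add[OF power_series_op_sums[OF assms(1,2)] power_series_op_sums[OF assms(1,3)]]
    by (simp add: scale_left_distrib)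
  then show ?thesis
    unfolding power_series_op_def[of "a + b"] by (rule sums_unique[symmetric])
qed

lemma power_series_op_1 [simp]: "power_series_op 1 L v = v"
proof -
  have "(\<lambda>n. cs ((1 :: complex fps) $ n) ((L ^^ n) v)) sums (\<Sum>n\<in>{0}. cs ((1 :: complex fps) $ n) ((L ^^ n) v))"
    by (rule sums_finite) auto
  then show ?thesis
    unfolding power_series_op_def by (simp add: sums_unique[symmetric])
qed

lemma power_series_op_vec_add:
  assumes L: "Vector_Spaces.linear cs cs L" and pb: "power_bounded L C \<rho>" and a: "ereal \<rho> < fps_conv_radius a"
  shows "power_series_op a L (v + w) = power_series_op a L v + power_series_op a L w"
proof -
  have "(\<lambda>n. cs (a $ n) ((L ^^ n) (v + w))) sums (power_series_op a L v + power_series_op a L w)"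
    using sums_add[OF power_series_op_sums[OF pb a, of v] power_series_op_sums[OF pb a, of w]]
      funpow_linear[OF L]
    by (simp add: Vector_Spaces.linear_iff scale_right_distrib)
  then show ?thesis
    unfolding power_series_op_def[of _ _ "v + w"] by (rule sums_unique[symmetric])
qed

end

section \<open>Leibniz rules for powers of \<open>ad w\<close> and the differential of exp
  (\<open>ad w\<close>)\<close>

context complex_lie_algebra
begin

lemma br_bilinear:
  shows br_add_left: "br (x + x') y = br x y + br x' y"
    and br_add_right: "br x (y + y') = br x y + br x y'"
    and br_scale_left: "br (cs c x) y = cs c (br x y)"
    and br_scale_right: "br x (cs c y) = cs c (br x y)"
  using br_linear_left br_linear_right by (auto simp: Vector_Spaces.linear_iff)

lemma bounded_bilinear_br: "bounded_bilinear br"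
proof -
  have "bilinear br"
    unfolding bilinear_def
    using linear_real[OF br_linear_right] linear_real[OF br_linear_left] by blast
  then show ?thesis
    by (simp add: bilinear_conv_bounded_bilinear)
qed

sublocale br: bounded_bilinear br
  by (rule bounded_bilinear_br)

lemma br_antisym: "br x y = - br y x"
proof -
  have "br x y + br y x = 0"
    using br_self[of "x + y"] unfolding br_add_left br_add_right by (simp add: br_self add.commute)
  then show ?thesis
    by (simp add: eq_neg_iff_add_eq_0)
qed

lemma br_derivation: "br w (br x y) = br (br w x) y + br x (br w y)"
proof -
  have "br y (br w x) = - br (br w x) y" "br x (br y w) = - br x (br w y)"
    by (rule br_antisym) (simp add: br_antisym[of y w] br.minus_right)
  then show ?thesis
    using jacobi[of w x y] by (simp add: algebra_simps add_eq_0_iff)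
qed

lemma funpow_br_Leibniz:
  "(br w ^^ n) (br x y) = (\<Sum>i\<le>n. of_nat (n choose i) *\<^sub>R br ((br w ^^ i) x) ((br w ^^ (n - i)) y))"
proof (induction n)
  case (Suc n)
  define t where "t = (\<lambda>i j. br ((br w ^^ i) x) ((br w ^^ j) y))"
  have "(br w ^^ Suc n) (br x y) = (\<Sum>i\<le>n. of_nat (n choose i) *\<^sub>R br w (t i (n - i)))"
    by (simp add: Suc br.sum_right br.scaleR_right t_def)
  also have "\<dots> = (\<Sum>i\<le>n. of_nat (n choose i) *\<^sub>R t (Suc i) (n - i))
      + (\<Sum>i\<le>n. of_nat (n choose i) *\<^sub>R t i (Suc n - i))"
  proof -
    have "br w (t i (n - i)) = t (Suc i) (n - i) + t i (Suc n - i)" if "i \<le> n" for i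
      using that by (simp add: t_def br_derivation[of w "(br w ^^ i) x"] Suc_diff_le)
    then show ?thesis
      by (simp add: scaleR_right_distrib flip: sum.distrib)
  qed
  also have "(\<Sum>i\<le>n. of_nat (n choose i) *\<^sub>R t i (Suc n - i)) = (\<Sum>i\<le>Suc n. of_nat (n choose i) *\<^sub>R t i (Suc n - i))"
    by simp
  also have "\<dots> = t 0 (Suc n) + (\<Sum>i\<le>n. of_nat (n choose Suc i) *\<^sub>R t (Suc i) (n - i))"
    by (subst sum.atMost_Suc_shift) simp
  also have "(\<Sum>i\<le>n. of_nat (n choose i) *\<^sub>R t (Suc i) (n - i)) + (t 0 (Suc n) + (\<Sum>i\<le>n. of_nat (n choose Suc i) *\<^sub>R t (Suc i) (n - i)))
      = t 0 (Suc n) + (\<Sum>i\<le>n. of_nat (Suc n choose Suc i) *\<^sub>R t (Suc i) (n - i))"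
    by (simp add: scaleR_left_distrib sum.distrib)
  also have "\<dots> = (\<Sum>i\<le>Suc n. of_nat (Suc n choose i) *\<^sub>R t i (Suc n - i))"
    by (subst sum.atMost_Suc_shift) simp
  finally show ?case
    by (simp add: t_def)
qed simp

text \<open>In commuting symbols, with \<open>br w\<close> acting on a bracket as x + y, this is the
  binomial expansion of ((x + y)^(m+1) - y^(m+1)) / x. In the induction the top term is split off by
  itself, the other terms absorb one \<open>br w\<close> into \<open>y\<close>, and Pascal's rule
  joins the two sums.\<close>

lemma funpow_br_sum_Leibniz:
  "(\<Sum>i\<le>m. (br w ^^ i) (br x ((br w ^^ (m - i)) y)))
     = (\<Sum>p\<le>m. of_nat (Suc m choose Suc p) *\<^sub>R br ((br w ^^ p) x) ((br w ^^ (m - p)) y))"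
proof (induction m arbitrary: y)
  case (Suc m)
  define t where "t = (\<lambda>i j. br ((br w ^^ i) x) ((br w ^^ j) y))"
  have "(\<Sum>i\<le>Suc m. (br w ^^ i) (br x ((br w ^^ (Suc m - i)) y)))
      = (\<Sum>i\<le>m. (br w ^^ i) (br x ((br w ^^ (m - i)) (br w y)))) + (br w ^^ Suc m) (br x y)"
    by (auto intro!: sum.cong simp: Suc_diff_le funpow_swap1)
  also have "(\<Sum>i\<le>m. (br w ^^ i) (br x ((br w ^^ (m - i)) (br w y))))
      = (\<Sum>p\<le>m. of_nat (Suc m choose Suc p) *\<^sub>R t p (Suc m - p))"
    unfolding Suc by (auto intro!: sum.cong simp: Suc_diff_le funpow_swap1 t_def)
  also have "\<dots> = (\<Sum>p\<le>Suc m. of_nat (Suc m choose Suc p) *\<^sub>R t p (Suc m - p))"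
    by (simp add: binomial_eq_0)
  also have "(br w ^^ Suc m) (br x y) = (\<Sum>p\<le>Suc m. of_nat (Suc m choose p) *\<^sub>R t p (Suc m - p))"
    unfolding t_def by (rule funpow_br_Leibniz)
  also have "(\<Sum>p\<le>Suc m. of_nat (Suc m choose Suc p) *\<^sub>R t p (Suc m - p))
      + (\<Sum>p\<le>Suc m. of_nat (Suc m choose p) *\<^sub>R t p (Suc m - p))
      = (\<Sum>p\<le>Suc m. of_nat (Suc (Suc m) choose Suc p) *\<^sub>R t p (Suc m - p))"
    by (simp only: sum.distrib[symmetric] scaleR_left_distrib[symmetric] binomial_Suc_Suc of_nat_add add.commute)
  finally show ?case
    by (simp add: t_def)
qed simp

lemma scale_of_nat: "of_nat n *\<^sub>R x = cs (of_nat n) x"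
  using cs_of_real[of "of_nat n"] by simp

text \<open>The exponential of a derivation is an automorphism: binomial coefficients of the Leibniz
  rule divided by n! are the coefficients of a Cauchy product of two exponentials.\<close>

lemma exp_op_br:
  assumes pb: "power_bounded (br w) C \<rho>"
  shows "power_series_op (fps_exp 1) (br w) (br x y)
    = br (power_series_op (fps_exp 1) (br w) x) (power_series_op (fps_exp 1) (br w) y)"
proof -
  have r: "ereal \<rho> < fps_conv_radius (fps_exp 1 :: complex fps)"
    by simp
  have "(\<lambda>n. \<Sum>i\<le>n. br (cs (fps_exp 1 $ i) ((br w ^^ i) x)) (cs (fps_exp 1 $ (n - i)) ((br w ^^ (n - i)) y)))
      sums br (power_series_op (fps_exp 1) (br w) x) (power_series_op (fps_exp 1) (br w) y)"
    unfolding power_series_op_def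
    by (intro bilinear_Cauchy_product_sums bounded_bilinear_br power_series_op_summable[OF pb r])
  moreover have "(\<Sum>i\<le>n. br (cs (fps_exp 1 $ i) ((br w ^^ i) x)) (cs (fps_exp 1 $ (n - i)) ((br w ^^ (n - i)) y)))
      = cs (fps_exp 1 $ n) ((br w ^^ n) (br x y))" for n
    unfolding funpow_br_Leibniz scale_sum_right scale_of_nat
    by (intro sum.cong) (auto simp: br_scale_left br_scale_right binomial_fact field_simps)
  ultimately show ?thesis
    unfolding power_series_op_def[of _ _ "br x y"] by (simp only: sums_unique[symmetric])
qed

text \<open>The series is the termwise derivative of exp (\<open>ad w\<close>) y in direction
  \<open>x\<close>. Its value is the classical formula for the differential of the exponential, with
  the factor (exp z - 1) / z at \<open>ad w\<close>.\<close>

lemma exp_op_derivative: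
  assumes pb: "power_bounded (br w) C \<rho>"
  shows "(\<lambda>m. cs (fps_exp 1 $ Suc m) (\<Sum>i\<le>m. (br w ^^ i) (br x ((br w ^^ (m - i)) y))))
    sums br (power_series_op expm1_over_X (br w) x) (power_series_op (fps_exp 1) (br w) y)"
proof -
  have "(\<lambda>n. \<Sum>i\<le>n. br (cs (expm1_over_X $ i) ((br w ^^ i) x)) (cs (fps_exp 1 $ (n - i)) ((br w ^^ (n - i)) y)))
      sums br (power_series_op expm1_over_X (br w) x) (power_series_op (fps_exp 1) (br w) y)"
    unfolding power_series_op_def
    by (intro bilinear_Cauchy_product_sums bounded_bilinear_br power_series_op_summable[OF pb])
       (simp_all add: fps_conv_radius_expm1_over_X)
  moreover have "(\<Sum>i\<le>n. br (cs (expm1_over_X $ i) ((br w ^^ i) x)) (cs (fps_exp 1 $ (n - i)) ((br w ^^ (n - i)) y)))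
      = cs (fps_exp 1 $ Suc n) (\<Sum>i\<le>n. (br w ^^ i) (br x ((br w ^^ (n - i)) y)))" for n
    unfolding funpow_br_sum_Leibniz scale_sum_right scale_of_nat
  proof (intro sum.cong refl)
    fix i assume "i \<in> {..n}"
    then have "of_nat (Suc n choose Suc i) = (fact (Suc n) / (fact (Suc i) * fact (n - i)) :: complex)"
      by (subst binomial_fact) auto
    then have c: "expm1_over_X $ i * fps_exp 1 $ (n - i) = fps_exp 1 $ Suc n * of_nat (Suc n choose Suc i)"
      by (simp add: expm1_over_X_nth del: fact_Suc)
    show "br (cs (expm1_over_X $ i) ((br w ^^ i) x)) (cs (fps_exp 1 $ (n - i)) ((br w ^^ (n - i)) y))
        = cs (fps_exp 1 $ Suc n) (cs (of_nat (Suc n choose Suc i)) (br ((br w ^^ i) x) ((br w ^^ (n - i)) y)))"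
      using c by (simp add: br_scale_left br_scale_right mult.commute)
  qed
  ultimately show ?thesis
    by simp
qed

end

section \<open>Termwise differentiation of power series in \<open>ad w\<close>\<close>

text \<open>The Weierstrass test supplies the uniform convergence of derivatives that
  \<open>has_derivative_series\<close> asks for.\<close>

lemma has_derivative_series_bounded:
  fixes f :: "nat \<Rightarrow> 'a::real_normed_vector \<Rightarrow> 'b::banach"
  assumes S: "convex S" "open S" "x \<in> S"
    and f': "\<And>n x. x \<in> S \<Longrightarrow> (f n has_derivative f' n x) (at x)"
    and bound: "\<And>n x h. x \<in> S \<Longrightarrow> norm (f' n x h) \<le> M n * norm h"
    and M: "summable M"
    and f: "\<And>x. x \<in> S \<Longrightarrow> summable (\<lambda>n. f n x)"
  shows "((\<lambda>x. \<Sum>n. f n x) has_derivative (\<lambda>h. \<Sum>n. f' n x h)) (at x)"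
    and "summable (\<lambda>n. f' n x h)"
proof -
  have sf': "summable (\<lambda>n. norm (f' n x h))" if "x \<in> S" for x h
    by (rule summable_comparison_test'[where N = 0, OF summable_mult2[OF M, of "norm h"]])
       (simp add: bound[OF that])
  then show "summable (\<lambda>n. f' n x h)"
    using S(3) by (intro summable_norm_cancel[of "\<lambda>n. f' n x h"])
  have "\<forall>\<^sub>F n in sequentially. \<forall>x\<in>S. \<forall>h. norm ((\<Sum>i<n. f' i x h) - (\<Sum>i. f' i x h)) \<le> e * norm h"
    if e: "e > 0" for e
  proof -
    obtain N where N: "\<And>n. n \<ge> N \<Longrightarrow> norm (\<Sum>i. M (i + n)) < e"
      using suminf_exist_split[OF e M] by blast
    have "norm ((\<Sum>i<n. f' i x h) - (\<Sum>i. f' i x h)) \<le> e * norm h" if n: "n \<ge> N" and x: "x \<in> S" for n x h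
    proof -
      have s: "summable (\<lambda>i. norm (f' (i + n) x h))" "summable (\<lambda>i. M (i + n))"
        using summable_ignore_initial_segment[OF sf'[OF x, of h], of n] summable_ignore_initial_segment[OF M, of n]
        by simp_all
      have "norm ((\<Sum>i<n. f' i x h) - (\<Sum>i. f' i x h)) = norm (\<Sum>i. f' (i + n) x h)"
        using suminf_minus_initial_segment[OF summable_norm_cancel[OF sf'[OF x, of h]], of n]
        by (simp add: norm_minus_commute)
      also have "\<dots> \<le> (\<Sum>i. norm (f' (i + n) x h))"
        by (rule summable_norm[OF s(1)])
      also have "\<dots> \<le> (\<Sum>i. M (i + n) * norm h)"
        by (rule suminf_le) (use bound[OF x] s in \<open>auto intro: summable_mult2\<close>)
      also have "\<dots> = (\<Sum>i. M (i + n)) * norm h"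
        by (rule suminf_mult2[symmetric, OF s(2)])
      also have "\<dots> \<le> e * norm h"
        using N[OF n] by (intro mult_right_mono) auto
      finally show ?thesis .
    qed
    then show ?thesis
      unfolding eventually_sequentially by blast
  qed
  from has_derivative_series[OF S(1) has_derivative_at_withinI[OF f'] this S(3) summable_sums[OF f[OF S(3)]]]
  obtain g where g: "\<And>x. x \<in> S \<Longrightarrow> (\<lambda>n. f n x) sums g x"
      "\<And>x. x \<in> S \<Longrightarrow> (g has_derivative (\<lambda>h. \<Sum>n. f' n x h)) (at x within S)"
    by auto
  have "(g has_derivative (\<lambda>h. \<Sum>n. f' n x h)) (at x)"
    using g(2)[OF S(3)] unfolding at_within_open[OF S(3,2)] .
  then show "((\<lambda>x. \<Sum>n. f n x) has_derivative (\<lambda>h. \<Sum>n. f' n x h)) (at x)"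
    by (rule has_derivative_transform_within_open[OF _ S(2,3)]) (rule sums_unique[OF g(1)])
qed

lemma summable_deriv_fps:
  fixes a :: "complex fps"
  assumes "0 \<le> \<rho>" "ereal \<rho> < fps_conv_radius a"
  shows "summable (\<lambda>m. norm (a $ Suc m) * real (Suc m) * \<rho> ^ m)"
proof -
  have "ereal \<rho> < fps_conv_radius (fps_deriv a)"
    using assms(2) fps_conv_radius_deriv[of a] by (rule less_le_trans)
  from summable_norm_fps[OF assms(1) this] show ?thesis
    by (simp add: norm_mult mult.commute mult.left_commute del: of_nat_Suc)
qed

context complex_lie_algebra
begin

lemma norm_br_le: obtains M where "0 < M" "\<And>x y. norm (br x y) \<le> M * norm x * norm y"
  using br.pos_bounded by (metis mult.commute mult.left_commute)

lemma has_derivative_funpow_br: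
  "((\<lambda>w. (br w ^^ n) y) has_derivative
     (\<lambda>\<eta>. \<Sum>i<n. (br w ^^ i) (br \<eta> ((br w ^^ (n - Suc i)) y)))) (at w)"
proof (induction n)
  case (Suc n)
  have "((\<lambda>w. br w ((br w ^^ n) y)) has_derivative
      (\<lambda>\<eta>. br w (\<Sum>i<n. (br w ^^ i) (br \<eta> ((br w ^^ (n - Suc i)) y))) + br \<eta> ((br w ^^ n) y))) (at w)"
    by (rule br.FDERIV[OF has_derivative_ident Suc])
  moreover have "br w (\<Sum>i<n. (br w ^^ i) (br \<eta> ((br w ^^ (n - Suc i)) y))) + br \<eta> ((br w ^^ n) y)
      = (\<Sum>i<Suc n. (br w ^^ i) (br \<eta> ((br w ^^ (Suc n - Suc i)) y)))" for \<eta>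
    by (simp only: sum.lessThan_Suc_shift br.sum_right) (simp add: add.commute)
  ultimately show ?case
    by simp
qed simp

lemma funpow_br_derivative_bound:
  assumes M: "0 \<le> M" "\<And>x y. norm (br x y) \<le> M * norm x * norm y"
    and pb: "power_bounded (br w) C \<rho>"
  shows "norm (\<Sum>i<Suc m. (br w ^^ i) (br \<eta> ((br w ^^ (Suc m - Suc i)) y)))
    \<le> C * C * M * norm y * (real (Suc m) * \<rho> ^ m) * norm \<eta>"
proof -
  note nn = power_bounded_nonneg[OF pb]
  have "norm ((br w ^^ i) (br \<eta> ((br w ^^ (Suc m - Suc i)) y))) \<le> C * C * M * norm y * \<rho> ^ m * norm \<eta>"
    if "i < Suc m" for i
  proof -
    have "norm ((br w ^^ i) (br \<eta> ((br w ^^ (Suc m - Suc i)) y)))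
        \<le> C * \<rho> ^ i * (M * norm \<eta> * (C * \<rho> ^ (m - i) * norm y))"
      using nn M by (intro order.trans[OF power_boundedD[OF pb]] mult_left_mono order.trans[OF M(2)])
        (auto intro!: power_boundedD[OF pb])
    also have "\<dots> = C * C * M * norm y * (\<rho> ^ i * \<rho> ^ (m - i)) * norm \<eta>"
      by (simp add: algebra_simps)
    also have "\<rho> ^ i * \<rho> ^ (m - i) = \<rho> ^ m"
      using that by (simp flip: power_add)
    finally show ?thesis .
  qed
  then have "norm (\<Sum>i<Suc m. (br w ^^ i) (br \<eta> ((br w ^^ (Suc m - Suc i)) y)))
      \<le> (\<Sum>i<Suc m. C * C * M * norm y * \<rho> ^ m * norm \<eta>)"
    by (intro sum_norm_le) auto
  then show ?thesis
    by (simp add: algebra_simps)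
qed

text \<open>The majorant \<open>N\<close> of the differentiated series is that of the derivative of
  the power series at \<open>\<rho>\<close>, uniform on the ball. The term of order 0 is constant in
  \<open>w\<close>, which explains the index shift in the series for \<open>D\<close>.\<close>

lemma power_series_op_has_derivative:
  assumes r: "ereal \<rho> < fps_conv_radius a" and \<delta>: "0 < \<delta>"
    and pb: "\<And>w'. w' \<in> ball w \<delta> \<Longrightarrow> power_bounded (br w') C \<rho>"
  obtains D where "((\<lambda>w. power_series_op a (br w) y) has_derivative D) (at w)"
    and "\<And>\<eta>. (\<lambda>m. cs (a $ Suc m) (\<Sum>i\<le>m. (br w ^^ i) (br \<eta> ((br w ^^ (m - i)) y)))) sums D \<eta>"
proof -
  obtain K where K: "0 \<le> K" "\<And>c x. norm (cs c x) \<le> K * norm c * norm x"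
    using norm_cs_le by blast
  obtain M where M: "0 < M" "\<And>x y. norm (br x y) \<le> M * norm x * norm y"
    using norm_br_le by blast
  have w: "w \<in> ball w \<delta>"
    using \<delta> by simp
  note nn = power_bounded_nonneg[OF pb[OF w]]
  define f where "f = (\<lambda>n w. cs (a $ n) ((br w ^^ n) y))"
  define f' where "f' = (\<lambda>n w \<eta>. cs (a $ n) (\<Sum>i<n. (br w ^^ i) (br \<eta> ((br w ^^ (n - Suc i)) y))))"
  define N where "N = (\<lambda>n. K * C * C * M * norm y * (norm (a $ n) * real n * \<rho> ^ (n - 1)))"
  have "summable (\<lambda>m. N (Suc m))"
    using summable_deriv_fps[OF _ r] nn by (auto simp: N_def intro!: summable_mult)
  then have N: "summable N"
    by (simp add: summable_Suc_iff)
  have bound: "norm (f' n w' \<eta>) \<le> N n * norm \<eta>" if w': "w' \<in> ball w \<delta>" for n w' \<eta>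
  proof (cases n)
    case (Suc m)
    have "norm (f' n w' \<eta>) \<le> K * norm (a $ n) * (C * C * M * norm y * (real (Suc m) * \<rho> ^ m) * norm \<eta>)"
      unfolding f'_def Suc using K M
      by (intro order.trans[OF K(2)] mult_left_mono funpow_br_derivative_bound pb w') auto
    then show ?thesis
      by (simp add: N_def Suc algebra_simps)
  qed (simp add: f'_def N_def)
  have der: "(f n has_derivative f' n w') (at w')" for n w'
    unfolding f_def f'_def
    by (intro bounded_linear.has_derivative[OF bounded_bilinear.bounded_linear_right[OF bounded_bilinear_cs]]
        has_derivative_funpow_br)
  have sm: "summable (\<lambda>n. f n w')" if "w' \<in> ball w \<delta>" for w'
    unfolding f_def using power_series_op_sums[OF pb[OF that] r] by (rule sums_summable)
  note * = has_derivative_series_bounded[where f = f and f' = f' and S = "ball w \<delta>" and M = N, OF _ _ w der bound N sm]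
  have "(\<lambda>m. f' (Suc m) w \<eta>) sums (\<Sum>n. f' n w \<eta>)" for \<eta>
  proof -
    have "(\<lambda>n. f' n w \<eta>) sums (\<Sum>n. f' n w \<eta>)"
      by (rule summable_sums, rule *(2)) auto
    moreover have "f' 0 w \<eta> = 0"
      by (simp add: f'_def)
    ultimately show ?thesis
      using sums_Suc_iff[of "\<lambda>n. f' n w \<eta>"] by simp
  qed
  moreover have "((\<lambda>w. power_series_op a (br w) y) has_derivative (\<lambda>\<eta>. \<Sum>n. f' n w \<eta>)) (at w)"
    using *(1) by (simp add: f_def power_series_op_def)
  ultimately show ?thesis
    using that by (simp add: f'_def lessThan_Suc_atMost)
qed

section \<open>Uniform bounds for the powers of \<open>ad w\<close>\<close>

lemma power_bounded_small:
  assumes "0 < \<rho>"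
  obtains \<delta> where "0 < \<delta>" "\<And>w. w \<in> ball 0 \<delta> \<Longrightarrow> power_bounded (br w) 1 \<rho>"
proof -
  obtain M where M: "0 < M" "\<And>x y. norm (br x y) \<le> M * norm x * norm y"
    using norm_br_le by blast
  have "power_bounded (br w) 1 \<rho>" if w: "w \<in> ball 0 (\<rho> / M)" for w
  proof -
    have "norm ((br w ^^ n) v) \<le> \<rho> ^ n * norm v" for n v
    proof (induction n)
      case (Suc n)
      have "M * norm w \<le> \<rho>"
        using w M(1) by (simp add: pos_less_divide_eq mult.commute less_imp_le)
      then have "M * norm w * norm ((br w ^^ n) v) \<le> \<rho> * (\<rho> ^ n * norm v)"
        using Suc assms M(1) by (intro mult_mono) auto
      then show ?case
        using M(2)[of w "(br w ^^ n) v"] by simp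
    qed simp
    then show ?thesis
      using assms by (simp add: power_bounded_def)
  qed
  then show ?thesis
    using that[of "\<rho> / M"] assms M(1) by simp
qed

lemma power_bounded_global:
  obtains M where "0 < M" "\<And>w n v. norm ((br w ^^ n) v) \<le> (M * norm w) ^ n * norm v"
proof -
  obtain M where M: "0 < M" "\<And>x y. norm (br x y) \<le> M * norm x * norm y"
    using norm_br_le by blast
  have "norm ((br w ^^ n) v) \<le> (M * norm w) ^ n * norm v" for w n v
  proof (induction n)
    case (Suc n)
    have "norm ((br w ^^ Suc n) v) \<le> M * norm w * norm ((br w ^^ n) v)"
      using M(2) by simp
    also have "\<dots> \<le> M * norm w * ((M * norm w) ^ n * norm v)"
      using M(1) by (intro mult_left_mono Suc) auto
    finally show ?case
      by simp
  qed simp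
  then show ?thesis
    using that M(1) by blast
qed

text \<open>A strict bound on a single power survives a small change of \<open>w\<close>, because
  the N-th power is continuous in \<open>w\<close> and it suffices to compare on a basis. Writing n
  = N k + s then bounds all powers, with finitely many remainders s.\<close>

lemma power_bounded_near:
  assumes N: "0 < N" and \<rho>: "0 < \<rho>" and lt: "\<And>v. v \<noteq> 0 \<Longrightarrow> norm ((br w ^^ N) v) \<le> q * norm v" "q < \<rho> ^ N"
  obtains C \<delta> where "0 < \<delta>" "\<And>w'. w' \<in> ball w \<delta> \<Longrightarrow> power_bounded (br w') C \<rho>"
proof -
  obtain M where M: "0 < M" "\<And>w n v. norm ((br w ^^ n) v) \<le> (M * norm w) ^ n * norm v"
    using power_bounded_global by blast
  define d where "d = (\<lambda>w'. \<Sum>b\<in>Basis. norm ((br w' ^^ N) b - (br w ^^ N) b))"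
  have "isCont (\<lambda>w'. (br w' ^^ N) b) w" for b
    using has_derivative_continuous[OF has_derivative_funpow_br] by blast
  then have "isCont d w"
    unfolding d_def by (intro continuous_intros)
  moreover have "d w = 0"
    by (simp add: d_def)
  ultimately obtain \<delta>1 where \<delta>1: "0 < \<delta>1" "\<And>w'. dist w' w < \<delta>1 \<Longrightarrow> d w' < \<rho> ^ N - q"
    using lt(2) unfolding continuous_at_eps_delta by (metis abs_less_iff diff_gt_0_iff_gt dist_real_def diff_zero)
  define \<delta> where "\<delta> = min \<delta>1 1"
  define M0 where "M0 = M * (norm w + 1)"
  \<comment> \<open>\<open>M0\<close> bounds the norm of \<open>ad w'\<close> on the ball, so the
    sum dominates the factor (\<open>M0\<close> / \<open>\<rho>\<close>)^s lost in each remainder s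
    < N.\<close>
  define C where "C = (\<Sum>s<N. (M0 / \<rho>) ^ s)"
  have M0: "0 < M0"
    unfolding M0_def using M(1) by (intro mult_pos_pos) (auto intro: add_nonneg_pos)
  have "power_bounded (br w') C \<rho>" if w': "w' \<in> ball w \<delta>" for w'
  proof -
    have lin: "linear (\<lambda>v. (br w' ^^ N) v - (br w ^^ N) v)"
      by (intro linear_compose_sub linear_real funpow_linear br_linear_right)
    have step: "norm ((br w' ^^ N) v) \<le> \<rho> ^ N * norm v" for v
    proof -
      have "(br w' ^^ N) v - (br w ^^ N) v = (\<Sum>b\<in>Basis. (v \<bullet> b) *\<^sub>R ((br w' ^^ N) b - (br w ^^ N) b))"
      proof -
        let ?f = "\<lambda>v. (br w' ^^ N) v - (br w ^^ N) v"
        have "?f v = ?f (\<Sum>b\<in>Basis. (v \<bullet> b) *\<^sub>R b)"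
          by (simp only: euclidean_representation)
        also have "\<dots> = (\<Sum>b\<in>Basis. (v \<bullet> b) *\<^sub>R ?f b)"
          by (simp only: linear_sum[OF lin] linear_cmul[OF lin])
        finally show ?thesis .
      qed
      then have "norm ((br w' ^^ N) v - (br w ^^ N) v) \<le> (\<Sum>b\<in>Basis. norm v * norm ((br w' ^^ N) b - (br w ^^ N) b))"
        by (auto intro!: sum_norm_le mult_right_mono simp: Basis_le_norm)
      also have "\<dots> = d w' * norm v"
        by (simp add: d_def sum_distrib_left mult.commute)
      also have "\<dots> \<le> (\<rho> ^ N - q) * norm v"
        using \<delta>1(2)[of w'] w' by (intro mult_right_mono) (auto simp: \<delta>_def dist_commute)
      finally have "norm ((br w' ^^ N) v - (br w ^^ N) v) \<le> (\<rho> ^ N - q) * norm v" .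
      moreover have "norm ((br w ^^ N) v) \<le> q * norm v"
        using lt(1)[of v] linear_0[OF linear_real[OF funpow_linear[OF br_linear_right]]] by (cases "v = 0") auto
      ultimately show ?thesis
        using norm_triangle_sub[of "(br w' ^^ N) v" "(br w ^^ N) v"] by (simp add: algebra_simps)
    qed
    have steps: "norm (((br w' ^^ N) ^^ k) v) \<le> (\<rho> ^ N) ^ k * norm v" for k v
    proof (induction k)
      case (Suc k)
      have "norm (((br w' ^^ N) ^^ Suc k) v) \<le> \<rho> ^ N * norm (((br w' ^^ N) ^^ k) v)"
        using step by simp
      also have "\<dots> \<le> \<rho> ^ N * ((\<rho> ^ N) ^ k * norm v)"
        using \<rho> by (intro mult_left_mono Suc) auto
      finally show ?case
        by simp
    qed simp
    have nw: "M * norm w' \<le> M0"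
    proof -
      have "norm w' \<le> norm w + 1"
        using w' norm_triangle_sub[of w' w] by (auto simp: \<delta>_def dist_norm norm_minus_commute)
      then show ?thesis
        unfolding M0_def using M(1) by (intro mult_left_mono) auto
    qed
    have "norm ((br w' ^^ n) v) \<le> C * \<rho> ^ n * norm v" for n v
    proof -
      define k s where "k = n div N" and "s = n mod N"
      have n: "n = N * k + s" and s: "s < N"
        using N by (auto simp: k_def s_def)
      have "norm ((br w' ^^ n) v) = norm (((br w' ^^ N) ^^ k) ((br w' ^^ s) v))"
        unfolding n funpow_add by (simp add: funpow_mult)
      also have "\<dots> \<le> (\<rho> ^ N) ^ k * ((M * norm w') ^ s * norm v)"
        using \<rho> by (intro order.trans[OF steps] mult_left_mono M) auto
      also have "\<dots> \<le> (\<rho> ^ N) ^ k * (M0 ^ s * norm v)"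
        using \<rho> nw M(1) by (intro mult_left_mono mult_right_mono power_mono) auto
      also have "\<dots> = \<rho> ^ n * (M0 / \<rho>) ^ s * norm v"
        using \<rho> by (simp add: n power_add power_mult power_divide)
      also have "\<dots> \<le> \<rho> ^ n * C * norm v"
      proof -
        have "(M0 / \<rho>) ^ s \<le> C"
          unfolding C_def using s M0 \<rho> by (intro member_le_sum) auto
        then show ?thesis
          using \<rho> by (intro mult_right_mono mult_left_mono) auto
      qed
      finally show ?thesis
        by (simp add: mult.commute)
    qed
    moreover have "0 \<le> C"
      unfolding C_def using M0 \<rho> by (intro sum_nonneg) auto
    ultimately show ?thesis
      using \<rho> by (simp add: power_bounded_def)
  qed
  then show ?thesis
    using that[of \<delta> C] \<delta>1(1) by (simp add: \<delta>_def)
qed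

end

context complex_lie_algebra
begin

lemma funpow_br_scaleR: "(br (t *\<^sub>R w) ^^ n) y = t ^ n *\<^sub>R (br w ^^ n) y"
  by (induction n) (simp_all add: br.scaleR_left br.scaleR_right)

text \<open>
  If the powers of \<open>ad w\<close> grew at least like those of the radius of convergence,
  then convergence at the slightly larger point \<open>t w\<close> would push the radius further out.
\<close>

lemma taylor_power_bounded:
  assumes g: "open g\<^sub>0" "w \<in> g\<^sub>0"
    and sm: "\<And>w' y. w' \<in> g\<^sub>0 \<Longrightarrow> summable (\<lambda>n. cs (a $ n) ((br w' ^^ n) y))"
    and R: "0 < fps_conv_radius a"
  obtains C \<rho> \<delta> where "0 < \<delta>" "ereal \<rho> < fps_conv_radius a"
    "\<And>w'. w' \<in> ball w \<delta> \<Longrightarrow> power_bounded (br w') C \<rho>"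
proof -
  have bl: "bounded_linear (br w ^^ n)" for n
    using linear_real[OF funpow_linear[OF br_linear_right]] by (simp add: linear_conv_bounded_linear)
  \<comment> \<open>By Gelfand's formula this says that the spectral radius of \<open>ad w\<close>
    lies strictly below the radius of convergence.\<close>
  have "\<exists>N \<rho>. 0 < N \<and> 0 < \<rho> \<and> ereal \<rho> < fps_conv_radius a \<and> onorm (br w ^^ N) < \<rho> ^ N"
  proof (rule ccontr)
    assume "\<not> ?thesis"
    then have ge: "\<rho> ^ N \<le> onorm (br w ^^ N)" if "0 < N" "0 < \<rho>" "ereal \<rho> < fps_conv_radius a" for N \<rho>
      using that by (meson not_less)
    show False
    proof (cases "fps_conv_radius a")
      case PInf
      then show False
        using ge[of 1 "onorm (br w) + 1"] onorm_pos_le[OF bl[of 1]] by simp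
    next
      case MInf
      then show False
        using R by simp
    next
      case (real r)
      then have r: "0 < r"
        using R by simp
      obtain K where K: "0 \<le> K" "\<And>c x. norm (cs c x) \<le> K * norm c * norm x"
        using norm_cs_le by blast
      have lower: "norm c * norm v \<le> K * norm (cs c v)" for c v
      proof (cases "c = 0")
        case False
        then have "norm v \<le> K * inverse (norm c) * norm (cs c v)"
          using K(2)[of "inverse c" "cs c v"] by (simp add: norm_inverse)
        then show ?thesis
          using False by (simp add: field_simps)
      qed (use K in simp)
      obtain d where d: "0 < d" "ball w d \<subseteq> g\<^sub>0"
        using g by (meson openE)
      \<comment> \<open>Chosen so that t > 1 while t w stays in the ball of radius d; the summand 1
        in the denominator covers w = 0.\<close>
      define t where "t = 1 + d / (2 * (norm w + 1))"
      have nw: "0 < norm w + 1"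
        by (simp add: add_nonneg_pos)
      have t: "1 < t"
        unfolding t_def using d(1) nw by (simp add: field_simps)
      have "norm (w - t *\<^sub>R w) = d / (2 * (norm w + 1)) * norm w"
        using d(1) nw by (simp add: t_def scaleR_left_distrib)
      also have "\<dots> < d"
      proof -
        have "d * norm w < d * (2 * (norm w + 1))"
          using d(1) by (intro mult_strict_left_mono) (simp_all add: add_nonneg_pos)
        then show ?thesis
          using nw by (simp add: pos_divide_less_eq)
      qed
      finally have tw: "t *\<^sub>R w \<in> g\<^sub>0"
        using d(2) by (auto simp: dist_norm)
      have "\<exists>B. \<forall>n. norm (cs (a $ n) ((br (t *\<^sub>R w) ^^ n) b)) \<le> B" for b
        using summable_imp_Bseq[OF sm[OF tw, of b]] by (auto simp: Bseq_def)
      then obtain B where B: "\<And>n b. norm (cs (a $ n) ((br (t *\<^sub>R w) ^^ n) b)) \<le> B b"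
        by metis
      define B' where "B' = (\<Sum>b\<in>Basis. K * B b)"
      have bnd: "norm (a $ n) * t ^ n * onorm (br w ^^ n) \<le> B'" for n
      proof -
        have "norm (a $ n) * t ^ n * onorm (br w ^^ n) \<le> norm (a $ n) * t ^ n * (\<Sum>b\<in>Basis. norm ((br w ^^ n) b))"
          using t by (intro mult_left_mono onorm_componentwise[OF bl]) auto
        also have "\<dots> = (\<Sum>b\<in>Basis. norm (a $ n) * norm ((br (t *\<^sub>R w) ^^ n) b))"
          using t by (simp add: funpow_br_scaleR sum_distrib_left mult.assoc)
        also have "\<dots> \<le> B'"
          unfolding B'_def by (intro sum_mono order.trans[OF lower] mult_left_mono B K)
        finally show ?thesis .
      qed
      \<comment> \<open>The midpoint of r / t and r: still inside the disc of convergence, but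
        beyond it after multiplication by t.\<close>
      define \<rho> where "\<rho> = r * (1 + t) / (2 * t)"
      have \<rho>: "0 < \<rho>" "\<rho> < r" "r < \<rho> * t"
        using r t by (simp_all add: \<rho>_def field_simps add_pos_pos)
      have an: "norm (a $ n) * (\<rho> * t) ^ n \<le> B'" if "1 \<le> n" for n
      proof -
        have "norm (a $ n) * (\<rho> * t) ^ n = norm (a $ n) * t ^ n * \<rho> ^ n"
          by (simp add: power_mult_distrib)
        also have "\<dots> \<le> norm (a $ n) * t ^ n * onorm (br w ^^ n)"
          using ge[of n \<rho>] that \<rho> t real by (intro mult_left_mono) auto
        also have "\<dots> \<le> B'"
          by (rule bnd)
        finally show ?thesis .
      qed
      have "ereal (\<rho> * t) \<le> conv_radius (fps_nth a)"
      proof (rule conv_radius_geI_ex)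
        fix s assume s: "0 < s" "ereal s < ereal (\<rho> * t)"
        have "summable (\<lambda>n. B' * (s / (\<rho> * t)) ^ n)"
          using s \<rho> t by (intro summable_mult summable_geometric) (auto simp: abs_mult)
        moreover have "norm (a $ n * of_real s ^ n) \<le> B' * (s / (\<rho> * t)) ^ n" if "1 \<le> n" for n
        proof -
          have "norm (a $ n * of_real s ^ n) = norm (a $ n) * (\<rho> * t) ^ n * (s / (\<rho> * t)) ^ n"
            using s \<rho> t by (simp add: norm_mult norm_power power_divide)
          also have "\<dots> \<le> B' * (s / (\<rho> * t)) ^ n"
            using s \<rho> t by (intro mult_right_mono an that) auto
          finally show ?thesis .
        qed
        ultimately have "summable (\<lambda>n. a $ n * of_real s ^ n)"
          by (rule summable_comparison_test')
        then show "\<exists>z. norm z = s \<and> summable (\<lambda>n. a $ n * z ^ n)"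
          using s(1) by (intro exI[of _ "of_real s"]) auto
      qed
      then show False
        using real \<rho>(3) by (simp add: fps_conv_radius_def)
    qed
  qed
  then obtain N \<rho> where N: "0 < N" "0 < \<rho>" "ereal \<rho> < fps_conv_radius a" "onorm (br w ^^ N) < \<rho> ^ N"
    by blast
  from power_bounded_near[OF N(1,2) onorm[OF bl] N(4)]
  obtain C \<delta> where "0 < \<delta>" "\<And>w'. w' \<in> ball w \<delta> \<Longrightarrow> power_bounded (br w') C \<rho>"
    by blast
  then show ?thesis
    using that N(3) by blast
qed

end

section \<open>Engel's theorem and eigenvectors\<close>

text \<open>Engel's theorem relative to V: a nonzero class of W / V killed by K. This form lets the
  induction hypothesis act twice on a maximal proper subalgebra M. With K and M as the two spaces it
  gives z outside M normalizing M, hence K = M + R z. With W and V it gives vectors killed by M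
  modulo V, and nilpotency of \<open>br z\<close> finds among them one that z kills too.\<close>

lemma Engel_invariant_vector:
  fixes br :: "'a::euclidean_space \<Rightarrow> 'a \<Rightarrow> 'a"
  assumes bil: "bilinear br"
    and self: "\<And>x. br x x = 0" and antisym: "\<And>x y. br x y = - br y x"
    and der: "\<And>w x y. br w (br x y) = br (br w x) y + br x (br w y)"
    and nil: "\<And>x y. \<exists>n. (br x ^^ n) y = 0"
  shows "subspace K \<Longrightarrow> (\<forall>x\<in>K. \<forall>y\<in>K. br x y \<in> K) \<Longrightarrow> subspace V \<Longrightarrow> subspace W \<Longrightarrow> V \<subset> W \<Longrightarrow>
    (\<forall>x\<in>K. \<forall>v\<in>V. br x v \<in> V) \<Longrightarrow> (\<forall>x\<in>K. \<forall>v\<in>W. br x v \<in> W) \<Longrightarrow>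
    \<exists>z\<in>W - V. \<forall>x\<in>K. br x z \<in> V"
proof (induction "dim K" arbitrary: K V W rule: less_induct)
  case less
  have add: "br (x + x') y = br x y + br x' y" "br x (y + y') = br x y + br x y'"
    and scale: "br (c *\<^sub>R x) y = c *\<^sub>R br x y" "br x (c *\<^sub>R y) = c *\<^sub>R br x y" for x x' y y' c
    using bil by (simp_all add: bilinear_ladd bilinear_radd bilinear_lmul bilinear_rmul)
  show ?case
  proof (cases "K = {0}")
    case True
    obtain z where "z \<in> W - V"
      using less.prems by blast
    moreover have "br 0 z = 0"
      using bil by (simp add: bilinear_lzero)
    ultimately show ?thesis
      using True subspace_0[OF \<open>subspace V\<close>] by (intro bexI[of _ z]) auto
  next
    case False
    define P where "P = (\<lambda>M. subspace M \<and> (\<forall>x\<in>M. \<forall>y\<in>M. br x y \<in> M) \<and> M \<subset> K)"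
    have "P {0}"
      using False subspace_0[OF \<open>subspace K\<close>] self by (auto simp: P_def)
    \<comment> \<open>A proper subalgebra of maximal dimension; \<open>{0}\<close> shows that there
      is one.\<close>
    have "\<exists>M. P M \<and> (\<forall>M'. P M' \<longrightarrow> dim M' \<le> dim M)"
    proof (rule ex_has_greatest_nat[of P "{0}" dim "Suc DIM('a)"])
      show "\<forall>M. P M \<longrightarrow> dim M < Suc DIM('a)"
        using dim_subset_UNIV by (auto simp: less_Suc_eq_le)
    qed fact
    then obtain M where M: "P M" "\<And>M'. P M' \<Longrightarrow> dim M' \<le> dim M"
      by blast
    have less_dim: "dim A < dim B" if "subspace A" "subspace B" "A \<subset> B" for A B :: "'a set"
    proof -
      have "span A = A" "span B = B"
        using that by (simp_all only: span_eq_iff)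
      then show ?thesis
        using dim_psubset[of A B] that(3) by (simp only:)
    qed
    have dM: "dim M < dim K"
      using M(1) less.prems(1) by (intro less_dim) (auto simp: P_def)
    have MK: "subspace M" "\<And>x y. x \<in> M \<Longrightarrow> y \<in> M \<Longrightarrow> br x y \<in> M" "M \<subset> K"
      using M(1) by (auto simp: P_def)
    have "\<exists>z\<in>K - M. \<forall>x\<in>M. br x z \<in> M"
      by (rule less.hyps[OF dM]) (use MK less.prems in auto)
    then obtain z where z: "z \<in> K" "z \<notin> M" "\<And>x. x \<in> M \<Longrightarrow> br x z \<in> M"
      by blast
    define M' where "M' = {m + c *\<^sub>R z |m c. m \<in> M}"
    have M'I: "m + c *\<^sub>R z \<in> M'" if "m \<in> M" for m c
      using that by (auto simp: M'_def)
    have "subspace M'"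
    proof (rule subspaceI)
      show "0 \<in> M'"
        using M'I[OF subspace_0[OF MK(1)], of 0] by simp
    next
      fix x y assume "x \<in> M'" "y \<in> M'"
      then obtain m c n d where "x = m + c *\<^sub>R z" "y = n + d *\<^sub>R z" "m \<in> M" "n \<in> M"
        by (auto simp: M'_def)
      then show "x + y \<in> M'"
        using M'I[OF subspace_add[OF MK(1), of m n], of "c + d"] by (simp add: algebra_simps)
    next
      fix r x assume "x \<in> M'"
      then obtain m c where "x = m + c *\<^sub>R z" "m \<in> M"
        by (auto simp: M'_def)
      then show "r *\<^sub>R x \<in> M'"
        using M'I[OF subspace_scale[OF MK(1), of m r], of "r * c"] by (simp add: algebra_simps)
    qed
    moreover have "br x y \<in> M'" if xy: "x \<in> M'" "y \<in> M'" for x y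
    proof -
      obtain m c n d where "x = m + c *\<^sub>R z" "y = n + d *\<^sub>R z" and mn: "m \<in> M" "n \<in> M"
        using xy by (auto simp: M'_def)
      then have "br x y = br m n + d *\<^sub>R br m z + c *\<^sub>R (- br n z)"
        by (simp add: add scale self antisym[of z n])
      also have "\<dots> \<in> M"
        using mn z MK by (intro subspace_add[OF MK(1)] subspace_scale[OF MK(1)] subspace_neg[OF MK(1)]) auto
      finally show ?thesis
        using M'I[of "br x y" 0] by simp
    qed
    moreover have "M' \<subseteq> K"
      using z MK(3) less.prems(1) by (auto simp: M'_def intro!: subspace_add subspace_scale)
    moreover have sub: "M \<subset> M'"
      using M'I[of _ 0] M'I[OF subspace_0[OF MK(1)], of 1] z(2) by auto
    ultimately have "M' = K"
      using M(2)[of M'] less_dim[OF MK(1) _ sub] unfolding P_def by force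
    \<comment> \<open>The vectors of W killed by M modulo V. They are stable under
      \<open>br z\<close> because z normalizes M.\<close>
    define N where "N = {w \<in> W. \<forall>x\<in>M. br x w \<in> V}"
    have "\<exists>w\<in>W - V. \<forall>x\<in>M. br x w \<in> V"
      by (rule less.hyps[OF dM]) (use MK less.prems in auto)
    then obtain w where w: "w \<in> N" "w \<notin> V"
      by (auto simp: N_def)
    have stable: "br z v \<in> N" if v: "v \<in> N" for v
    proof -
      have "br m (br z v) \<in> V" if m: "m \<in> M" for m
        unfolding der[of m z v] using v z m less.prems by (intro subspace_add[OF \<open>subspace V\<close>]) (auto simp: N_def)
      then show ?thesis
        using v z(1) less.prems by (auto simp: N_def)
    qed
    have N: "(br z ^^ n) w \<in> N" for n
      by (induction n) (auto simp: w stable)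
    obtain n where "(br z ^^ n) w = 0"
      using nil by blast
    then have ex: "\<exists>n. (br z ^^ n) w \<in> V"
      using subspace_0[OF \<open>subspace V\<close>] by metis
    \<comment> \<open>The iterate just before the first one in V lies outside V and is sent into V
      by z.\<close>
    define n where "n = (LEAST n. (br z ^^ n) w \<in> V)"
    have n: "(br z ^^ n) w \<in> V"
      using LeastI_ex[OF ex] by (simp add: n_def)
    then obtain k where k: "n = Suc k"
      using w(2) by (cases n) auto
    define v where "v = (br z ^^ k) w"
    have "v \<notin> V"
      using not_less_Least[of k "\<lambda>n. (br z ^^ n) w \<in> V"] k by (simp add: n_def v_def)
    moreover have v: "v \<in> N" "br z v \<in> V"
      using N[of k] n k by (simp_all add: v_def)
    moreover have "br x v \<in> V" if "x \<in> K" for x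
    proof -
      obtain m c where "x = m + c *\<^sub>R z" "m \<in> M"
        using \<open>x \<in> K\<close> \<open>M' = K\<close> by (auto simp: M'_def)
      then show ?thesis
        using v less.prems(3) by (auto simp: add scale N_def intro!: subspace_add subspace_scale)
    qed
    ultimately show ?thesis
      by (intro bexI[of _ v]) (auto simp: N_def)
  qed
qed

section \<open>Annihilating polynomials and eigenvectors of a single operator\<close>

context complex_fd_space
begin

definition poly_op :: "complex poly \<Rightarrow> ('a \<Rightarrow> 'a) \<Rightarrow> 'a \<Rightarrow> 'a" where
  "poly_op p L v = (\<Sum>i\<le>degree p. cs (coeff p i) ((L ^^ i) v))"

lemma poly_op_eq: "degree p \<le> n \<Longrightarrow> poly_op p L v = (\<Sum>i\<le>n. cs (coeff p i) ((L ^^ i) v))"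
  unfolding poly_op_def by (intro sum.mono_neutral_left) (auto simp: coeff_eq_0)

lemma poly_op_add: "poly_op (p + q) L v = poly_op p L v + poly_op q L v"
  by (simp add: poly_op_eq[of _ "max (degree p) (degree q)"] degree_add_le scale_left_distrib sum.distrib)

lemma poly_op_smult: "poly_op (smult c p) L v = cs c (poly_op p L v)"
  by (simp add: poly_op_eq[of _ "degree p"] degree_smult_le scale_sum_right)

lemma poly_op_0 [simp]: "poly_op 0 L v = 0"
  by (simp add: poly_op_def)

lemma poly_op_sum: "poly_op (\<Sum>i\<in>I. p i) L v = (\<Sum>i\<in>I. poly_op (p i) L v)"
  by (induction I rule: infinite_finite_induct) (auto simp: poly_op_add)

lemma poly_op_monom: "poly_op (monom c i) L v = cs c ((L ^^ i) v)"
proof -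
  have "poly_op (monom c i) L v = (\<Sum>j\<le>i. cs (coeff (monom c i) j) ((L ^^ j) v))"
    by (rule poly_op_eq) (simp add: degree_monom_le)
  also have "\<dots> = (\<Sum>j\<in>{i}. cs (coeff (monom c i) j) ((L ^^ j) v))"
    by (rule sum.mono_neutral_right) auto
  finally show ?thesis
    by simp
qed

lemma poly_op_pCons:
  assumes "Vector_Spaces.linear cs cs L"
  shows "poly_op (pCons c p) L v = cs c v + L (poly_op p L v)"
proof -
  interpret L: Vector_Spaces.linear cs cs L by fact
  have "poly_op (pCons c p) L v = (\<Sum>i\<le>Suc (degree p). cs (coeff (pCons c p) i) ((L ^^ i) v))"
    by (rule poly_op_eq) (simp add: degree_pCons_le)
  also have "\<dots> = cs c v + (\<Sum>i\<le>degree p. cs (coeff p i) (L ((L ^^ i) v)))"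
    by (subst sum.atMost_Suc_shift) simp
  finally show ?thesis
    by (simp add: poly_op_def L.sum L.scale)
qed

lemma poly_op_linear_factor:
  assumes "Vector_Spaces.linear cs cs L"
  shows "poly_op ([:-a, 1:] * q) L v = L (poly_op q L v) - cs a (poly_op q L v)"
proof -
  have "[:-a, 1:] * q = smult (-a) q + pCons 0 q"
    by simp
  then show ?thesis
    by (simp only: poly_op_add poly_op_smult poly_op_pCons[OF assms]) simp
qed

lemma poly_op_commute:
  assumes "Vector_Spaces.linear cs cs L"
  shows "poly_op q L (L v) = L (poly_op q L v)"
proof -
  interpret L: Vector_Spaces.linear cs cs L by fact
  show ?thesis
    by (simp add: poly_op_def L.sum L.scale funpow_swap1)
qed

text \<open>Linear factors are split off one by one. For the root 0 the vector is replaced by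
  \<open>L v\<close>, whose iterates are again nonzero. For a root a different from 0, either the
  remaining factor sends v to an eigenvector, or it annihilates v already.\<close>

lemma annihilated_eigenvector:
  assumes L: "Vector_Spaces.linear cs cs L"
  shows "p \<noteq> 0 \<Longrightarrow> poly_op p L v = 0 \<Longrightarrow> (\<And>n. (L ^^ n) v \<noteq> 0) \<Longrightarrow> \<exists>l u. l \<noteq> 0 \<and> u \<noteq> 0 \<and> L u = cs l u"
proof (induction "degree p" arbitrary: p v)
  case 0
  then obtain c where "p = [:c:]" "c \<noteq> 0"
    by (metis degree_eq_zeroE pCons_0_0)
  then show ?case
    using 0(3) 0(4)[of 0] by (simp add: poly_op_def)
next
  case (Suc d)
  have "\<not> constant (poly p)"
    using Suc(2) by (simp add: constant_degree)
  then obtain a where "poly p a = 0"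
    using fundamental_theorem_of_algebra by blast
  then obtain q where q: "p = [:-a, 1:] * q"
    by (auto simp: poly_eq_0_iff_dvd)
  then have q0: "q \<noteq> 0"
    using Suc by auto
  then have d: "d = degree q"
    using Suc(2) by (simp add: q degree_mult_eq del: mult_pCons_left)
  have Lu: "L (poly_op q L v) = cs a (poly_op q L v)"
    using Suc(4) unfolding q poly_op_linear_factor[OF L] by simp
  show ?case
  proof (cases "a = 0")
    case True
    have "poly_op q L (L v) = 0"
      using Lu True by (simp add: poly_op_commute[OF L])
    moreover have "(L ^^ n) (L v) \<noteq> 0" for n
      using Suc(5)[of "Suc n"] by (simp add: funpow_swap1)
    ultimately show ?thesis
      using Suc(1)[OF d q0] by blast
  next
    case False
    then show ?thesis
      using Lu Suc(1)[OF d q0 _ Suc(5)] by (cases "poly_op q L v = 0") auto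
  qed
qed

lemma non_nilpotent_eigenvector:
  assumes L: "Vector_Spaces.linear cs cs L" and v: "\<And>n. (L ^^ n) v \<noteq> 0"
  shows "\<exists>l u. l \<noteq> 0 \<and> u \<noteq> 0 \<and> L u = cs l u"
proof -
  define f where "f = (\<lambda>i. (L ^^ i) v)"
  let ?I = "{..DIM('a)}"
  have "\<exists>p. p \<noteq> 0 \<and> poly_op p L v = 0"
  proof (cases "inj_on f ?I")
    case True
    then have "card (f ` ?I) > DIM('a)"
      by (simp add: card_image)
    \<comment> \<open>\<open>DIM('a)\<close> is the real dimension, so the dependence has real
      coefficients, which are then read as complex ones.\<close>
    then have "real_vector.dependent (f ` ?I)"
      by (intro dependent_biggerset) auto
    then obtain u y where u: "(\<Sum>x\<in>f ` ?I. u x *\<^sub>R x) = 0" "y \<in> f ` ?I" "u y \<noteq> 0"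
      by (auto simp: real_vector.dependent_finite)
    then obtain j where j: "j \<in> ?I" "u (f j) \<noteq> 0"
      by auto
    define p where "p = (\<Sum>i\<in>?I. monom (complex_of_real (u (f i))) i)"
    have "poly_op p L v = (\<Sum>i\<in>?I. u (f i) *\<^sub>R f i)"
      by (simp add: p_def poly_op_sum poly_op_monom cs_of_real f_def)
    also have "\<dots> = 0"
      using u(1) by (simp add: sum.reindex[OF True])
    finally have "poly_op p L v = 0" .
    moreover have "coeff p j = of_real (u (f j))"
      using j(1) by (simp add: p_def coeff_sum coeff_monom)
    then have "p \<noteq> 0"
      using j(2) by auto
    ultimately show ?thesis
      by blast
  next
    case False
    then obtain i j where ij: "i \<noteq> j" "f i = f j"
      by (auto simp: inj_on_def)
    have "poly_op (monom 1 i + monom (-1) j) L v = 0"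
      using ij(2) by (simp add: poly_op_add poly_op_monom f_def)
    moreover have "coeff (monom 1 i + monom (-1) j) i = (1 :: complex)"
      using ij(1) by (simp add: coeff_monom)
    then have "monom 1 i + monom (-1) j \<noteq> (0 :: complex poly)"
      by force
    ultimately show ?thesis
      by blast
  qed
  then obtain p where "p \<noteq> 0" "poly_op p L v = 0"
    by blast
  then show ?thesis
    using v by (rule annihilated_eigenvector[OF L])
qed

end

context simple_complex_lie_algebra
begin

text \<open>The centre is an ideal and, the algebra being non-abelian, a proper one. Hence an
  element is determined by its adjoint action, which later identifies the velocity of the
  logarithm.\<close>

lemma center_trivial:
  assumes "\<And>x. br x z = 0"
  shows "z = 0"
proof -
  let ?Z = "{z. \<forall>x. br x z = 0}"
  have "subspace ?Z"
    by (intro subspaceI) (auto simp: br_add_right br_scale_right br.zero_right)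
  then have "lie_ideal cs br ?Z"
    by (auto simp: lie_ideal_def br.zero_right)
  then have "?Z = {0} \<or> ?Z = UNIV"
    by (rule simple)
  moreover have "?Z \<noteq> UNIV"
    using non_abelian by blast
  ultimately show ?thesis
    using assms by blast
qed

text \<open>If every \<open>br w\<close> were nilpotent, the relative Engel theorem with V = {0} and
  K, W the whole algebra would produce a nonzero central element.\<close>

lemma nonzero_ad_eigenvector:
  obtains w u l where "l \<noteq> 0" "u \<noteq> 0" "br w u = cs l u"
proof -
  have "\<exists>w y. \<forall>n. (br w ^^ n) y \<noteq> 0"
  proof (rule ccontr)
    assume "\<not> ?thesis"
    then have nil: "\<And>x y. \<exists>n. (br x ^^ n) y = 0"
      by blast
    obtain x y where "br x y \<noteq> 0"
      using non_abelian by blast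
    then have "{0} \<subset> (UNIV :: 'a set)"
      by blast
    then have "\<exists>z\<in>UNIV - {0}. \<forall>x\<in>UNIV. br x z \<in> {0}"
      by (intro Engel_invariant_vector[OF _ br_self br_antisym br_derivation nil])
         (auto simp: bilinear_conv_bounded_bilinear bounded_bilinear_br br.zero_right)
    then show False
      using center_trivial by blast
  qed
  then show ?thesis
    using non_nilpotent_eigenvector[OF br_linear_right] that by metis
qed

end

section \<open>The adjoint representation and the exponential map\<close>

text \<open>Gronwall's argument: the weight exp (-2 M s) makes the squared norm
  nonincreasing.\<close>

lemma linear_ode_zero:
  fixes y :: "real \<Rightarrow> 'a::real_inner"
  assumes y: "\<And>s. (y has_vector_derivative L (y s)) (at s)"
    and L: "\<And>v. norm (L v) \<le> M * norm v"
    and y0: "y 0 = 0" and s: "0 \<le> s"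
  shows "y s = 0"
proof -
  define \<phi> where "\<phi> = (\<lambda>s. exp (- 2 * M * s) * (y s \<bullet> y s))"
  have "((\<lambda>s. y s \<bullet> y s) has_real_derivative 2 * (y t \<bullet> L (y t))) (at t)" for t
    using bounded_bilinear.has_vector_derivative[OF bounded_bilinear_inner y y, of t]
    by (simp add: has_real_derivative_iff_has_vector_derivative inner_commute)
  then have \<phi>: "(\<phi> has_real_derivative exp (- 2 * M * t) * (2 * (y t \<bullet> L (y t)) - 2 * M * (y t \<bullet> y t))) (at t)" for t
    unfolding \<phi>_def by (auto intro!: derivative_eq_intros simp: algebra_simps)
  have "y t \<bullet> L (y t) \<le> M * (y t \<bullet> y t)" for t
  proof -
    have "y t \<bullet> L (y t) \<le> norm (y t) * norm (L (y t))"
      by (rule norm_cauchy_schwarz)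
    also have "\<dots> \<le> norm (y t) * (M * norm (y t))"
      by (intro mult_left_mono L) simp
    finally show ?thesis
      by (simp add: dot_square_norm power2_eq_square algebra_simps)
  qed
  then have neg: "exp (- 2 * M * t) * (2 * (y t \<bullet> L (y t)) - 2 * M * (y t \<bullet> y t)) \<le> 0" for t
    by (intro mult_nonneg_nonpos) (auto simp: mult.assoc)
  have "\<phi> s \<le> \<phi> 0"
    by (rule DERIV_nonpos_imp_nonincreasing[OF s]) (intro exI conjI, rule \<phi>, rule neg)
  then have "exp (- 2 * M * s) * (y s \<bullet> y s) \<le> 0"
    by (simp add: \<phi>_def y0)
  then have "y s \<bullet> y s \<le> 0"
    by (simp add: mult_le_0_iff)
  then show ?thesis
    by (metis inner_eq_zero_iff inner_ge_zero order.antisym)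
qed

context complex_lie_algebra
begin

abbreviation exp_ad :: "'a \<Rightarrow> 'a \<Rightarrow> 'a" where
  "exp_ad w \<equiv> power_series_op (fps_exp 1) (br w)"

lemma power_bounded_any:
  obtains C \<rho> where "\<And>w'. w' \<in> ball w 1 \<Longrightarrow> power_bounded (br w') C \<rho>"
proof -
  obtain M where M: "0 < M" "\<And>w n v. norm ((br w ^^ n) v) \<le> (M * norm w) ^ n * norm v"
    using power_bounded_global by blast
  have "power_bounded (br w') 1 (M * (norm w + 1))" if "w' \<in> ball w 1" for w'
  proof -
    have "norm w' \<le> norm w + 1"
      using that norm_triangle_sub[of w' w] by (auto simp: dist_norm norm_minus_commute)
    then have "(M * norm w') ^ n * norm v \<le> (M * (norm w + 1)) ^ n * norm v" for n and v :: 'a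
      using M(1) by (intro mult_right_mono power_mono mult_left_mono) auto
    then show ?thesis
      unfolding power_bounded_def using order.trans[OF M(2)] M(1) by simp
  qed
  then show ?thesis
    using that by blast
qed

lemma exp_ad_has_derivative:
  "((\<lambda>w. exp_ad w y) has_derivative (\<lambda>\<eta>. br (power_series_op expm1_over_X (br w) \<eta>) (exp_ad w y))) (at w)"
proof -
  obtain C \<rho> where pb: "\<And>w'. w' \<in> ball w 1 \<Longrightarrow> power_bounded (br w') C \<rho>"
    using power_bounded_any by blast
  obtain D where D: "((\<lambda>w. exp_ad w y) has_derivative D) (at w)"
    "\<And>\<eta>. (\<lambda>m. cs (fps_exp 1 $ Suc m) (\<Sum>i\<le>m. (br w ^^ i) (br \<eta> ((br w ^^ (m - i)) y)))) sums D \<eta>"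
    using power_series_op_has_derivative[of \<rho> "fps_exp 1" 1 w C y] pb by auto
  have "D \<eta> = br (power_series_op expm1_over_X (br w) \<eta>) (exp_ad w y)" for \<eta>
    by (rule sums_unique2[OF D(2) exp_op_derivative[OF pb]]) simp
  then show ?thesis
    using D(1) by presburger
qed

lemma expm1_op_fixed:
  assumes "br w v = 0"
  shows "power_series_op expm1_over_X (br w) v = v"
proof -
  have z: "(br w ^^ k) 0 = 0" for k
    by (induction k) (simp_all add: br.zero_right)
  have "(br w ^^ n) v = 0" if n: "n \<noteq> 0" for n
  proof -
    obtain k where "n = Suc k"
      using not0_implies_Suc[OF n] by blast
    then show ?thesis
      using assms z[of k] by (simp add: funpow_swap1)
  qed
  then have "(\<lambda>n. cs (expm1_over_X $ n) ((br w ^^ n) v)) sums (\<Sum>n\<in>{0}. cs (expm1_over_X $ n) ((br w ^^ n) v))"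
    by (intro sums_finite) auto
  then show ?thesis
    unfolding power_series_op_def by (simp add: sums_unique[symmetric] expm1_over_X_nth)
qed

lemma exp_ad_ray_derivative:
  "((\<lambda>s. exp_ad (s *\<^sub>R w) y) has_vector_derivative br w (exp_ad (s *\<^sub>R w) y)) (at s)"
proof -
  have "((\<lambda>s. exp_ad (s *\<^sub>R w) y) has_derivative
      (\<lambda>h. br (power_series_op expm1_over_X (br (s *\<^sub>R w)) (h *\<^sub>R w)) (exp_ad (s *\<^sub>R w) y))) (at s)"
    by (rule has_derivative_compose[OF _ exp_ad_has_derivative, where f = "\<lambda>s. s *\<^sub>R w"])
       (auto intro!: derivative_eq_intros)
  moreover have "power_series_op expm1_over_X (br (s *\<^sub>R w)) (h *\<^sub>R w) = h *\<^sub>R w" for h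
    by (rule expm1_op_fixed) (simp add: br.scaleR_left br.scaleR_right br_self)
  ultimately show ?thesis
    by (simp add: has_vector_derivative_def br.scaleR_left)
qed

lemma exp_ad_0: "exp_ad 0 y = y"
proof -
  have "(br 0 ^^ n) y = 0" if "n \<noteq> 0" for n
    using that by (cases n) (simp_all add: br.zero_left)
  then have "(\<lambda>n. cs (fps_exp 1 $ n) ((br 0 ^^ n) y)) sums (\<Sum>n\<in>{0}. cs (fps_exp 1 $ n) ((br 0 ^^ n) y))"
    by (intro sums_finite) auto
  then show ?thesis
    unfolding power_series_op_def by (simp add: sums_unique[symmetric])
qed

lemma linear_exp_ad: "linear (exp_ad w)"
proof -
  obtain C \<rho> where "power_bounded (br w) C \<rho>"
    using power_bounded_any[of w] by (metis centre_in_ball zero_less_one)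
  note pb = this
  show ?thesis
  proof (rule linearI)
    fix x y and c :: real
    show "exp_ad w (x + y) = exp_ad w x + exp_ad w y"
      by (rule power_series_op_vec_add[OF br_linear_right pb]) simp
    have "bounded_linear ((*\<^sub>R) c :: 'a \<Rightarrow> 'a)"
      by (rule bounded_linear_scaleR_right)
    from bounded_linear.sums[OF this power_series_op_sums[OF pb, of "fps_exp 1" x]]
    have "(\<lambda>n. c *\<^sub>R cs (fps_exp 1 $ n) ((br w ^^ n) x)) sums (c *\<^sub>R exp_ad w x)"
      by simp
    moreover have "c *\<^sub>R cs (fps_exp 1 $ n) ((br w ^^ n) x) = cs (fps_exp 1 $ n) ((br w ^^ n) (c *\<^sub>R x))" for n
      using linear_cmul[OF linear_real[OF funpow_linear[OF br_linear_right]]]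
        bounded_bilinear.scaleR_right[OF bounded_bilinear_cs] by simp
    ultimately show "exp_ad w (c *\<^sub>R x) = c *\<^sub>R exp_ad w x"
      unfolding power_series_op_def[of _ _ "c *\<^sub>R x"] by (simp only: sums_unique[symmetric])
  qed
qed

lemma exp_ad_surj: "\<exists>x. exp_ad w x = y"
proof -
  obtain C \<rho> where "power_bounded (br w) C \<rho>"
    using power_bounded_any[of w] by (metis centre_in_ball zero_less_one)
  from power_series_op_mult[OF br_linear_right this, of "fps_exp 1" "fps_exp (-1)" y]
  have "exp_ad w (power_series_op (fps_exp (-1)) (br w) y) = y"
    by (simp flip: fps_exp_add_mult)
  then show ?thesis
    by blast
qed

end

section \<open>Differentiability of maps into the group, and the adjoint representation\<close>

lemma holomorphic_mapD:
  assumes "holomorphic_map s1 T1 A1 s2 T2 A2 f" "(V, \<phi>) \<in> A1" "(W, \<psi>) \<in> A2"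
  shows "holomorphic_on_space s1 s2 (\<phi> ` {x \<in> V. f x \<in> W}) (\<psi> \<circ> f \<circ> inv_into V \<phi>)"
  using bspec[OF bspec[OF conjunct2[OF assms(1)[unfolded holomorphic_map_def]] assms(2), simplified] assms(3)]
  by simp

lemma holomorphic_on_spaceD:
  "holomorphic_on_space s1 s2 S f \<Longrightarrow> x \<in> S \<Longrightarrow> \<exists>D. (f has_derivative D) (at x)"
  unfolding holomorphic_on_space_def by blast

locale lie_group_with_exp =
  fixes cs :: "complex \<Rightarrow> 'a::euclidean_space \<Rightarrow> 'a" and br :: "'a \<Rightarrow> 'a \<Rightarrow> 'a"
    and G :: "'g monoid" (structure) and T :: "'g topology" and A :: "('g, 'a) chart set"
    and U :: "'g set" and \<kappa> :: "'g \<Rightarrow> 'a" and e :: "'a \<Rightarrow> 'g"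
  assumes lie_group: "complex_lie_group_with_lie_algebra cs br G T A U \<kappa>"
    and exp_map: "exponential_map G T \<kappa> e"
begin

sublocale complex_lie_algebra cs br
  using lie_group by (simp add: complex_lie_group_with_lie_algebra_def)

sublocale group G
  using lie_group by (simp add: complex_lie_group_with_lie_algebra_def complex_lie_group_def)

lemma group_facts:
  shows topspace_T: "topspace T = carrier G"
    and manifold: "complex_manifold cs T A"
    and mult_holomorphic: "holomorphic_map (prod_scale cs cs) (prod_topology T T) (prod_atlas A A) cs T A
       (\<lambda>(g, h). g \<otimes> h)"
    and U: "(U, \<kappa>) \<in> A" "\<one> \<in> U" "\<kappa> \<one> = 0"
    and Ad_derivative: "((\<lambda>x. Ad G U \<kappa> (inv_into U \<kappa> x) Y) has_derivative (\<lambda>X. br X Y)) (at 0)"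
  using lie_group by (simp_all add: complex_lie_group_with_lie_algebra_def complex_lie_group_def)

lemma chart:
  assumes "(V, \<phi>) \<in> A"
  shows chart_openin: "openin T V" and chart_open: "open (\<phi> ` V)"
    and chart_homeo: "homeomorphic_map (subtopology T V) (top_of_set (\<phi> ` V)) \<phi>"
    and chart_subset: "V \<subseteq> carrier G" and chart_inj: "inj_on \<phi> V"
proof -
  show V: "openin T V" and o: "open (\<phi> ` V)"
    and h: "homeomorphic_map (subtopology T V) (top_of_set (\<phi> ` V)) \<phi>"
    using manifold assms unfolding complex_manifold_def by blast+
  show "V \<subseteq> carrier G"
    using openin_subset[OF V] by (simp add: topspace_T)
  then have "topspace (subtopology T V) = V"
    by (auto simp: topspace_T)
  then show "inj_on \<phi> V"
    using homeomorphic_imp_injective_map[OF h] by simp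
qed

lemma chart_image_open:
  assumes "(V, \<phi>) \<in> A" "openin T W"
  shows "open (\<phi> ` (V \<inter> W))"
proof -
  have "openin (subtopology T V) (V \<inter> W)"
    using assms(2) by (auto simp: openin_subtopology)
  then have "openin (top_of_set (\<phi> ` V)) (\<phi> ` (V \<inter> W))"
    using homeomorphic_imp_open_map[OF chart_homeo[OF assms(1)]] by (simp add: open_map_def)
  then show ?thesis
    using chart_open[OF assms(1)] openin_open_trans by blast
qed

lemma chart_at:
  assumes "g \<in> carrier G"
  obtains V \<phi> where "(V, \<phi>) \<in> A" "g \<in> V"
proof -
  have "g \<in> (\<Union>(V, \<phi>)\<in>A. V)"
    using manifold assms by (simp add: complex_manifold_def topspace_T)
  then show ?thesis
    using that by blast
qed

text \<open>Only real differentiability is recorded, so that curves in a real parameter and maps on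
  the Lie algebra are handled together. Staying in the chart domain is a separate condition, because
  coordinates are arbitrary outside it.\<close>

definition gdiff :: "('b::real_normed_vector \<Rightarrow> 'g) \<Rightarrow> 'b \<Rightarrow> bool" where
  "gdiff f p \<longleftrightarrow> (\<exists>V \<phi> D. (V, \<phi>) \<in> A \<and> (\<forall>\<^sub>F x in nhds p. f x \<in> V) \<and>
     ((\<lambda>x. \<phi> (f x)) has_derivative D) (at p))"

lemma gdiffI:
  "(V, \<phi>) \<in> A \<Longrightarrow> \<forall>\<^sub>F x in nhds p. f x \<in> V \<Longrightarrow> ((\<lambda>x. \<phi> (f x)) has_derivative D) (at p) \<Longrightarrow> gdiff f p"
  unfolding gdiff_def by blast

lemma gdiffE:
  assumes "gdiff f p"
  obtains V \<phi> D where "(V, \<phi>) \<in> A" "\<forall>\<^sub>F x in nhds p. f x \<in> V" "f p \<in> V"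
    "((\<lambda>x. \<phi> (f x)) has_derivative D) (at p)"
  using assms unfolding gdiff_def by (blast dest: eventually_nhds_x_imp_x)

lemma gdiff_carrier: "gdiff f p \<Longrightarrow> f p \<in> carrier G"
  by (elim gdiffE) (use chart_subset in blast)

lemma gdiff_eventually:
  assumes "gdiff f p" "openin T W" "f p \<in> W"
  shows "\<forall>\<^sub>F x in nhds p. f x \<in> W"
proof -
  obtain V \<phi> D where V: "(V, \<phi>) \<in> A" "\<forall>\<^sub>F x in nhds p. f x \<in> V" "f p \<in> V"
    and D: "((\<lambda>x. \<phi> (f x)) has_derivative D) (at p)"
    using assms(1) by (rule gdiffE)
  have "((\<lambda>x. \<phi> (f x)) \<longlongrightarrow> \<phi> (f p)) (nhds p)"
    using has_derivative_continuous[OF D] tendsto_at_iff_tendsto_nhds[of "\<lambda>x. \<phi> (f x)" p]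
    by (simp add: continuous_at)
  then have "\<forall>\<^sub>F x in nhds p. \<phi> (f x) \<in> \<phi> ` (V \<inter> W)"
    using topological_tendstoD[OF _ chart_image_open[OF V(1) assms(2)]] V(3) assms(3) by blast
  then show ?thesis
    using V(2)
  proof eventually_elim
    case (elim x)
    then obtain y where "y \<in> V \<inter> W" "\<phi> (f x) = \<phi> y"
      by blast
    then show ?case
      using elim(2) chart_inj[OF V(1)] by (metis IntD1 IntD2 inj_onD)
  qed
qed

lemma has_derivative_eventually:
  assumes "(f has_derivative D) (at p)" "\<forall>\<^sub>F x in nhds p. f x = g x"
  shows "(g has_derivative D) (at p)"
  using assms(1)
  by (rule has_derivative_transform_eventually)
     (use assms(2) eventually_nhds_x_imp_x[OF assms(2)] in \<open>simp_all add: eventually_nhds_conv_at\<close>)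

lemma gdiff_mult:
  assumes f: "gdiff f p" and h: "gdiff h p"
  shows gdiff_mult_chart: "(V, \<psi>) \<in> A \<Longrightarrow> f p \<otimes> h p \<in> V \<Longrightarrow> \<exists>D. ((\<lambda>x. \<psi> (f x \<otimes> h x)) has_derivative D) (at p)"
    and gdiff_mult': "gdiff (\<lambda>x. f x \<otimes> h x) p"
proof -
  obtain V1 \<phi>1 D1 where V1: "(V1, \<phi>1) \<in> A" "\<forall>\<^sub>F x in nhds p. f x \<in> V1" "f p \<in> V1"
    and D1: "((\<lambda>x. \<phi>1 (f x)) has_derivative D1) (at p)"
    using f by (rule gdiffE)
  obtain V2 \<phi>2 D2 where V2: "(V2, \<phi>2) \<in> A" "\<forall>\<^sub>F x in nhds p. h x \<in> V2" "h p \<in> V2"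
    and D2: "((\<lambda>x. \<phi>2 (h x)) has_derivative D2) (at p)"
    using h by (rule gdiffE)
  have inj: "inj_on (map_prod \<phi>1 \<phi>2) (V1 \<times> V2)"
    using chart_inj[OF V1(1)] chart_inj[OF V2(1)] by (rule map_prod_inj_on)
  show chart: "\<exists>D. ((\<lambda>x. \<psi> (f x \<otimes> h x)) has_derivative D) (at p)"
    if V: "(V, \<psi>) \<in> A" "f p \<otimes> h p \<in> V" for V \<psi>
  proof -
    define m where "m = \<psi> \<circ> (\<lambda>(g, h). g \<otimes> h) \<circ> inv_into (V1 \<times> V2) (map_prod \<phi>1 \<phi>2)"
    have "(V1 \<times> V2, map_prod \<phi>1 \<phi>2) \<in> prod_atlas A A"
      using V1(1) V2(1) by (auto simp: prod_atlas_def)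
    then have hol: "holomorphic_on_space (prod_scale cs cs) cs
        (map_prod \<phi>1 \<phi>2 ` {x \<in> V1 \<times> V2. (\<lambda>(g, h). g \<otimes> h) x \<in> V}) m"
      unfolding m_def by (rule holomorphic_mapD[OF mult_holomorphic _ V(1)])
    have "(\<phi>1 (f p), \<phi>2 (h p)) \<in> map_prod \<phi>1 \<phi>2 ` {x \<in> V1 \<times> V2. (\<lambda>(g, h). g \<otimes> h) x \<in> V}"
      using V1(3) V2(3) V(2) by (intro image_eqI[of _ _ "(f p, h p)"]) auto
    from holomorphic_on_spaceD[OF hol this]
    obtain Dm where Dm: "(m has_derivative Dm) (at (\<phi>1 (f p), \<phi>2 (h p)))" ..
    have d: "((\<lambda>x. m (\<phi>1 (f x), \<phi>2 (h x))) has_derivative (\<lambda>y. Dm (D1 y, D2 y))) (at p)"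
      by (rule has_derivative_compose[OF has_derivative_Pair[OF D1 D2] Dm])
    have ev: "\<forall>\<^sub>F x in nhds p. m (\<phi>1 (f x), \<phi>2 (h x)) = \<psi> (f x \<otimes> h x)"
      using V1(2) V2(2)
    proof eventually_elim
      case (elim x)
      then have "inv_into (V1 \<times> V2) (map_prod \<phi>1 \<phi>2) (map_prod \<phi>1 \<phi>2 (f x, h x)) = (f x, h x)"
        by (intro inv_into_f_f[OF inj]) auto
      then show ?case
        by (simp add: m_def)
    qed
    show ?thesis
      by (rule exI) (rule has_derivative_eventually[OF d ev])
  qed
  show "gdiff (\<lambda>x. f x \<otimes> h x) p"
  proof -
    have c: "f p \<in> carrier G" "h p \<in> carrier G"
      using gdiff_carrier f h by blast+
    then have "f p \<otimes> h p \<in> carrier G"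
      by (rule m_closed)
    then obtain V \<psi> where V: "(V, \<psi>) \<in> A" "f p \<otimes> h p \<in> V"
      by (rule chart_at)
    have "continuous_map (prod_topology T T) T (\<lambda>(g, h). g \<otimes> h)"
      using mult_holomorphic by (simp add: holomorphic_map_def)
    from openin_continuous_map_preimage[OF this chart_openin[OF V(1)]]
    have o: "openin (prod_topology T T) {x \<in> topspace (prod_topology T T). (\<lambda>(g, h). g \<otimes> h) x \<in> V}" .
    have "(f p, h p) \<in> {x \<in> topspace (prod_topology T T). (\<lambda>(g, h). g \<otimes> h) x \<in> V}"
      using c V(2) by (simp add: topspace_T)
    from o[unfolded openin_prod_topology_alt, rule_format, OF this]
    obtain W1 W2 where W: "openin T W1" "openin T W2" "f p \<in> W1" "h p \<in> W2"
      "W1 \<times> W2 \<subseteq> {x \<in> topspace (prod_topology T T). (\<lambda>(g, h). g \<otimes> h) x \<in> V}"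
      by (elim exE conjE)
    have "\<forall>\<^sub>F x in nhds p. f x \<otimes> h x \<in> V"
      using gdiff_eventually[OF f W(1,3)] gdiff_eventually[OF h W(2,4)]
    proof eventually_elim
      case (elim x)
      then have "(f x, h x) \<in> W1 \<times> W2"
        by simp
      from subsetD[OF W(5) this] show ?case
        by simp
    qed
    with V(1) show ?thesis
      using chart[OF V] by (elim exE) (rule gdiffI)
  qed
qed

lemma gdiff_const: "c \<in> carrier G \<Longrightarrow> gdiff (\<lambda>x. c) p"
proof -
  assume "c \<in> carrier G"
  then obtain V \<phi> where "(V, \<phi>) \<in> A" "c \<in> V"
    by (rule chart_at)
  then show ?thesis
    by (intro gdiffI[OF _ _ has_derivative_const]) auto
qed

text \<open>A change of chart, obtained by multiplying with the unit:
  \<open>gdiff_mult_chart\<close> already admits every target chart.\<close>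

lemma gdiff_in_chart:
  assumes f: "gdiff f p" and V: "(V, \<psi>) \<in> A" "f p \<in> V"
  shows "\<exists>D. ((\<lambda>x. \<psi> (f x)) has_derivative D) (at p)"
proof -
  have "f p \<otimes> \<one> \<in> V"
    using gdiff_carrier[OF f] V(2) by simp
  from gdiff_mult_chart[OF f gdiff_const[OF one_closed] V(1) this]
  obtain D where d: "((\<lambda>x. \<psi> (f x \<otimes> \<one>)) has_derivative D) (at p)" ..
  have ev: "\<forall>\<^sub>F x in nhds p. \<psi> (f x \<otimes> \<one>) = \<psi> (f x)"
  proof -
    have "\<forall>\<^sub>F x in nhds p. f x \<in> carrier G"
      using gdiff_eventually[OF f chart_openin[OF V(1)] V(2)] chart_subset[OF V(1)]
      by (auto elim: eventually_mono)
    then show ?thesis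
      by eventually_elim simp
  qed
  show ?thesis
    by (rule exI) (rule has_derivative_eventually[OF d ev])
qed

lemma gdiff_compose:
  assumes f: "gdiff f (k p)" and k: "(k has_derivative D) (at p)"
  shows "gdiff (\<lambda>x. f (k x)) p"
proof -
  obtain V \<phi> D' where V: "(V, \<phi>) \<in> A" "\<forall>\<^sub>F x in nhds (k p). f x \<in> V"
    and D': "((\<lambda>x. \<phi> (f x)) has_derivative D') (at (k p))"
    using f by (rule gdiffE)
  have "filterlim k (nhds (k p)) (nhds p)"
    using has_derivative_continuous[OF k] tendsto_at_iff_tendsto_nhds[of k p] by (simp add: continuous_at)
  then have "\<forall>\<^sub>F x in nhds p. f (k x) \<in> V"
    by (rule eventually_compose_filterlim[OF V(2)])
  moreover have "((\<lambda>x. \<phi> (f (k x))) has_derivative (\<lambda>x. D' (D x))) (at p)"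
    by (rule has_derivative_compose[OF k D'])
  ultimately show ?thesis
    by (rule gdiffI[OF V(1)])
qed

abbreviation unchart :: "'a \<Rightarrow> 'g" where "unchart \<equiv> inv_into U \<kappa>"

lemma unchart_0: "unchart 0 = \<one>"
  using inv_into_f_f[OF chart_inj[OF U(1)] U(2)] U(3) by simp

lemma unchart_eventually: "\<forall>\<^sub>F x in nhds 0. unchart x \<in> U \<and> \<kappa> (unchart x) = x"
proof -
  have "0 \<in> \<kappa> ` U"
    using U by force
  then have "\<forall>\<^sub>F x in nhds 0. x \<in> \<kappa> ` U"
    using chart_open[OF U(1)] by (simp add: eventually_nhds_in_open)
  then show ?thesis
    by eventually_elim (simp add: inv_into_into f_inv_into_f)
qed

lemma gdiff_unchart: "gdiff unchart 0"
proof -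
  have "((\<lambda>x. \<kappa> (unchart x)) has_derivative (\<lambda>x. x)) (at 0)"
    by (rule has_derivative_eventually[OF has_derivative_ident])
       (use unchart_eventually in \<open>eventually_elim, simp\<close>)
  moreover have "\<forall>\<^sub>F x in nhds 0. unchart x \<in> U"
    using unchart_eventually by eventually_elim simp
  ultimately show ?thesis
    by (intro gdiffI[OF U(1)])
qed

abbreviation conj_map :: "'g \<Rightarrow> 'a \<Rightarrow> 'g" where
  "conj_map g x \<equiv> g \<otimes> unchart x \<otimes> inv g"

lemma gdiff_conj_map: "g \<in> carrier G \<Longrightarrow> gdiff (conj_map g) 0"
  by (intro gdiff_mult' gdiff_const gdiff_unchart inv_closed)

lemma conj_map_0: "g \<in> carrier G \<Longrightarrow> conj_map g 0 = \<one>"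
  by (simp add: unchart_0)

lemma conj_map_eventually:
  assumes "g \<in> carrier G"
  shows "\<forall>\<^sub>F x in nhds 0. conj_map g x \<in> U"
  by (rule gdiff_eventually[OF gdiff_conj_map[OF assms] chart_openin[OF U(1)]])
     (simp only: conj_map_0[OF assms] U(2))

abbreviation ad_rep :: "'g \<Rightarrow> 'a \<Rightarrow> 'a" where "ad_rep \<equiv> Ad G U \<kappa>"

lemma Ad_has_derivative:
  assumes "g \<in> carrier G"
  shows "((\<lambda>x. \<kappa> (conj_map g x)) has_derivative ad_rep g) (at 0)"
proof -
  have "\<exists>D. ((\<lambda>x. \<kappa> (conj_map g x)) has_derivative D) (at 0)"
    by (rule gdiff_in_chart[OF gdiff_conj_map[OF assms] U(1)]) (simp only: conj_map_0[OF assms] U(2))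
  then show ?thesis
    unfolding Ad_def using frechet_derivative_works differentiableI by blast
qed

lemma Ad_mult:
  assumes g: "g \<in> carrier G" and h: "h \<in> carrier G"
  shows "ad_rep (g \<otimes> h) y = ad_rep g (ad_rep h y)"
proof -
  have "\<kappa> (conj_map h 0) = 0"
    by (simp only: conj_map_0[OF h] U(3))
  then have "((\<lambda>x. \<kappa> (conj_map g (\<kappa> (conj_map h x)))) has_derivative (\<lambda>y. ad_rep g (ad_rep h y))) (at 0)"
    using Ad_has_derivative[OF g] by (intro has_derivative_compose[OF Ad_has_derivative[OF h]]) simp
  moreover have "\<forall>\<^sub>F x in nhds 0. \<kappa> (conj_map g (\<kappa> (conj_map h x))) = \<kappa> (conj_map (g \<otimes> h) x)"
    using conj_map_eventually[OF h] unchart_eventually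
  proof eventually_elim
    case (elim x)
    then have "unchart (\<kappa> (conj_map h x)) = conj_map h x"
      by (intro inv_into_f_f[OF chart_inj[OF U(1)]]) blast
    moreover have "unchart x \<in> carrier G"
      using elim chart_subset[OF U(1)] by blast
    ultimately show ?case
      using g h by (simp add: m_assoc inv_mult_group)
  qed
  ultimately have "((\<lambda>x. \<kappa> (conj_map (g \<otimes> h) x)) has_derivative (\<lambda>y. ad_rep g (ad_rep h y))) (at 0)"
    by (rule has_derivative_eventually)
  then have "ad_rep (g \<otimes> h) = (\<lambda>y. ad_rep g (ad_rep h y))"
    using Ad_has_derivative[OF m_closed[OF g h]] by (rule has_derivative_unique[symmetric])
  then show ?thesis
    by simp
qed

lemma Ad_one: "ad_rep \<one> y = y"
proof -
  have "\<forall>\<^sub>F x in nhds 0. x = \<kappa> (conj_map \<one> x)"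
    using unchart_eventually by eventually_elim (use chart_subset[OF U(1)] in auto)
  then have "((\<lambda>x. \<kappa> (conj_map \<one> x)) has_derivative (\<lambda>x. x)) (at 0)"
    by (rule has_derivative_eventually[OF has_derivative_ident])
  then have "ad_rep \<one> = (\<lambda>x. x)"
    using Ad_has_derivative[OF one_closed] has_derivative_unique by blast
  then show ?thesis
    by simp
qed

lemma exp_ray:
  shows exp_ray_continuous: "continuous_map euclideanreal T (\<lambda>t. e (t *\<^sub>R X))"
    and exp_ray_add: "e ((s + t) *\<^sub>R X) = e (s *\<^sub>R X) \<otimes> e (t *\<^sub>R X)"
    and exp_ray_derivative: "((\<lambda>t. \<kappa> (e (t *\<^sub>R X))) has_vector_derivative X) (at 0)"
  using exp_map by (simp_all add: exponential_map_def)

lemma exp_closed: "e X \<in> carrier G"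
proof -
  have "e (1 *\<^sub>R X) \<in> topspace T"
    using exp_ray_continuous[of X] continuous_map_image_subset_topspace by (metis UNIV_I image_subset_iff topspace_euclidean)
  then show ?thesis
    by (simp add: topspace_T)
qed

lemma exp_0: "e 0 = \<one>"
  using exp_ray_add[of 0 0 0] exp_closed[of 0] by (simp add: l_cancel_one')

lemma Ad_exp_derivative: "((\<lambda>s. ad_rep (e (s *\<^sub>R w)) y) has_vector_derivative br w y) (at 0)"
proof -
  have "openin euclideanreal {s \<in> topspace euclideanreal. e (s *\<^sub>R w) \<in> U}"
    by (rule openin_continuous_map_preimage[OF exp_ray_continuous chart_openin[OF U(1)]])
  then have "\<forall>\<^sub>F s in nhds 0. e (s *\<^sub>R w) \<in> U"
    using eventually_nhds_in_open[of "{s. e (s *\<^sub>R w) \<in> U}" 0] by (simp add: exp_0 U(2))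
  then have ev: "\<forall>\<^sub>F s in nhds 0. ad_rep (unchart (\<kappa> (e (s *\<^sub>R w)))) y = ad_rep (e (s *\<^sub>R w)) y"
    by eventually_elim (simp add: inv_into_f_f[OF chart_inj[OF U(1)]])
  have "((\<lambda>s. ad_rep (unchart (\<kappa> (e (s *\<^sub>R w)))) y) has_derivative (\<lambda>h. br (h *\<^sub>R w) y)) (at 0)"
    using Ad_derivative[of y] exp_ray_derivative[of w]
    by (intro has_derivative_compose[where f = "\<lambda>s. \<kappa> (e (s *\<^sub>R w))" and g = "\<lambda>x. ad_rep (unchart x) y"])
       (simp_all add: has_vector_derivative_def exp_0 U(3))
  from has_derivative_eventually[OF this ev] show ?thesis
    by (simp add: has_vector_derivative_def br.scaleR_left)
qed

text \<open>Along the ray s w both sides solve f' = [w, f] with the same initial value, so they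
  agree by uniqueness.\<close>

lemma Ad_exp: "ad_rep (e w) y = exp_ad w y"
proof -
  define f where "f = (\<lambda>s. ad_rep (e (s *\<^sub>R w)) y)"
  have f: "(f has_vector_derivative br w (f s)) (at s)" for s
  proof -
    have "((\<lambda>h. ad_rep (e (h *\<^sub>R w)) (f s)) has_vector_derivative br w (f s)) (at (s - s))"
      using Ad_exp_derivative[of w "f s"] by simp
    \<comment> \<open>The derivative of the adjoint action along the ray is known at 0 only;
      multiplicativity transports it to every s.\<close>
    moreover have "((\<lambda>t. t - s) has_vector_derivative 1) (at s)"
      by (auto intro!: derivative_eq_intros)
    ultimately have "((\<lambda>h. ad_rep (e (h *\<^sub>R w)) (f s)) \<circ> (\<lambda>t. t - s) has_vector_derivative 1 *\<^sub>R br w (f s)) (at s)"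
      by (intro vector_diff_chain_at)
    moreover have "ad_rep (e ((t - s) *\<^sub>R w)) (f s) = f t" for t
      using exp_ray_add[of "t - s" s w] Ad_mult[OF exp_closed exp_closed] by (simp add: f_def)
    ultimately show ?thesis
      by (simp add: o_def)
  qed
  define d where "d = (\<lambda>s. f s - exp_ad (s *\<^sub>R w) y)"
  have "(d has_vector_derivative br w (d s)) (at s)" for s
    unfolding d_def br.diff_right by (intro has_vector_derivative_diff f exp_ad_ray_derivative)
  moreover obtain M where "\<And>x y. norm (br x y) \<le> M * norm x * norm y"
    using norm_br_le by blast
  moreover have "d 0 = 0"
    by (simp add: d_def f_def exp_0 Ad_one exp_ad_0)
  ultimately have "d 1 = 0"
    by (intro linear_ode_zero[of d "br w" "M * norm w" 1]) auto
  then show ?thesis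
    by (simp add: d_def f_def)
qed

end

section \<open>The logarithm of exp (t X) Omega exp (t X) and the derivative in the PL-CDYBE\<close>

locale taylor_on_exp_domain = lie_group_with_exp cs br G T A U \<kappa> e
  for cs :: "complex \<Rightarrow> 'a::euclidean_space \<Rightarrow> 'a" and br :: "'a \<Rightarrow> 'a \<Rightarrow> 'a"
    and G :: "'g monoid" (structure) and T :: "'g topology" and A :: "('g, 'a) chart set"
    and U :: "'g set" and \<kappa> :: "'g \<Rightarrow> 'a" and e :: "'a \<Rightarrow> 'g" +
  fixes F :: "complex \<Rightarrow> complex" and g\<^sub>0 :: "'a set" and R :: "'g \<Rightarrow> 'a \<Rightarrow> 'a"
    and B :: "'a \<Rightarrow> 'a \<Rightarrow> complex"
  assumes simple_algebra: "simple_complex_lie_algebra cs br"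
    and scalar_product: "invariant_scalar_product cs br B"
    and analytic: "F analytic_on {0}"
    and open_g0: "open g\<^sub>0" and zero_g0: "0 \<in> g\<^sub>0"
    and openin_exp_g0: "openin T (e ` g\<^sub>0)"
    and exp_biholomorphic: "biholomorphic_map cs (top_of_set g\<^sub>0) {(g\<^sub>0, id)}
           cs (subtopology T (e ` g\<^sub>0)) (open_submanifold_atlas A (e ` g\<^sub>0)) e"
    and taylor: "\<forall>\<omega>\<in>g\<^sub>0. taylor_summable cs F (br \<omega>)"
    and R_exp: "\<forall>\<omega>\<in>g\<^sub>0. R (e \<omega>) = taylor_apply cs F (br \<omega>)"
begin

sublocale simple_complex_lie_algebra cs br
  by (rule simple_algebra)

lemma gdiff_exp:
  assumes x: "x \<in> g\<^sub>0"
  shows "gdiff e x"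
proof -
  obtain V \<psi> where V: "(V, \<psi>) \<in> A" "e x \<in> V"
    using chart_at[OF exp_closed] by blast
  let ?V = "V \<inter> e ` g\<^sub>0"
  have at: "(?V, \<psi>) \<in> open_submanifold_atlas A (e ` g\<^sub>0)"
    using V(1) by (auto simp: open_submanifold_atlas_def)
  have hol: "holomorphic_map cs (top_of_set g\<^sub>0) {(g\<^sub>0, id)}
      cs (subtopology T (e ` g\<^sub>0)) (open_submanifold_atlas A (e ` g\<^sub>0)) e"
    using exp_biholomorphic by (simp add: biholomorphic_map_def)
  have "x \<in> id ` {x \<in> g\<^sub>0. e x \<in> ?V}"
    using x V(2) by simp
  from holomorphic_on_spaceD[OF holomorphic_mapD[OF hol _ at] this]
  obtain D where D: "((\<psi> \<circ> e \<circ> inv_into g\<^sub>0 id) has_derivative D) (at x)"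
    by auto
  have g0: "\<forall>\<^sub>F y in nhds x. y \<in> g\<^sub>0"
    using open_g0 x by (rule eventually_nhds_in_open)
  have inv: "inv_into g\<^sub>0 id y = y" if "y \<in> g\<^sub>0" for y
    using inv_into_f_f[OF inj_on_id that] by simp
  have "\<forall>\<^sub>F y in nhds x. (\<psi> \<circ> e \<circ> inv_into g\<^sub>0 id) y = \<psi> (e y)"
    using g0 by eventually_elim (simp add: inv)
  from has_derivative_eventually[OF D this] have D': "((\<lambda>y. \<psi> (e y)) has_derivative D) (at x)" .
  have "continuous_map (top_of_set g\<^sub>0) (subtopology T (e ` g\<^sub>0)) e"
    using hol by (simp add: holomorphic_map_def)
  then have "continuous_map (top_of_set g\<^sub>0) T e"
    by (rule continuous_map_into_fulltopology)
  from openin_continuous_map_preimage[OF this chart_openin[OF V(1)]]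
  have "openin (top_of_set g\<^sub>0) {y \<in> g\<^sub>0. e y \<in> V}"
    by simp
  then have "open {y \<in> g\<^sub>0. e y \<in> V}"
    using open_g0 openin_open_trans by blast
  then have "\<forall>\<^sub>F y in nhds x. y \<in> {y \<in> g\<^sub>0. e y \<in> V}"
    using x V(2) by (intro eventually_nhds_in_open) auto
  then have "\<forall>\<^sub>F y in nhds x. e y \<in> V"
    by eventually_elim simp
  then show ?thesis
    by (rule gdiffI[OF V(1) _ D'])
qed

text \<open>Openness of the exponential image keeps the curve inside it for small t, and the
  holomorphic inverse of \<open>e\<close> makes its logarithm differentiable. The velocity is left
  undetermined here.\<close>

lemma log_curve:
  fixes X :: 'a
  assumes w: "w \<in> g\<^sub>0"
  obtains \<gamma> \<eta> where "\<gamma> 0 = w" "(\<gamma> has_vector_derivative \<eta>) (at 0)"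
    "\<forall>\<^sub>F t in nhds (0::real). \<gamma> t \<in> g\<^sub>0 \<and> e (\<gamma> t) = e (t *\<^sub>R X) \<otimes> e w \<otimes> e (t *\<^sub>R X)"
proof -
  obtain l where hol: "holomorphic_map cs (subtopology T (e ` g\<^sub>0)) (open_submanifold_atlas A (e ` g\<^sub>0))
      cs (top_of_set g\<^sub>0) {(g\<^sub>0, id)} l"
    and l: "\<And>x. x \<in> g\<^sub>0 \<Longrightarrow> l (e x) = x"
    using exp_biholomorphic by (auto simp: biholomorphic_map_def)
  define c where "c = (\<lambda>t. e (t *\<^sub>R X) \<otimes> e w \<otimes> e (t *\<^sub>R X))"
  have c0: "c 0 = e w"
    using exp_closed by (simp add: c_def exp_0)
  have "gdiff e (0 *\<^sub>R X)"
    using gdiff_exp zero_g0 by simp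
  then have "gdiff (\<lambda>t. e (t *\<^sub>R X)) 0"
    by (rule gdiff_compose[where D = "\<lambda>t. t *\<^sub>R X"]) (auto intro!: derivative_eq_intros)
  then have c: "gdiff c 0"
    unfolding c_def by (intro gdiff_mult' gdiff_const exp_closed)
  have ev: "\<forall>\<^sub>F t in nhds 0. c t \<in> e ` g\<^sub>0"
    using w by (intro gdiff_eventually[OF c openin_exp_g0]) (auto simp: c0)
  obtain V \<psi> D where V: "(V, \<psi>) \<in> A" "\<forall>\<^sub>F t in nhds 0. c t \<in> V" "c 0 \<in> V"
    and D: "((\<lambda>t. \<psi> (c t)) has_derivative D) (at 0)"
    using c by (rule gdiffE)
  let ?V = "V \<inter> e ` g\<^sub>0"
  have at: "(?V, \<psi>) \<in> open_submanifold_atlas A (e ` g\<^sub>0)"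
    using V(1) by (auto simp: open_submanifold_atlas_def)
  have "\<psi> (c 0) \<in> \<psi> ` {y \<in> ?V. l y \<in> g\<^sub>0}"
    using V(3) w by (intro imageI) (auto simp: c0 l)
  from holomorphic_on_spaceD[OF holomorphic_mapD[OF hol at] this]
  obtain D' where D': "((id \<circ> l \<circ> inv_into ?V \<psi>) has_derivative D') (at (\<psi> (c 0)))"
    by auto
  have d: "((\<lambda>t. (id \<circ> l \<circ> inv_into ?V \<psi>) (\<psi> (c t))) has_derivative (\<lambda>t. D' (D t))) (at 0)"
    by (rule has_derivative_compose[OF D D'])
  have inj: "inj_on \<psi> ?V"
    using chart_inj[OF V(1)] by (rule inj_on_subset) simp
  have "\<forall>\<^sub>F t in nhds 0. (id \<circ> l \<circ> inv_into ?V \<psi>) (\<psi> (c t)) = l (c t)"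
    using V(2) ev by eventually_elim (simp add: inv_into_f_f[OF inj])
  from has_derivative_eventually[OF d this]
  have d': "((\<lambda>t. l (c t)) has_derivative (\<lambda>t. D' (D t))) (at 0)" .
  have "(\<lambda>t. D' (D t)) = (\<lambda>h. h *\<^sub>R D' (D 1))"
  proof
    fix h
    show "D' (D h) = h *\<^sub>R D' (D 1)"
      using linear_cmul[OF has_derivative_linear[OF d'], of h 1] by simp
  qed
  with d' have "((\<lambda>t. l (c t)) has_vector_derivative D' (D 1)) (at 0)"
    unfolding has_vector_derivative_def by (simp only:)
  moreover have "l (c 0) = w"
    by (simp add: c0 l w)
  moreover have "\<forall>\<^sub>F t in nhds 0. l (c t) \<in> g\<^sub>0 \<and> e (l (c t)) = e (t *\<^sub>R X) \<otimes> e w \<otimes> e (t *\<^sub>R X)"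
    using ev by eventually_elim (auto simp: l c_def)
  ultimately show ?thesis
    by (intro that)
qed

text \<open>
  Apply the adjoint representation to the curve: \<open>Ad (e (\<gamma> t)) = exp (ad (\<gamma> t))\<close>, whose derivative
  is known, while \<open>Ad\<close> of the product is a product of exponentials.
\<close>

lemma log_curve_velocity:
  assumes \<gamma>: "\<gamma> 0 = w" "(\<gamma> has_vector_derivative \<eta>) (at 0)"
    and ev: "\<forall>\<^sub>F t in nhds (0::real). e (\<gamma> t) = e (t *\<^sub>R X) \<otimes> e w \<otimes> e (t *\<^sub>R X)"
  shows "power_series_op expm1_over_X (br w) \<eta> = X + exp_ad w X"
proof -
  have "br (power_series_op expm1_over_X (br w) \<eta>) (exp_ad w y) = br (X + exp_ad w X) (exp_ad w y)" for y
  proof -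
    have "((\<lambda>t. exp_ad (\<gamma> t) y) has_derivative
        (\<lambda>h. br (power_series_op expm1_over_X (br w) (h *\<^sub>R \<eta>)) (exp_ad w y))) (at 0)"
      using exp_ad_has_derivative[of y w] \<gamma> unfolding has_vector_derivative_def
      by (intro has_derivative_compose[where f = \<gamma> and g = "\<lambda>w. exp_ad w y"]) simp_all
    note d1 = this
    define Z where "Z = (\<lambda>t. exp_ad w (exp_ad (t *\<^sub>R X) y))"
    have E: "((\<lambda>t. exp_ad (t *\<^sub>R X) v) has_vector_derivative br X v) (at 0)" for v
      using exp_ad_ray_derivative[of X v 0] by (simp add: exp_ad_0)
    have Z0: "Z 0 = exp_ad w y"
      by (simp add: Z_def exp_ad_0)
    have Z: "(Z has_vector_derivative exp_ad w (br X y)) (at 0)"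
      unfolding Z_def
      by (rule bounded_linear.has_vector_derivative[OF _ E])
         (rule linear_exp_ad[unfolded linear_conv_bounded_linear])
    \<comment> \<open>Operator and argument both depend on t, but the derivative of the operator is
      known only on fixed vectors; expanding \<open>Z t\<close> in the basis makes the product rule
      applicable.\<close>
    have "((\<lambda>t. \<Sum>b\<in>Basis. (Z t \<bullet> b) *\<^sub>R exp_ad (t *\<^sub>R X) b) has_vector_derivative
        (\<Sum>b\<in>Basis. (Z 0 \<bullet> b) *\<^sub>R br X b + (exp_ad w (br X y) \<bullet> b) *\<^sub>R exp_ad (0 *\<^sub>R X) b)) (at 0)"
      by (rule has_vector_derivative_sum, rule bounded_bilinear.has_vector_derivative[OF bounded_bilinear_scaleR _ E],
          rule bounded_linear.has_vector_derivative[OF bounded_linear_inner_left Z])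
    moreover have "(\<Sum>b\<in>Basis. (Z t \<bullet> b) *\<^sub>R exp_ad (t *\<^sub>R X) b) = exp_ad (t *\<^sub>R X) (Z t)" for t
    proof -
      have "exp_ad (t *\<^sub>R X) (Z t) = exp_ad (t *\<^sub>R X) (\<Sum>b\<in>Basis. (Z t \<bullet> b) *\<^sub>R b)"
        by (simp only: euclidean_representation)
      then show ?thesis
        by (simp only: linear_sum[OF linear_exp_ad] linear_cmul[OF linear_exp_ad])
    qed
    moreover have "(\<Sum>b\<in>Basis. (Z 0 \<bullet> b) *\<^sub>R br X b + (exp_ad w (br X y) \<bullet> b) *\<^sub>R exp_ad (0 *\<^sub>R X) b)
        = br X (Z 0) + exp_ad w (br X y)"
    proof -
      have "br X (Z 0) = br X (\<Sum>b\<in>Basis. (Z 0 \<bullet> b) *\<^sub>R b)"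
        by (simp only: euclidean_representation)
      also have "\<dots> = (\<Sum>b\<in>Basis. (Z 0 \<bullet> b) *\<^sub>R br X b)"
        by (simp only: br.sum_right br.scaleR_right)
      finally show ?thesis
        by (simp add: sum.distrib exp_ad_0 euclidean_representation)
    qed
    ultimately have d2: "((\<lambda>t. exp_ad (t *\<^sub>R X) (Z t)) has_vector_derivative (br X (Z 0) + exp_ad w (br X y))) (at 0)"
      by simp
    have "\<forall>\<^sub>F t in nhds 0. exp_ad (t *\<^sub>R X) (Z t) = exp_ad (\<gamma> t) y"
      using ev
    proof eventually_elim
      case (elim t)
      have "exp_ad (\<gamma> t) y = Ad G U \<kappa> (e (t *\<^sub>R X) \<otimes> e w \<otimes> e (t *\<^sub>R X)) y"
        by (simp only: Ad_exp[symmetric] elim)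
      also have "\<dots> = exp_ad (t *\<^sub>R X) (Z t)"
        by (simp add: Ad_mult exp_closed Ad_exp Z_def)
      finally show ?case
        by (rule sym)
    qed
    from has_derivative_eventually[OF d2[unfolded has_vector_derivative_def] this]
    have "(\<lambda>h. h *\<^sub>R (br X (Z 0) + exp_ad w (br X y))) = (\<lambda>h. br (power_series_op expm1_over_X (br w) (h *\<^sub>R \<eta>)) (exp_ad w y))"
      using d1 by (rule has_derivative_unique)
    from fun_cong[OF this, of 1]
    have "br (power_series_op expm1_over_X (br w) \<eta>) (exp_ad w y) = br X (exp_ad w y) + exp_ad w (br X y)"
      by (simp add: Z0)
    moreover obtain C \<rho> where "power_bounded (br w) C \<rho>"
      using power_bounded_any[of w] by (metis centre_in_ball zero_less_one)
    ultimately show ?thesis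
      by (simp add: exp_op_br br.add_left)
  qed
  note * = this
  \<comment> \<open>Since exp (\<open>ad w\<close>) is onto, the bracket of d with every element
    vanishes, so d is central.\<close>
  define d where "d = power_series_op expm1_over_X (br w) \<eta> - (X + exp_ad w X)"
  have "br y d = 0" for y
  proof -
    obtain x where "y = exp_ad w x"
      using exp_ad_surj[of w y] by blast
    then have "br d y = 0"
      using *[of x] by (simp only: d_def br.diff_left diff_self)
    then show ?thesis
      using br_antisym[of y d] by simp
  qed
  then have "d = 0"
    by (rule center_trivial)
  then show ?thesis
    by (simp add: d_def)
qed

text \<open>The equation is solved by the inverse of (exp z - 1) / z, which may be applied to
  \<open>ad w\<close> because \<open>\<rho>\<close> is below its radius 2 pi; z (exp z + 1) / (exp z
  - 1) is z coth (z / 2).\<close>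

lemma velocity_eq_zcoth:
  assumes pb: "power_bounded (br w) C \<rho>" and \<rho>: "\<rho> < 2 * pi"
    and \<eta>: "power_series_op expm1_over_X (br w) \<eta> = X + exp_ad w X"
  shows "\<eta> = power_series_op zcoth_fps (br w) X"
proof -
  let ?P = "inverse expm1_over_X"
  have "ereal \<rho> < ereal (2 * pi)"
    using \<rho> by simp
  then have P: "ereal \<rho> < fps_conv_radius ?P"
    using fps_conv_radius_inverse_expm1_over_X by (rule less_le_trans)
  have E: "ereal \<rho> < fps_conv_radius (fps_exp 1 :: complex fps)" "ereal \<rho> < fps_conv_radius expm1_over_X"
      "ereal \<rho> < fps_conv_radius (fps_exp 1 + 1 :: complex fps)"
    by (simp_all add: fps_conv_radius_expm1_over_X less_fps_conv_radius_add)
  have "\<eta> = power_series_op (?P * expm1_over_X) (br w) \<eta>"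
    by (simp add: expm1_over_X_inverse)
  also have "\<dots> = power_series_op ?P (br w) (X + exp_ad w X)"
    by (simp only: power_series_op_mult[OF br_linear_right pb P E(2)] \<eta>)
  also have "X + exp_ad w X = power_series_op (fps_exp 1 + 1) (br w) X"
    by (simp add: power_series_op_add[OF pb E(1)])
  also have "power_series_op ?P (br w) \<dots> = power_series_op zcoth_fps (br w) X"
    by (simp only: zcoth_fps_def power_series_op_mult[OF br_linear_right pb P E(3)])
  finally show ?thesis .
qed

definition F_fps :: "complex fps" where "F_fps = fps_expansion F 0"

lemma F_has_fps_expansion: "F has_fps_expansion F_fps"
  unfolding F_fps_def using analytic by (rule analytic_at_imp_has_fps_expansion_0)

lemma F_fps_conv_radius: "0 < fps_conv_radius F_fps"
  using F_has_fps_expansion by (simp add: has_fps_expansion_def)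

lemma taylor_apply_eq: "taylor_apply cs F L = power_series_op F_fps L"
  by (simp add: fun_eq_iff taylor_apply_def power_series_op_def F_fps_def fps_expansion_def)

lemma taylor_summable_F_fps: "w \<in> g\<^sub>0 \<Longrightarrow> summable (\<lambda>n. cs (F_fps $ n) ((br w ^^ n) y))"
  using taylor by (simp add: taylor_summable_def F_fps_def fps_expansion_def)

lemma R_exp_eq: "w \<in> g\<^sub>0 \<Longrightarrow> R (e w) = power_series_op F_fps (br w)"
  using R_exp by (simp add: taylor_apply_eq)

text \<open>The velocity stays implicit here: its closed form needs powers of \<open>ad w\<close>
  bounded below 2 pi, whereas this version also covers F = 0.\<close>

lemma D_plus_sums:
  assumes w: "w \<in> g\<^sub>0"
  obtains \<eta> where "power_series_op expm1_over_X (br w) \<eta> = X + exp_ad w X"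
    and "\<And>Y. (\<lambda>m. cs (F_fps $ Suc m) (\<Sum>i\<le>m. (br w ^^ i) (br \<eta> ((br w ^^ (m - i)) Y))))
      sums D_plus G e X R (e w) Y"
proof -
  obtain \<gamma> \<eta> where \<gamma>: "\<gamma> 0 = w" "(\<gamma> has_vector_derivative \<eta>) (at 0)"
    and ev: "\<forall>\<^sub>F t in nhds (0::real). \<gamma> t \<in> g\<^sub>0 \<and> e (\<gamma> t) = e (t *\<^sub>R X) \<otimes> e w \<otimes> e (t *\<^sub>R X)"
    using log_curve[OF w] by blast
  have ev': "\<forall>\<^sub>F t in nhds (0::real). e (\<gamma> t) = e (t *\<^sub>R X) \<otimes> e w \<otimes> e (t *\<^sub>R X)"
    using ev by eventually_elim simp
  obtain C \<rho> \<delta> where \<delta>: "0 < \<delta>" "ereal \<rho> < fps_conv_radius F_fps"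
    "\<And>w'. w' \<in> ball w \<delta> \<Longrightarrow> power_bounded (br w') C \<rho>"
    by (rule taylor_power_bounded[OF open_g0 w taylor_summable_F_fps F_fps_conv_radius])
       (assumption, rule that)
  have "(\<lambda>m. cs (F_fps $ Suc m) (\<Sum>i\<le>m. (br w ^^ i) (br \<eta> ((br w ^^ (m - i)) Y))))
      sums D_plus G e X R (e w) Y" for Y
  proof -
    obtain D where D: "((\<lambda>w. power_series_op F_fps (br w) Y) has_derivative D) (at w)"
      "\<And>\<eta>. (\<lambda>m. cs (F_fps $ Suc m) (\<Sum>i\<le>m. (br w ^^ i) (br \<eta> ((br w ^^ (m - i)) Y)))) sums D \<eta>"
      by (rule power_series_op_has_derivative[OF \<delta>(2,1,3), where y = Y]) (assumption, rule that)
    have d: "((\<lambda>t. power_series_op F_fps (br (\<gamma> t)) Y) has_derivative (\<lambda>h. D (h *\<^sub>R \<eta>))) (at 0)"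
      using D(1) \<gamma> unfolding has_vector_derivative_def
      by (intro has_derivative_compose[where f = \<gamma> and g = "\<lambda>w. power_series_op F_fps (br w) Y"]) simp_all
    have "\<forall>\<^sub>F t in nhds 0. power_series_op F_fps (br (\<gamma> t)) Y = R (e (t *\<^sub>R X) \<otimes> e w \<otimes> e (t *\<^sub>R X)) Y"
      using ev
    proof eventually_elim
      case (elim t)
      then show ?case
        using R_exp_eq[of "\<gamma> t"] by metis
    qed
    from has_derivative_eventually[OF d this]
    have "((\<lambda>t. R (e (t *\<^sub>R X) \<otimes> e w \<otimes> e (t *\<^sub>R X)) Y) has_vector_derivative D \<eta>) (at 0)"
      by (simp add: has_vector_derivative_def linear_cmul[OF has_derivative_linear[OF D(1)]])
    then have "D_plus G e X R (e w) Y = D \<eta>"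
      unfolding D_plus_def by (rule vector_derivative_at)
    then show ?thesis
      using D(2) by simp
  qed
  with log_curve_velocity[OF \<gamma> ev'] show ?thesis
    by (rule that)
qed

end

section \<open>The PL-CDYBE as a power series identity\<close>

text \<open>
  The point \<open>(x, y, z) = (-1, 1, 0)\<close> corresponds to taking \<open>Z = w\<close> and \<open>X\<close> an eigenvector of \<open>ad w\<close>;
  there the functional equation degenerates to a Riccati equation for \<open>F\<close>.
\<close>

definition solution_recursion :: "complex fps \<Rightarrow> nat \<Rightarrow> complex" where
  "solution_recursion a n = cdybe_coeff (*) a n (\<lambda>i j k. (-1) ^ i * 1 ^ j * 0 ^ k)"

lemma cdybe_coeff_cong:
  assumes "\<And>i j k. i + j + k = n \<Longrightarrow> t i j k = t' i j k"
  shows "cdybe_coeff sc a n t = cdybe_coeff sc a n t'"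
proof -
  have "(\<Sum>i\<le>n. sc (a $ i * a $ (n - i)) (t i (n - i) 0 + t 0 i (n - i) + t (n - i) 0 i))
      = (\<Sum>i\<le>n. sc (a $ i * a $ (n - i)) (t' i (n - i) 0 + t' 0 i (n - i) + t' (n - i) 0 i))"
    by (intro sum.cong refl) (simp add: assms)
  moreover have "(\<Sum>m\<le>n. sc (a $ Suc m * zcoth_fps $ (n - m) / 2)
          (\<Sum>i\<le>m. sc ((-1) ^ i) (t (n - m) (m - i) i + t i (n - m) (m - i) + t (m - i) i (n - m))))
      = (\<Sum>m\<le>n. sc (a $ Suc m * zcoth_fps $ (n - m) / 2)
          (\<Sum>i\<le>m. sc ((-1) ^ i) (t' (n - m) (m - i) i + t' i (n - m) (m - i) + t' (m - i) i (n - m))))"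
    by (intro sum.cong refl arg_cong[of _ _ "sc _"]) (simp add: assms)
  ultimately show ?thesis
    by (simp only: cdybe_coeff_def)
qed

lemma cdybe_coeff_mult: "cdybe_coeff (*) a n (\<lambda>i j k. c * t i j k) = c * cdybe_coeff (*) a n t"
proof -
  have 1: "c * x + c * y + c * z = c * (x + y + z)" for x y z :: complex
    by (simp only: distrib_left)
  have 2: "d * (c * x) = c * (d * x)" for d x :: complex
    by (simp only: ac_simps)
  show ?thesis
    unfolding cdybe_coeff_def 1 2 sum_distrib_left[symmetric] right_diff_distrib[symmetric] ..
qed

text \<open>In even degree m the recursion expresses the coefficient of index m + 1 by those of
  index at most m: its factor is m + 3, never zero, times \<open>zcoth_fps $ 0 / 2\<close>, which is
  1.\<close>

lemma solution_recursion_unique: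
  assumes a: "\<And>n. even n \<Longrightarrow> a $ n = 0" and b: "\<And>n. even n \<Longrightarrow> b $ n = 0"
    and eq: "\<And>n. solution_recursion a n = solution_recursion b n"
  shows "a = b"
proof (rule fps_ext)
  fix n
  show "a $ n = b $ n"
  proof (induction n rule: less_induct)
    case (less n)
    show ?case
    proof (cases "even n")
      case False
      then obtain m where n: "n = Suc m" and m: "even m"
        by (metis even_Suc not0_implies_Suc even_zero)
      have IH: "a $ i = b $ i" if "i \<le> m" for i
        using less that n by simp
      define S where "S = (\<lambda>a :: complex fps. \<Sum>i\<le>m. a $ i * a $ (m - i)
        * ((-1) ^ i * 1 ^ (m - i) * 0 ^ 0 + (-1) ^ 0 * 1 ^ i * 0 ^ (m - i) + (-1) ^ (m - i) * 1 ^ 0 * 0 ^ i))"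
      define K where "K = (\<lambda>l. \<Sum>i\<le>l. (-1) ^ i * ((-1) ^ (m - l) * 1 ^ (l - i) * 0 ^ i
        + (-1) ^ i * 1 ^ (m - l) * 0 ^ (l - i) + (-1) ^ (l - i) * 1 ^ i * (0::complex) ^ (m - l)))"
      define Q where "Q = (\<lambda>a :: complex fps. \<Sum>l<m. a $ Suc l * zcoth_fps $ (m - l) / 2 * K l)"
      have rec: "solution_recursion a m = S a - (Q a + a $ Suc m * K m)" for a
        by (simp add: solution_recursion_def cdybe_coeff_def S_def Q_def K_def lessThan_Suc_atMost[symmetric])
      have "S a = S b"
        unfolding S_def by (intro sum.cong refl) (simp add: IH)
      moreover have "Q a = Q b"
        unfolding Q_def by (intro sum.cong refl) (simp add: IH)
      ultimately have "a $ Suc m * K m = b $ Suc m * K m"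
        using eq[of m] by (simp add: rec)
      \<comment> \<open>One comes from i = 0, one from i = m, and m + 1 from the third summand,
        where m even makes all signs positive.\<close>
      moreover have "K m = of_nat (m + 3)"
      proof -
        have "(\<Sum>i\<le>m. (-1) ^ i * (0::complex) ^ i) = (\<Sum>i\<in>{0}. (-1) ^ i * 0 ^ i)"
          by (rule sum.mono_neutral_right) (auto simp: power_0_left)
        moreover have "(\<Sum>i\<le>m. (-1) ^ i * ((-1) ^ i * (0::complex) ^ (m - i))) = (\<Sum>i\<in>{m}. (-1) ^ i * ((-1) ^ i * 0 ^ (m - i)))"
          by (rule sum.mono_neutral_right) (auto simp: power_0_left)
        moreover have "(\<Sum>i\<le>m. (-1) ^ i * (-1 :: complex) ^ (m - i)) = (\<Sum>i\<le>m. 1)"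
          using m by (intro sum.cong refl) (simp flip: power_add)
        moreover have "(-1) ^ m * ((-1) ^ m * 0 ^ (m - m)) = (1 :: complex)"
          by (simp flip: power_add)
        ultimately show ?thesis
          by (simp add: K_def distrib_left sum.distrib)
      qed
      moreover have "of_nat (m + 3) \<noteq> (0 :: complex)"
        by (metis of_nat_eq_0_iff add_is_0 zero_neq_numeral)
      ultimately show ?thesis
        by (simp only: n mult_cancel_right) simp
    qed (simp add: a b)
  qed
qed

text \<open>The monomial x^i y^j z^k at y = 1 and z = -1 - x. The exponent j leaves no trace, but in
  fixed degree i and k determine it.\<close>

definition scalar_monomial :: "nat \<Rightarrow> nat \<Rightarrow> nat \<Rightarrow> complex poly" where
  "scalar_monomial i j k = [:0, 1:] ^ i * (- [:1, 1:]) ^ k"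

text \<open>The scalar identity holds where x, y, z are all nonzero, thus at all but two values of
  x; a polynomial identity then follows and includes the degenerate points.\<close>

lemma cdybe_coeff_poly_F_nu:
  "cdybe_coeff smult (F_nu_fps \<nu>) n scalar_monomial = [:if n = 0 then 1/4 - \<nu>\<^sup>2 else 0:]"
    (is "?P = [:?c:]")
proof -
  have "poly ?P x = cdybe_coeff (*) (F_nu_fps \<nu>) n (\<lambda>i j k. x ^ i * 1 ^ j * (- 1 - x) ^ k)" for x
    by (simp add: cdybe_coeff_def poly_sum scalar_monomial_def)
  then have *: "poly ?P x = ?c" if "x \<noteq> 0" "- 1 - x \<noteq> 0" for x
    using that cdybe_coeff_F_nu[of x 1 "- 1 - x"] by simp
  have "UNIV - {0, -1} \<subseteq> {x. poly (?P - [:?c:]) x = 0}"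
    using * by (force simp: add_eq_0_iff)
  moreover have "infinite (UNIV - {0, -1 :: complex})"
    by (simp add: infinite_UNIV_char_0)
  ultimately have "?P - [:?c:] = 0"
    using poly_roots_finite finite_subset by blast
  then show ?thesis
    by simp
qed

text \<open>The point (-1, 1, 0) has z = 0 and is out of reach for \<open>cdybe_coeff_F_nu\<close>;
  the polynomial identity covers it.\<close>

lemma solution_recursion_F_nu: "solution_recursion (F_nu_fps \<nu>) n = (if n = 0 then 1/4 - \<nu>\<^sup>2 else 0)"
  using arg_cong[OF cdybe_coeff_poly_F_nu[of \<nu> n], of "\<lambda>p. poly p (-1)"]
  by (simp add: solution_recursion_def cdybe_coeff_def poly_sum scalar_monomial_def)

section \<open>Trilinear forms in powers of \<open>ad w\<close> and the expansion of the
  PL-CDYBE\<close>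

context taylor_on_exp_domain
begin

lemma B_bilinear:
  shows B_bounded_bilinear: "bounded_bilinear B"
    and B_scale_left: "B (cs c x) y = c * B x y"
    and B_sym: "B x y = B y x"
    and B_invariant: "B (br x y) z = B x (br y z)"
    and B_nondegenerate: "(\<And>y. B x y = 0) \<Longrightarrow> x = 0"
proof -
  have l: "Vector_Spaces.linear cs (*) (\<lambda>y. B x y)" "Vector_Spaces.linear cs (*) (\<lambda>x. B x y)" for x y
    using scalar_product by (auto simp: invariant_scalar_product_def)
  have "bilinear B"
    unfolding bilinear_def using linear_real_functional[OF l(1)] linear_real_functional[OF l(2)] by blast
  then show "bounded_bilinear B"
    by (simp add: bilinear_conv_bounded_bilinear)
  show "B (cs c x) y = c * B x y"
    using l(2)[of y] by (simp add: Vector_Spaces.linear_iff)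
  show "B x y = B y x" "B (br x y) z = B x (br y z)" "(\<And>y. B x y = 0) \<Longrightarrow> x = 0"
    using scalar_product by (auto simp: invariant_scalar_product_def)
qed

sublocale B: bounded_bilinear B
  by (rule B_bounded_bilinear)

lemma B_scale_right: "B x (cs c y) = c * B x y"
  by (metis B_scale_left B_sym)

lemma B_cyclic: "B (br x y) z = B (br y z) x"
  by (metis B_invariant B_sym)

lemma B_skew: "B (br w x) y = - B x (br w y)"
proof -
  have "B (br w x) y = B (- br x w) y"
    by (simp only: br_antisym[of w x])
  then show ?thesis
    by (simp add: B.minus_left B_invariant)
qed

lemma B_skew_funpow: "B ((br w ^^ n) x) y = (-1) ^ n * B x ((br w ^^ n) y)"
  by (induction n arbitrary: y) (simp_all add: B_skew, simp add: funpow_swap1)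

definition cubic_form :: "'a \<Rightarrow> 'a \<Rightarrow> 'a \<Rightarrow> 'a \<Rightarrow> nat \<Rightarrow> nat \<Rightarrow> nat \<Rightarrow> complex" where
  "cubic_form w X Y Z i j k = B (br ((br w ^^ i) X) ((br w ^^ j) Y)) ((br w ^^ k) Z)"

lemma cubic_form_cyclic: "cubic_form w Y Z X i j k = cubic_form w X Y Z k i j"
  by (simp add: cubic_form_def B_cyclic[of "(br w ^^ k) X"])

text \<open>This is x + y + z = 0: \<open>ad w\<close> is a derivation of the bracket and skew for
  \<open>B\<close>.\<close>

lemma cubic_form_relation:
  "cubic_form w X Y Z i j (Suc k) = - cubic_form w X Y Z (Suc i) j k - cubic_form w X Y Z i (Suc j) k"
proof -
  have "cubic_form w X Y Z i j (Suc k) = - B (br w (br ((br w ^^ i) X) ((br w ^^ j) Y))) ((br w ^^ k) Z)"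
    by (simp add: cubic_form_def B_skew)
  then show ?thesis
    by (simp add: br_derivation[of w] B.add_left cubic_form_def)
qed

text \<open>
  Modulo the relation above, the cubic form is a linear functional on polynomials
  homogeneous of degree \<open>n\<close> in two variables; here they are dehomogenized in the second one,
  so that the three arguments stand for \<open>x\<close>, \<open>1\<close> and \<open>-1 - x\<close>.
\<close>

lemma cdybe_coeff_cubic_form:
  "cdybe_coeff (*) (F_nu_fps \<nu>) n (cubic_form w X Y Z) = (if n = 0 then (1/4 - \<nu>\<^sup>2) * B (br X Y) Z else 0)"
proof -
  let ?t = "cubic_form w X Y Z"
  \<comment> \<open>Homogenized, x^i stands for x^i y^(n-i), whose value is the form with
    \<open>k = 0\<close>.\<close>
  define \<Lambda> where "\<Lambda> = (\<lambda>p. \<Sum>i\<le>n. coeff p i * ?t i (n - i) 0)"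
  have add: "\<Lambda> (p + q) = \<Lambda> p + \<Lambda> q" and smult: "\<Lambda> (smult c p) = c * \<Lambda> p" for p q c
    by (simp_all add: \<Lambda>_def distrib_right sum.distrib sum_distrib_left mult.assoc)
  have zero: "\<Lambda> 0 = 0"
    by (simp add: \<Lambda>_def)
  have sum: "\<Lambda> (sum f I) = (\<Sum>i\<in>I. \<Lambda> (f i))" if "finite I" for f and I :: "nat set"
    using that by (induction I rule: finite_induct) (simp_all add: add zero)
  have diff: "\<Lambda> (p - q) = \<Lambda> p - \<Lambda> q" for p q
    using add[of "p - q" q] by simp
  \<comment> \<open>The cubic form and the monomial obey the same reduction of k, namely z = -x - y,
    and agree for k = 0.\<close>
  have mono: "?t i j k = \<Lambda> (scalar_monomial i j k)" if "i + j + k = n" for i j k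
    using that
  proof (induction k arbitrary: i j)
    case 0
    have "\<Lambda> (scalar_monomial i j 0) = (\<Sum>l\<le>n. (if l = i then ?t l (n - l) 0 else 0))"
      unfolding \<Lambda>_def scalar_monomial_def
      by (intro sum.cong refl) (auto simp: coeff_monom simp flip: monom_altdef[of 1, simplified])
    then show ?case
      using 0 by (simp add: sum.delta) (metis add_diff_cancel_left')
  next
    case (Suc k)
    have "scalar_monomial i j (Suc k) = smult (-1) (scalar_monomial (Suc i) j k + scalar_monomial i (Suc j) k)"
      by (simp add: scalar_monomial_def algebra_simps)
    then have "\<Lambda> (scalar_monomial i j (Suc k)) = - (\<Lambda> (scalar_monomial (Suc i) j k) + \<Lambda> (scalar_monomial i (Suc j) k))"
      by (simp only: smult add) simp
    then show ?case
      using Suc.prems Suc.IH[of "Suc i" j] Suc.IH[of i "Suc j"] by (simp add: cubic_form_relation)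
  qed
  have "cdybe_coeff (*) (F_nu_fps \<nu>) n ?t = cdybe_coeff (*) (F_nu_fps \<nu>) n (\<lambda>i j k. \<Lambda> (scalar_monomial i j k))"
    by (rule cdybe_coeff_cong) (rule mono)
  also have "\<dots> = \<Lambda> (cdybe_coeff smult (F_nu_fps \<nu>) n scalar_monomial)"
    by (simp only: cdybe_coeff_def add smult diff sum finite_atMost)
  also have "\<dots> = \<Lambda> [:if n = 0 then 1/4 - \<nu>\<^sup>2 else 0:]"
    by (simp only: cdybe_coeff_poly_F_nu)
  also have "\<dots> = (if n = 0 then (1/4 - \<nu>\<^sup>2) * B (br X Y) Z else 0)"
    by (simp add: \<Lambda>_def cubic_form_def)
  finally show ?thesis .
qed

definition cdybe_term :: "'a \<Rightarrow> 'a \<Rightarrow> 'a \<Rightarrow> 'a \<Rightarrow> complex" where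
  "cdybe_term w X Y Z = B (br (R (e w) X) (R (e w) Y) - (1/2) *\<^sub>R D_plus G e X R (e w) Y) Z"

lemma PL_CDYBE_iff:
  "PL_CDYBE br B G e (e ` g\<^sub>0) R \<mu> \<longleftrightarrow>
    (\<forall>w\<in>g\<^sub>0. \<forall>X Y Z. cdybe_term w X Y Z + cdybe_term w Y Z X + cdybe_term w Z X Y = \<mu> * B (br X Y) Z)"
  unfolding PL_CDYBE_def Let_def cdybe_term_def by blast

text \<open>The bracket of the two values of \<open>R\<close> is a Cauchy product directly. For the
  derivative, skewness moves the outer powers of \<open>ad w\<close> onto Z, and invariance isolates
  the velocity as one argument of \<open>B\<close>; its series h (\<open>ad w\<close>) X then enters
  a second Cauchy product.\<close>

lemma cdybe_term_sums:
  assumes w: "w \<in> g\<^sub>0" and pb: "power_bounded (br w) C \<rho>"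
    and \<rho>: "ereal \<rho> < fps_conv_radius F_fps" "\<rho> < 2 * pi"
  fixes X Y Z :: 'a
  defines "t \<equiv> cubic_form w X Y Z"
  shows "(\<lambda>n. (\<Sum>i\<le>n. F_fps $ i * F_fps $ (n - i) * t i (n - i) 0)
      - (\<Sum>m\<le>n. F_fps $ Suc m * zcoth_fps $ (n - m) / 2 * (\<Sum>i\<le>m. (-1) ^ i * t (n - m) (m - i) i)))
    sums cdybe_term w X Y Z"
proof -
  let ?L = "br w" and ?a = F_fps and ?h = zcoth_fps
  obtain \<eta> where \<eta>': "power_series_op expm1_over_X ?L \<eta> = X + exp_ad w X"
    and D': "\<And>Y. (\<lambda>m. cs (?a $ Suc m) (\<Sum>i\<le>m. (?L ^^ i) (br \<eta> ((?L ^^ (m - i)) Y)))) sums D_plus G e X R (e w) Y"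
    by (rule D_plus_sums[OF w, of X]) (rule that)
  note D = D'[of Y]
  have \<eta>: "\<eta> = power_series_op ?h ?L X"
    by (rule velocity_eq_zcoth[OF pb \<rho>(2) \<eta>'])
  have "ereal \<rho> < ereal (2 * pi)"
    using \<rho>(2) by simp
  then have rh: "ereal \<rho> < fps_conv_radius ?h"
    using fps_conv_radius_zcoth by (rule less_le_trans)
  have "(\<lambda>n. \<Sum>i\<le>n. br (cs (?a $ i) ((?L ^^ i) X)) (cs (?a $ (n - i)) ((?L ^^ (n - i)) Y)))
      sums br (R (e w) X) (R (e w) Y)"
    unfolding R_exp_eq[OF w] power_series_op_def
    by (intro bilinear_Cauchy_product_sums bounded_bilinear_br power_series_op_summable[OF pb \<rho>(1)])
  from bounded_linear.sums[OF B.bounded_linear_left this, of Z]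
  have 1: "(\<lambda>n. \<Sum>i\<le>n. ?a $ i * ?a $ (n - i) * t i (n - i) 0) sums B (br (R (e w) X) (R (e w) Y)) Z"
    by (simp add: B.sum_left br_scale_left br_scale_right B_scale_left t_def cubic_form_def mult.assoc mult.left_commute)
  \<comment> \<open>What the velocity is paired with in order m, once all powers of
    \<open>ad w\<close> act on Y and Z.\<close>
  define W where "W = (\<lambda>m. cs (?a $ Suc m) (\<Sum>i\<le>m. (-1) ^ i *\<^sub>R br ((?L ^^ (m - i)) Y) ((?L ^^ i) Z)))"
  \<comment> \<open>Each \<open>W m\<close> has m + 1 summands of size \<open>\<rho>\<close>^m, so
    the series is dominated by that of the derivative of F.\<close>
  have sW: "summable (\<lambda>m. norm (W m))"
  proof -
    obtain K where K: "0 \<le> K" "\<And>c x. norm (cs c x) \<le> K * norm c * norm x"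
      using norm_cs_le by blast
    obtain M where M: "0 < M" "\<And>x y. norm (br x y) \<le> M * norm x * norm y"
      using norm_br_le by blast
    note nn = power_bounded_nonneg[OF pb]
    have "norm (W m) \<le> K * M * C * C * norm Y * norm Z * (norm (?a $ Suc m) * real (Suc m) * \<rho> ^ m)" for m
    proof -
      have "norm ((-1) ^ i *\<^sub>R br ((?L ^^ (m - i)) Y) ((?L ^^ i) Z)) \<le> M * C * C * norm Y * norm Z * \<rho> ^ m"
        if i: "i \<le> m" for i
      proof -
        have "norm ((-1) ^ i *\<^sub>R br ((?L ^^ (m - i)) Y) ((?L ^^ i) Z)) \<le> M * norm ((?L ^^ (m - i)) Y) * norm ((?L ^^ i) Z)"
          using M(2) by simp
        also have "\<dots> \<le> M * (C * \<rho> ^ (m - i) * norm Y) * (C * \<rho> ^ i * norm Z)"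
          using M(1) nn by (intro mult_mono power_boundedD[OF pb]) auto
        also have "\<dots> = M * C * C * norm Y * norm Z * (\<rho> ^ (m - i) * \<rho> ^ i)"
          by (simp only: ac_simps)
        also have "\<rho> ^ (m - i) * \<rho> ^ i = \<rho> ^ m"
          using i by (simp flip: power_add)
        finally show ?thesis .
      qed
      then have "norm (\<Sum>i\<le>m. (-1) ^ i *\<^sub>R br ((?L ^^ (m - i)) Y) ((?L ^^ i) Z)) \<le> (\<Sum>i\<le>m. M * C * C * norm Y * norm Z * \<rho> ^ m)"
        by (intro sum_norm_le) auto
      also have "\<dots> = real (Suc m) * (M * C * C * norm Y * norm Z * \<rho> ^ m)"
        by simp
      finally have "norm (W m) \<le> K * norm (?a $ Suc m) * (real (Suc m) * (M * C * C * norm Y * norm Z * \<rho> ^ m))"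
        unfolding W_def using K(1) by (intro order.trans[OF K(2)] mult_left_mono) auto
      then show ?thesis
        by (simp only: ac_simps)
    qed
    then have "norm (norm (W m)) \<le> K * M * C * C * norm Y * norm Z * (norm (?a $ Suc m) * real (Suc m) * \<rho> ^ m)" for m
      by simp
    moreover have "summable (\<lambda>m. K * M * C * C * norm Y * norm Z * (norm (?a $ Suc m) * real (Suc m) * \<rho> ^ m))"
      using nn \<rho>(1) by (intro summable_mult summable_deriv_fps) auto
    ultimately show ?thesis
      by (rule summable_comparison_test'[where N = 0, rotated])
  qed
  have "B (cs (?a $ Suc m) (\<Sum>i\<le>m. (?L ^^ i) (br \<eta> ((?L ^^ (m - i)) Y)))) Z = B \<eta> (W m)" for m
    unfolding W_def B_scale_left B_scale_right B.sum_left B.sum_right B.scaleR_right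
    by (intro arg_cong[of _ _ "\<lambda>x. _ * x"] sum.cong refl)
       (simp add: B_skew_funpow B_invariant scaleR_conv_of_real)
  with bounded_linear.sums[OF B.bounded_linear_left D, of Z]
  have "(\<lambda>m. B \<eta> (W m)) sums B (D_plus G e X R (e w) Y) Z"
    by simp
  moreover have "(\<lambda>m. B \<eta> (W m)) sums B \<eta> (\<Sum>m. W m)"
    by (rule bounded_linear.sums[OF B.bounded_linear_right summable_sums[OF summable_norm_cancel[OF sW]]])
  ultimately have BD: "B (D_plus G e X R (e w) Y) Z = B \<eta> (\<Sum>m. W m)"
    by (rule sums_unique2)
  have "(\<lambda>n. \<Sum>m\<le>n. B (cs (?h $ (n - m)) ((?L ^^ (n - m)) X)) (W m)) sums B \<eta> (\<Sum>m. W m)"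
    unfolding \<eta> power_series_op_def
    by (rule bilinear_Cauchy_product_sums[OF B.bounded_bilinear_axioms[THEN bounded_bilinear.flip] sW
          power_series_op_summable[OF pb rh]])
  then have "(\<lambda>n. \<Sum>m\<le>n. B (cs (?h $ (n - m)) ((?L ^^ (n - m)) X)) (W m)) sums B (D_plus G e X R (e w) Y) Z"
    by (simp only: BD)
  from sums_mult[OF this, of "1/2"]
  have "(\<lambda>n. 1/2 * (\<Sum>m\<le>n. B (cs (?h $ (n - m)) ((?L ^^ (n - m)) X)) (W m)))
      sums (1/2 * B (D_plus G e X R (e w) Y) Z)" .
  moreover have "1/2 * (\<Sum>m\<le>n. B (cs (?h $ (n - m)) ((?L ^^ (n - m)) X)) (W m))
      = (\<Sum>m\<le>n. ?a $ Suc m * ?h $ (n - m) / 2 * (\<Sum>i\<le>m. (-1) ^ i * t (n - m) (m - i) i))" for n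
    unfolding W_def B_scale_left B_scale_right B.sum_right sum_distrib_left[of "1/2"]
    by (intro sum.cong refl)
       (simp add: t_def cubic_form_def B_invariant B.scaleR_right scaleR_conv_of_real sum_distrib_left mult.assoc)
  ultimately have "(\<lambda>n. \<Sum>m\<le>n. ?a $ Suc m * ?h $ (n - m) / 2 * (\<Sum>i\<le>m. (-1) ^ i * t (n - m) (m - i) i))
      sums (1/2 * B (D_plus G e X R (e w) Y) Z)"
    by simp
  from sums_diff[OF 1 this] show ?thesis
    by (simp add: cdybe_term_def B.diff_left B.scaleR_left scaleR_conv_of_real)
qed

lemma cdybe_sums:
  assumes w: "w \<in> g\<^sub>0" and pb: "power_bounded (br w) C \<rho>"
    and \<rho>: "ereal \<rho> < fps_conv_radius F_fps" "\<rho> < 2 * pi"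
  shows "(\<lambda>n. cdybe_coeff (*) F_fps n (cubic_form w X Y Z))
    sums (cdybe_term w X Y Z + cdybe_term w Y Z X + cdybe_term w Z X Y)"
proof -
  have c: "cubic_form w Y Z X i j k = cubic_form w X Y Z k i j"
      "cubic_form w Z X Y i j k = cubic_form w X Y Z j k i" for i j k
    by (simp_all only: cubic_form_cyclic[of w Y Z X] cubic_form_cyclic[of w Z X Y])
  note s = cdybe_term_sums[OF w pb \<rho>]
  from sums_add[OF sums_add[OF s[of X Y Z] s[of Y Z X]] s[of Z X Y]]
  show ?thesis
    unfolding c cdybe_coeff_def
    by (simp add: distrib_left sum.distrib algebra_simps)
qed

end

section \<open>The two directions of the classification\<close>

context taylor_on_exp_domain
begin

lemma F_eq_F_nu_iff: "(\<forall>\<^sub>F z in nhds 0. F z = F_nu \<nu> z) \<longleftrightarrow> F_fps = F_nu_fps \<nu>"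
proof
  assume "\<forall>\<^sub>F z in nhds 0. F z = F_nu \<nu> z"
  then have "F has_fps_expansion F_nu_fps \<nu>"
    using F_nu_has_fps_expansion has_fps_expansion_cong[OF _ refl] by blast
  with F_has_fps_expansion show "F_fps = F_nu_fps \<nu>"
    by (rule fps_expansion_unique_complex)
next
  assume "F_fps = F_nu_fps \<nu>"
  then have "\<forall>\<^sub>F z in nhds 0. eval_fps (F_nu_fps \<nu>) z = F z"
    using F_has_fps_expansion by (simp add: has_fps_expansion_def)
  moreover have "\<forall>\<^sub>F z in nhds 0. eval_fps (F_nu_fps \<nu>) z = F_nu \<nu> z"
    using F_nu_has_fps_expansion by (simp add: has_fps_expansion_def)
  ultimately show "\<forall>\<^sub>F z in nhds 0. F z = F_nu \<nu> z"
    by eventually_elim simp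
qed

lemma F_fps_even_nth:
  assumes odd: "\<forall>\<^sub>F z in nhds 0. F (- z) = - F z" and n: "even n"
  shows "F_fps $ n = 0"
proof -
  have "(\<lambda>z. (-1) * z) has_fps_expansion fps_const (-1) * (fps_X :: complex fps)"
    by (intro fps_expansion_intros)
  from has_fps_expansion_compose[OF F_has_fps_expansion this]
  have "(\<lambda>z. F (- z)) has_fps_expansion dil (-1) F_fps"
    by (simp add: o_def dil_def)
  then have "(\<lambda>z. - F z) has_fps_expansion dil (-1) F_fps"
    by (rule iffD1[OF has_fps_expansion_cong[OF odd refl]])
  with has_fps_expansion_minus[OF F_has_fps_expansion] have "- F_fps = dil (-1) F_fps"
    by (rule fps_expansion_unique_complex)
  then have "- F_fps $ n = dil (-1) F_fps $ n"
    by (metis fps_neg_nth)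
  then show ?thesis
    using n by simp
qed

lemma PL_CDYBE_F_nu:
  assumes F: "F_fps = F_nu_fps \<nu>"
  shows "PL_CDYBE br B G e (e ` g\<^sub>0) R (1/4 - \<nu>\<^sup>2)"
  unfolding PL_CDYBE_iff
proof (intro ballI allI)
  fix w X Y Z
  assume w: "w \<in> g\<^sub>0"
  show "cdybe_term w X Y Z + cdybe_term w Y Z X + cdybe_term w Z X Y = (1/4 - \<nu>\<^sup>2) * B (br X Y) Z"
  proof (cases "\<nu>\<^sup>2 = 1/4")
    case True
    then have 0: "F_fps = 0"
      using F F_nu_fps_trivial by simp
    have "R (e w) X = 0" for X
      by (simp add: R_exp_eq[OF w] 0 power_series_op_def)
    moreover have "D_plus G e X R (e w) Y = 0" for X Y
    proof -
      obtain \<eta> where "\<And>Y. (\<lambda>m. cs (F_fps $ Suc m) (\<Sum>i\<le>m. (br w ^^ i) (br \<eta> ((br w ^^ (m - i)) Y))))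
          sums D_plus G e X R (e w) Y"
        by (rule D_plus_sums[OF w, of X]) (rule that)
      from this[of Y] have "(\<lambda>m. 0) sums D_plus G e X R (e w) Y"
        by (simp add: 0)
      then show ?thesis
        using sums_0 sums_unique2 by blast
    qed
    ultimately show ?thesis
      using True by (simp add: cdybe_term_def br.zero_left B.zero_left)
  next
    case False
    obtain C \<rho> \<delta> where \<delta>: "0 < \<delta>" "ereal \<rho> < fps_conv_radius F_fps"
      "\<And>w'. w' \<in> ball w \<delta> \<Longrightarrow> power_bounded (br w') C \<rho>"
      by (rule taylor_power_bounded[OF open_g0 w taylor_summable_F_fps F_fps_conv_radius])
         (assumption, rule that)
    have "ereal \<rho> < ereal (2 * pi)"
      using \<delta>(2) fps_conv_radius_F_nu[OF False] unfolding F by (rule less_le_trans)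
    then have "\<rho> < 2 * pi"
      by simp
    from cdybe_sums[OF w \<delta>(3) \<delta>(2) this, of X Y Z] \<delta>(1)
    have "(\<lambda>n. cdybe_coeff (*) F_fps n (cubic_form w X Y Z))
        sums (cdybe_term w X Y Z + cdybe_term w Y Z X + cdybe_term w Z X Y)"
      by simp
    moreover have "(\<lambda>n. cdybe_coeff (*) F_fps n (cubic_form w X Y Z)) sums ((1/4 - \<nu>\<^sup>2) * B (br X Y) Z)"
      unfolding F cdybe_coeff_cubic_form
      using sums_single[of 0 "\<lambda>n. (1/4 - \<nu>\<^sup>2) * B (br X Y) Z"] by simp
    ultimately show ?thesis
      by (rule sums_unique2)
  qed
qed

lemma PL_CDYBE_imp_recursion:
  assumes PL: "PL_CDYBE br B G e (e ` g\<^sub>0) R \<mu>"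
  shows "solution_recursion F_fps n = (if n = 0 then \<mu> else 0)"
proof -
  obtain w u l where l: "l \<noteq> 0" "u \<noteq> 0" "br w u = cs l u"
    by (rule nonzero_ad_eigenvector)
  obtain Y where Y: "B u Y \<noteq> 0"
    using B_nondegenerate l(2) by blast
  \<comment> \<open>This is B [u, Y] w: by cyclicity it equals B [w, u] Y. Being nonzero, it can be
    divided out at the end.\<close>
  define b where "b = l * B u Y"
  have b: "b \<noteq> 0"
    using l Y by (simp add: b_def)
  have "0 < min (fps_conv_radius F_fps) (ereal (2 * pi))"
    using F_fps_conv_radius by simp
  then obtain \<rho> where \<rho>: "0 < \<rho>" "ereal \<rho> < fps_conv_radius F_fps" "\<rho> < 2 * pi"
    using ereal_dense2[of 0 "min (fps_conv_radius F_fps) (ereal (2 * pi))"] by auto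
  obtain \<delta> where \<delta>: "0 < \<delta>" "\<And>w. w \<in> ball 0 \<delta> \<Longrightarrow> power_bounded (br w) 1 \<rho>"
    using power_bounded_small[OF \<rho>(1)] by blast
  have "((\<lambda>x. cs (- x / l) w) \<longlongrightarrow> cs (- 0 / l) w) (nhds 0)"
    using l(1) by (intro bounded_bilinear.tendsto[OF bounded_bilinear_cs] tendsto_intros filterlim_ident)
  from topological_tendstoD[OF this, of "g\<^sub>0 \<inter> ball 0 \<delta>"]
  have ev: "\<forall>\<^sub>F x in nhds 0. cs (- x / l) w \<in> g\<^sub>0 \<inter> ball 0 \<delta>"
    using open_Int[OF open_g0 open_ball] zero_g0 \<delta>(1) by simp
  have "\<forall>\<^sub>F x in nhds 0. (\<lambda>n. Abs_fps (solution_recursion F_fps) $ n * x ^ n) sums \<mu>"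
    using ev
  proof eventually_elim
    case (elim x)
    \<comment> \<open>Complex rescaling of w makes u an eigenvector of \<open>br v\<close> with
      eigenvalue -x, so the equation becomes a power series in x.\<close>
    define s v where "s = - x / l" and "v = cs s w"
    have v: "v \<in> g\<^sub>0" "v \<in> ball 0 \<delta>"
      using elim by (auto simp: v_def s_def)
    have sl: "s * l = - x"
      using l(1) by (simp add: s_def)
    have u: "(br v ^^ i) u = cs ((s * l) ^ i) u" for i
      by (induction i) (simp_all add: v_def br_scale_left br_scale_right l(3) mult.commute mult.left_commute)
    have vw: "br v w = 0"
      by (simp add: v_def br_scale_left br_self)
    have w: "(br v ^^ k) w = (if k = 0 then w else 0)" for k
      by (induction k) (simp_all add: vw br.zero_right)
    \<comment> \<open>Terms with k > 0 vanish since v commutes with w. Moving the j-th power from Y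
      to u gives (-1)^j (-x)^j = x^j, so only the sign (-1)^i survives.\<close>
    have form: "cubic_form v u Y w i j k = x ^ n * b * ((-1) ^ i * 1 ^ j * 0 ^ k)" if n: "i + j + k = n" for i j k n
    proof (cases "k = 0")
      case True
      have "B u ((br v ^^ j) Y) = (-1) ^ j * ((-1) ^ j * B u ((br v ^^ j) Y))"
        by (simp flip: power_mult_distrib mult.assoc)
      also have "\<dots> = (-1) ^ j * ((s * l) ^ j * B u Y)"
        by (simp only: B_skew_funpow[symmetric] u B_scale_left)
      finally have uY: "B u ((br v ^^ j) Y) = (-1) ^ j * ((s * l) ^ j * B u Y)" .
      have "cubic_form v u Y w i j k = (s * l) ^ i * B (br u ((br v ^^ j) Y)) w"
        by (simp add: cubic_form_def True u br_scale_left B_scale_left)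
      also have "B (br u ((br v ^^ j) Y)) w = l * B u ((br v ^^ j) Y)"
        by (simp only: B_cyclic[of w u, symmetric] l(3) B_scale_left)
      finally have "cubic_form v u Y w i j k = (s * l) ^ i * (s * l) ^ j * (-1) ^ j * b"
        by (simp add: uY b_def)
      also have "(s * l) ^ i * (s * l) ^ j = (-1) ^ i * (-1) ^ j * x ^ n"
        using n True unfolding sl power_add[symmetric] by (simp add: power_minus[of x])
      also have "(-1) ^ i * (-1) ^ j * x ^ n * (-1) ^ j * b = x ^ n * b * (-1) ^ i * ((-1) ^ j * (-1) ^ j)"
        by (simp only: ac_simps)
      finally show ?thesis
        by (simp add: True flip: power_mult_distrib)
    next
      case False
      then show ?thesis
        by (simp add: cubic_form_def w B.zero_right)
    qed
    have coeff: "cdybe_coeff (*) F_fps n (cubic_form v u Y w) = b * (solution_recursion F_fps n * x ^ n)" for n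
    proof -
      have "cdybe_coeff (*) F_fps n (cubic_form v u Y w)
          = cdybe_coeff (*) F_fps n (\<lambda>i j k. x ^ n * b * ((-1) ^ i * 1 ^ j * 0 ^ k))"
        by (rule cdybe_coeff_cong) (rule form)
      also have "\<dots> = x ^ n * b * solution_recursion F_fps n"
        unfolding solution_recursion_def by (rule cdybe_coeff_mult)
      finally show ?thesis
        by (simp only: ac_simps)
    qed
    have "B (br u Y) w = b"
      by (simp only: B_cyclic[of w u, symmetric] l(3) B_scale_left b_def)
    then have "cdybe_term v u Y w + cdybe_term v Y w u + cdybe_term v w u Y = b * \<mu>"
      using PL v(1) by (simp add: PL_CDYBE_iff mult.commute)
    with cdybe_sums[OF v(1) \<delta>(2)[OF v(2)] \<rho>(2,3), of u Y w]
    have "(\<lambda>n. b * (solution_recursion F_fps n * x ^ n)) sums (b * \<mu>)"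
      by (simp only: coeff)
    then show ?case
      using b by (simp add: sums_mult_iff)
  qed
  \<comment> \<open>The series equals a constant on a whole neighbourhood of 0, so its coefficients
    can be compared.\<close>
  then have "(\<lambda>x. \<mu>) has_fps_expansion Abs_fps (solution_recursion F_fps)"
    by (rule has_fps_expansionI)
  with has_fps_expansion_const[of \<mu>] have "fps_const \<mu> = Abs_fps (solution_recursion F_fps)"
    by (rule fps_expansion_unique_complex)
  then have "Abs_fps (solution_recursion F_fps) $ n = fps_const \<mu> $ n"
    by simp
  then show ?thesis
    by simp
qed

lemma PL_CDYBE_classification:
  assumes odd: "\<forall>\<^sub>F z in nhds 0. F (- z) = - F z"
  shows "PL_CDYBE br B G e (e ` g\<^sub>0) R \<mu> \<longleftrightarrow>
    (\<exists>\<nu>. \<mu> = 1/4 - \<nu>\<^sup>2 \<and> (\<forall>\<^sub>F z in nhds 0. F z = F_nu \<nu> z))"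
proof
  assume PL: "PL_CDYBE br B G e (e ` g\<^sub>0) R \<mu>"
  \<comment> \<open>Either square root will do: nu coth (nu z) is even in nu.\<close>
  define \<nu> where "\<nu> = csqrt (1/4 - \<mu>)"
  have \<mu>: "\<mu> = 1/4 - \<nu>\<^sup>2"
    by (simp add: \<nu>_def)
  have "F_fps = F_nu_fps \<nu>"
    by (rule solution_recursion_unique)
       (simp_all add: F_fps_even_nth[OF odd] F_nu_fps_even_nth PL_CDYBE_imp_recursion[OF PL]
         solution_recursion_F_nu \<mu>)
  then show "\<exists>\<nu>. \<mu> = 1/4 - \<nu>\<^sup>2 \<and> (\<forall>\<^sub>F z in nhds 0. F z = F_nu \<nu> z)"
    using \<mu> F_eq_F_nu_iff by blast
next
  assume "\<exists>\<nu>. \<mu> = 1/4 - \<nu>\<^sup>2 \<and> (\<forall>\<^sub>F z in nhds 0. F z = F_nu \<nu> z)"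
  then show "PL_CDYBE br B G e (e ` g\<^sub>0) R \<mu>"
    using PL_CDYBE_F_nu F_eq_F_nu_iff by blast
qed

end

theorem proposition2:
  fixes cs :: "complex \<Rightarrow> 'a::euclidean_space \<Rightarrow> 'a"
    and br :: "'a \<Rightarrow> 'a \<Rightarrow> 'a"
    and B :: "'a \<Rightarrow> 'a \<Rightarrow> complex"
    and G :: "'g monoid"
    and T :: "'g topology"
    and A :: "('g, 'a) chart set"
    and U :: "'g set"
    and \<kappa> :: "'g \<Rightarrow> 'a"
    and e :: "'a \<Rightarrow> 'g"
    and F :: "complex \<Rightarrow> complex"
    and g\<^sub>0 :: "'a set"
    and R :: "'g \<Rightarrow> 'a \<Rightarrow> 'a"
    and \<mu> :: complex
  assumes "simple_complex_lie_algebra cs br"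
    and "invariant_scalar_product cs br B"
    and "complex_lie_group_with_lie_algebra cs br G T A U \<kappa>"
    and "connected_space T"
    and "exponential_map G T \<kappa> e"
    and "F analytic_on {0}"
    and "\<forall>\<^sub>F z in nhds 0. F (- z) = - F z"
    and "open g\<^sub>0" and "0 \<in> g\<^sub>0"
    and "\<forall>g\<in>carrier G. \<forall>\<omega>\<in>g\<^sub>0. Ad G U \<kappa> g \<omega> \<in> g\<^sub>0"
    and "openin T (e ` g\<^sub>0)"
    and "biholomorphic_map cs (top_of_set g\<^sub>0) {(g\<^sub>0, id)}
           cs (subtopology T (e ` g\<^sub>0)) (open_submanifold_atlas A (e ` g\<^sub>0)) e"
    and "\<forall>\<omega>\<in>g\<^sub>0. taylor_summable cs F (br \<omega>)"
    and "\<forall>\<omega>\<in>g\<^sub>0. R (e \<omega>) = taylor_apply cs F (br \<omega>)"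
  shows "(PL_CDYBE br B G e (e ` g\<^sub>0) R \<mu> \<longleftrightarrow>
           (\<exists>\<nu>. \<mu> = 1/4 - \<nu>\<^sup>2 \<and> (\<forall>\<^sub>F z in nhds 0. F z = F_nu \<nu> z))) \<and>
         (\<forall>\<nu>. F_nu \<nu> analytic_on {0} \<and> (\<forall>z. F_nu \<nu> (- z) = - F_nu \<nu> z))"
proof -
  have "lie_group_with_exp cs br G T A U \<kappa> e"
    using assms by (simp add: lie_group_with_exp_def)
  then interpret taylor_on_exp_domain cs br G T A U \<kappa> e F g\<^sub>0 R B
    using assms by (simp add: taylor_on_exp_domain_def taylor_on_exp_domain_axioms_def)
  have "F_nu \<nu> analytic_on {0}" for \<nu>
    by (rule has_fps_expansion_imp_analytic_0[OF F_nu_has_fps_expansion])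
  then show ?thesis
    using PL_CDYBE_classification[OF assms(7)] F_nu_odd by blast
qed

end
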